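(* There exist Slovak spaces. Moreover, the entropies of Slovak spaces exhaust the interval $[0,\infty]$; that is, for every $s\in[0,\infty]$ there exists a Slovak space whose entropy equals $s$.
   Context: All spaces are metric. A homeomorphism $T:X\to X$ of a compact metric space is minimal if every forward orbit $\{T^nx:n\ge0\}$ is dense in $X$. $H(X,X)$ denotes the group of all self-homeomorphisms of $X$. A compact metric space $X$ is called a Slovak space if it has at least three elements, admits a minimal homeomorphism $T$, and $H(X,X)=\{T^n:n\in\mathbb Z\}$. For a Slovak space, $H(X,X)$ is infinite cyclic, so it has exactly two generators $T$ and $T^{-1}$, which have the same topological entropy; the entropy of the Slovak space $X$ is by definition the topological entropy $h_{\mathrm{top}}(T)\in[0,\infty]$ of a generator $T$. *)

theory Defs
  imports "HOL-Analysis.Analysis" "HOL-Algebra.Bij"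
begin

text \<open>
  As in \<^const>\<open>BijGroup\<close>, self-maps of the space are extensional, so that two of them
  are equal as soon as they agree on the points of the space.
\<close>

definition homeo_group :: "'a metric \<Rightarrow> ('a \<Rightarrow> 'a) monoid" where
  "homeo_group X = BijGroup (mspace X)
     \<lparr>carrier := {f \<in> Bij (mspace X). homeomorphic_map (mtopology_of X) (mtopology_of X) f}\<rparr>"

lemma group_homeo_group: "group (homeo_group X)"
proof -
  let ?S = "mspace X" and ?T = "mtopology_of X"
  let ?H = "{f \<in> Bij ?S. homeomorphic_map ?T ?T f}"
  have "subgroup ?H (BijGroup ?S)"
  proof (rule group.subgroupI[OF group_BijGroup])
    show "?H \<subseteq> carrier (BijGroup ?S)"
      by (auto simp: BijGroup_def)
    have "homeomorphic_map ?T ?T (\<lambda>x\<in>?S. x)"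
      by (rule homeomorphic_map_eq[of _ _ id]) auto
    then show "?H \<noteq> {}"
      using id_Bij by blast
  next
    fix f assume f: "f \<in> ?H"
    then obtain g where g: "homeomorphic_maps ?T ?T f g"
      by (auto simp: homeomorphic_map_maps)
    have "g y = inv_into ?S f y" if "y \<in> ?S" for y
    proof -
      have "g y \<in> ?S" "f (g y) = y"
        using g that continuous_map_image_subset_topspace[of ?T ?T g]
        by (auto simp: homeomorphic_maps_def)
      moreover have "inj_on f ?S"
        using f by (auto simp: Bij_def bij_betw_def)
      ultimately show ?thesis
        by (metis inv_into_f_f)
    qed
    moreover have "homeomorphic_map ?T ?T g"
      using g homeomorphic_maps_map by blast
    ultimately have "homeomorphic_map ?T ?T (\<lambda>x\<in>?S. inv_into ?S f x)"
      by (metis (no_types, lifting) homeomorphic_map_eq restrict_apply' topspace_mtopology_of)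
    moreover have "inv\<^bsub>BijGroup ?S\<^esub> f = (\<lambda>x\<in>?S. inv_into ?S f x)"
      using f by (simp add: inv_BijGroup)
    ultimately show "inv\<^bsub>BijGroup ?S\<^esub> f \<in> ?H"
      using f by (auto simp: restrict_inv_into_Bij)
  next
    fix f g assume fg: "f \<in> ?H" "g \<in> ?H"
    have "homeomorphic_map ?T ?T (compose ?S f g)"
    proof (rule homeomorphic_map_eq)
      show "homeomorphic_map ?T ?T (f \<circ> g)"
        using fg homeomorphic_map_compose[of ?T ?T g ?T f] by simp
    qed (simp add: compose_def)
    then show "f \<otimes>\<^bsub>BijGroup ?S\<^esub> g \<in> ?H"
      using fg by (auto simp: BijGroup_def compose_Bij)
  qed
  then have "group (BijGroup ?S\<lparr>carrier := ?H\<rparr>)"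
    by (rule subgroup.subgroup_is_group[OF _ group_BijGroup])
  then show ?thesis
    by (simp add: homeo_group_def)
qed

definition minimal_homeo :: "'a metric \<Rightarrow> ('a \<Rightarrow> 'a) \<Rightarrow> bool" where
  "minimal_homeo X T \<longleftrightarrow> T \<in> carrier (homeo_group X) \<and>
     (\<forall>x \<in> mspace X. Abstract_Topology.closure_of (mtopology_of X) (range (\<lambda>n::nat. (T ^^ n) x)) = mspace X)"

definition homeo_generator :: "'a metric \<Rightarrow> ('a \<Rightarrow> 'a) \<Rightarrow> bool" where
  "homeo_generator X T \<longleftrightarrow> T \<in> carrier (homeo_group X) \<and>
     carrier (homeo_group X) = range (\<lambda>n::int. T [^]\<^bsub>homeo_group X\<^esub> n)"

text \<open>
  Carrier and metric are arbitrary, and a compact metric space has at most continuum many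
  points; hence every Slovak space is isometric to one of type \<^typ>\<open>(nat \<Rightarrow> real) metric\<close>.
\<close>

definition slovak_space :: "'a metric \<Rightarrow> bool" where
  "slovak_space X \<longleftrightarrow> compact_space (mtopology_of X) \<and>
     (\<exists>x \<in> mspace X. \<exists>y \<in> mspace X. \<exists>z \<in> mspace X. x \<noteq> y \<and> x \<noteq> z \<and> y \<noteq> z) \<and>
     (\<exists>T. minimal_homeo X T \<and> homeo_generator X T)"

text \<open>
  Topological entropy of a continuous self-map of a compact metric space, following Bowen.
  The condition below says that distinct points of \<open>E\<close> are more than \<open>\<epsilon>\<close> apart in the metric
  \<open>d\<^sub>n(x, y) = max {d(T\<^sup>i x, T\<^sup>i y) | 0 \<le> i < n}\<close>.
\<close>

definition separated_set ::
    "'a metric \<Rightarrow> ('a \<Rightarrow> 'a) \<Rightarrow> nat \<Rightarrow> real \<Rightarrow> 'a set \<Rightarrow> bool" where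
  "separated_set X T n \<epsilon> E \<longleftrightarrow> E \<subseteq> mspace X \<and>
     (\<forall>x \<in> E. \<forall>y \<in> E. x \<noteq> y \<longrightarrow> (\<exists>i<n. mdist X ((T ^^ i) x) ((T ^^ i) y) > \<epsilon>))"

text \<open>
  If \<open>X\<close> is compact, \<open>T\<close> continuous and \<open>\<epsilon> > 0\<close>, the cardinalities below are bounded, so the
  supremum in \<^typ>\<open>nat\<close> is a maximum.
\<close>

definition separated_card :: "'a metric \<Rightarrow> ('a \<Rightarrow> 'a) \<Rightarrow> nat \<Rightarrow> real \<Rightarrow> nat" where
  "separated_card X T n \<epsilon> = (SUP E \<in> {E. finite E \<and> separated_set X T n \<epsilon> E}. card E)"

text \<open>
  The growth rate is antimonotone in \<open>\<epsilon>\<close>, so its limit as \<open>\<epsilon>\<close> tends to 0 from above is the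
  supremum over all \<open>\<epsilon> > 0\<close>.
\<close>

definition top_entropy :: "'a metric \<Rightarrow> ('a \<Rightarrow> 'a) \<Rightarrow> ereal" where
  "top_entropy X T =
     (SUP \<epsilon> \<in> {0<..}. limsup (\<lambda>n. ereal (ln (real (separated_card X T n \<epsilon>)) / real n)))"

text \<open>
  Meaningful for Slovak spaces only: there the generators are \<open>T\<close> and its inverse, which have
  the same entropy.
\<close>

definition slovak_entropy :: "'a metric \<Rightarrow> ereal" where
  "slovak_entropy X = (THE h. \<exists>T. homeo_generator X T \<and> h = top_entropy X T)"

end

theory Submission
  imports Defs
begin

text \<open>
  Let \<open>Y\<close> be a compact space with a free continuous flow \<open>\<phi>\<close> whose time-one map is minimal and
  whose paths all run along flow lines, and let \<open>y0\<close> be a point of \<open>Y\<close>. There is a function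
  \<open>osc\<close>, continuous off \<open>y0\<close>, that tends to \<open>0\<close> along the flow line from the left of \<open>y0\<close> and
  oscillates like \<open>sin (1/t)\<close> on the right. The closure \<open>Z\<close> of the graph of
  \<open>y \<mapsto> (osc (\<phi> n y))\<^sub>n\<close> is a minimal extension of \<open>Y\<close> in which every point of the orbit of \<open>y0\<close> is
  blown up to an arc. These arcs cut the flow line of \<open>y0\<close> into path components \<open>piece m\<close>,
  which are the only path components that are not dense; moreover \<open>closure (piece m)\<close> meets
  \<open>piece (m - 1)\<close>, in the arc \<open>fiber m\<close>, but no other piece. Hence a homeomorphism of \<open>Z\<close> shifts the
  pieces and the arcs by some \<open>k\<close>. Two points of an arc \<open>fiber m\<close> differ in the coordinate \<open>- m\<close>
  only, so by minimality the homeomorphism is the \<open>k\<close>-th power of the generator. As \<open>y0\<close> is not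
  periodic, visits near \<open>y0\<close> are rare and \<open>Z\<close> has the entropy of \<open>Y\<close>.

  For \<open>Y\<close> take the suspension of a minimal subshift in which every window of a point recurs along
  an arithmetic progression in all points; then the time-\<open>t\<close> maps with \<open>t\<close> irrational are minimal. The
  blocks of order \<open>k + 1\<close> of the subshift consist of a list of blocks of order \<open>k\<close>, of arbitrary
  blocks of order \<open>k\<close>, and of the same list again; the density of the arbitrary part and the size of
  the alphabet determine the entropy.
\<close>

section \<open>Minimal subshifts built from nested blocks\<close>

text \<open>The oscillation is one-sided on purpose. From the left the arc is attached in one point,
  so a piece is half-open with an arc at its right end; from the right the arc is only a limit. The
  incidence between closures and pieces is thus directed, and a homeomorphism may translate the
  chain of pieces but not reverse it. The blow-up also removes the time-\<open>t\<close> maps with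
  \<open>t\<close> not an integer, which are further homeomorphisms of \<open>Y\<close>. Pieces can
  be recognised because paths cannot leave a flow line: transverse to the flow only countably many
  values occur. Countability of the alphabet still admits a convergent sequence with its limit,
  which gives entropy \<infinity>; finite alphabets give the finite values, the entropy being
  \<open>speed * P * ln (card A)\<close> for the limit density \<open>P\<close> of free positions.
  The list of blocks stands at both ends of a block since a window may straddle a boundary. The
  alphabet can be infinite, so the list is a finite net of blocks and recurrence is approximate.
  Minimality of the time-one map then follows from recurrence along a progression of step
  \<open>P\<close> and the irrationality of \<open>speed / P\<close>.\<close>

definition shift :: "int \<Rightarrow> (int \<Rightarrow> 'a) \<Rightarrow> int \<Rightarrow> 'a" where
  "shift a c = (\<lambda>i. c (i + a))"

text \<open>A word of length \<open>p\<close> is any total function of which only the positions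
  \<open>0\<close>, ..., \<open>p - 1\<close> are read. Cutting a word out of a longer word or out
  of a point is then just a \<open>shift\<close>, and equality of words becomes
  \<open>agree\<close>.\<close>

definition agree :: "nat \<Rightarrow> (int \<Rightarrow> 'a) \<Rightarrow> (int \<Rightarrow> 'a) \<Rightarrow> bool" where
  "agree p c d \<longleftrightarrow> (\<forall>i. 0 \<le> i \<and> i < int p \<longrightarrow> c i = d i)"

definition cat :: "nat \<Rightarrow> (nat \<Rightarrow> int \<Rightarrow> 'a) \<Rightarrow> int \<Rightarrow> 'a" where
  "cat p W = (\<lambda>x. W (nat (x div int p)) (x mod int p))"

definition extend_words ::
    "nat \<Rightarrow> (int \<Rightarrow> 'a) set \<Rightarrow> (nat \<Rightarrow> int \<Rightarrow> 'a) \<Rightarrow> nat \<Rightarrow> nat \<Rightarrow> (int \<Rightarrow> 'a) set" where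
  "extend_words p B u q l = {w. (\<forall>i<q. agree p (shift (int (i * p)) w) (u i)) \<and>
     (\<forall>i<l. shift (int ((q + i) * p)) w \<in> B) \<and>
     (\<forall>i<q. agree p (shift (int ((q + l + i) * p)) w) (u i))}"

definition local_words :: "nat \<Rightarrow> (int \<Rightarrow> 'a) set \<Rightarrow> bool" where
  "local_words p B \<longleftrightarrow> (\<forall>w\<in>B. \<forall>w'. agree p w w' \<longrightarrow> w' \<in> B)"

lemma shift_apply [simp]: "shift a c i = c (i + a)"
  by (simp add: shift_def)

lemma shift_0 [simp]: "shift 0 c = c"
  by (simp add: shift_def)

lemma shift_shift [simp]: "shift a (shift b c) = shift (a + b) c"
  by (simp add: shift_def add.assoc)

lemma continuous_on_shift [continuous_intros]:
  fixes f :: "'b::topological_space \<Rightarrow> int \<Rightarrow> 'a::topological_space"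
  assumes "continuous_on S f"
  shows "continuous_on S (\<lambda>x. shift a (f x))"
  by (rule continuous_on_coordinatewise_then_product)
    (use continuous_on_product_then_coordinatewise[OF assms] in simp)

lemma agree_sym: "agree p c d \<Longrightarrow> agree p d c"
  by (simp add: agree_def)

lemma agree_trans: "agree p c d \<Longrightarrow> agree p d e \<Longrightarrow> agree p c e"
  by (simp add: agree_def)

lemma agreeD: "agree p c d \<Longrightarrow> 0 \<le> i \<Longrightarrow> i < int p \<Longrightarrow> c i = d i"
  by (simp add: agree_def)

lemma agree_shift:
  assumes "agree p c d" "0 \<le> a" "a + int m \<le> int p"
  shows "agree m (shift a c) (shift a d)"
  using assms by (auto simp: agree_def)

lemma agree_cat:
  assumes "p > 0"
  shows "agree p (shift (int (i * p)) (cat p W)) (W i)"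
  unfolding agree_def
proof (intro allI impI)
  fix x :: int assume x: "0 \<le> x \<and> x < int p"
  then have "(x + int i * int p) div int p = int i"
    using assms by (simp add: div_mult_self1)
  then show "shift (int (i * p)) (cat p W) x = W i x"
    using x by (simp add: cat_def)
qed

lemma cat_in_extend_words:
  assumes p: "p > 0" and B: "local_words p B" and g: "\<And>i. i < l \<Longrightarrow> g i \<in> B"
  shows "cat p (\<lambda>b. if b < q then u b else if b < q + l then g (b - q) else u (b - (q + l)))
    \<in> extend_words p B u q l" (is "cat p ?W \<in> _")
proof -
  have *: "agree p (shift (int (b * p)) (cat p ?W)) (?W b)" for b
    by (rule agree_cat[OF p])
  have "shift (int ((q + i) * p)) (cat p ?W) \<in> B" if "i < l" for i
    using *[of "q + i"] B g[OF that] that unfolding local_words_def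
    by (simp add: agree_sym)
  moreover have "agree p (shift (int (i * p)) (cat p ?W)) (u i)" if "i < q" for i
    using *[of i] that by simp
  moreover have "agree p (shift (int ((q + l + i) * p)) (cat p ?W)) (u i)" if "i < q" for i
    using *[of "q + l + i"] that by simp
  ultimately show ?thesis
    unfolding extend_words_def by blast
qed

lemma extend_words_block:
  assumes "w \<in> extend_words p B u q l" "local_words p B" "\<And>i. i < q \<Longrightarrow> u i \<in> B" "b < 2 * q + l"
  shows "shift (int (b * p)) w \<in> B"
proof -
  consider "b < q" | i where "b = q + i" "i < l" | i where "b = q + l + i" "i < q"
  proof (cases "b < q")
    case False
    then show ?thesis
      using assms(4) that(2)[of "b - q"] that(3)[of "b - q - l"] by (cases "b - q < l") auto
  qed (rule that)
  then show ?thesis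
  proof cases
    case 1
    then have "agree p (u b) (shift (int (b * p)) w)"
      using assms(1) by (auto simp: extend_words_def intro: agree_sym)
    then show ?thesis
      using assms(2,3) 1 unfolding local_words_def by blast
  next
    case 2
    then show ?thesis
      using assms(1) by (simp add: extend_words_def)
  next
    case 3
    then have "agree p (u i) (shift (int (b * p)) w)"
      using assms(1) by (auto simp: extend_words_def intro: agree_sym)
    then show ?thesis
      using assms(2,3) 3 unfolding local_words_def by blast
  qed
qed

lemma local_extend_words:
  assumes B: "local_words p B"
  shows "local_words ((2 * q + l) * p) (extend_words p B u q l)"
  unfolding local_words_def
proof (intro ballI allI impI)
  fix w w' assume w: "w \<in> extend_words p B u q l" and ag: "agree ((2 * q + l) * p) w w'"
  have *: "agree p (shift (int (b * p)) w) (shift (int (b * p)) w')" if "b < 2 * q + l" for b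
  proof (rule agree_shift[OF ag])
    have "(b + 1) * p \<le> (2 * q + l) * p"
      using that by (intro mult_right_mono) auto
    then show "int (b * p) + int p \<le> int ((2 * q + l) * p)"
      by (metis add.commute mult_Suc of_nat_add of_nat_mono Suc_eq_plus1)
  qed simp
  have 1: "agree p (shift (int (i * p)) w') (u i)" if "i < q" for i
  proof -
    have "agree p (shift (int (i * p)) w) (u i)"
      using w that unfolding extend_words_def by blast
    moreover have "agree p (shift (int (i * p)) w) (shift (int (i * p)) w')"
      using that by (intro *) simp
    ultimately show ?thesis
      by (blast intro: agree_trans agree_sym)
  qed
  have 2: "shift (int ((q + i) * p)) w' \<in> B" if "i < l" for i
    using w that *[of "q + i"] B unfolding extend_words_def local_words_def by auto
  have 3: "agree p (shift (int ((q + l + i) * p)) w') (u i)" if "i < q" for i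
  proof -
    have "agree p (shift (int ((q + l + i) * p)) w) (u i)"
      using w that unfolding extend_words_def by blast
    moreover have "agree p (shift (int ((q + l + i) * p)) w) (shift (int ((q + l + i) * p)) w')"
      using that by (intro *) simp
    ultimately show ?thesis
      by (blast intro: agree_trans agree_sym)
  qed
  show "w' \<in> extend_words p B u q l"
    using 1 2 3 unfolding extend_words_def by blast
qed

text \<open>Rounding the entries down to multiples of \<open>e\<close> leaves finitely many codes on
  the window; one member of \<open>S\<close> per code forms the net. The net must lie in
  \<open>S\<close> because its elements serve as blocks themselves.\<close>

lemma word_net:
  fixes S :: "(int \<Rightarrow> real) set"
  assumes S: "\<And>w x. w \<in> S \<Longrightarrow> 0 \<le> x \<Longrightarrow> x < int p \<Longrightarrow> w x \<in> {0..1}" and e: "e > 0"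
  obtains F where "finite F" "F \<subseteq> S"
    "\<And>w. w \<in> S \<Longrightarrow> \<exists>f\<in>F. \<forall>x. 0 \<le> x \<and> x < int p \<longrightarrow> \<bar>w x - f x\<bar> < e"
proof -
  define \<kappa> where "\<kappa> w = (\<lambda>x\<in>{0..<int p}. \<lfloor>w x / e\<rfloor>)" for w :: "int \<Rightarrow> real"
  have "\<kappa> ` S \<subseteq> PiE {0..<int p} (\<lambda>_. {0..\<lfloor>1 / e\<rfloor>})"
    using S e by (auto simp: \<kappa>_def intro!: floor_mono divide_right_mono)
  then have "finite (\<kappa> ` S)"
    by (rule finite_subset) (intro finite_PiE, auto)
  then obtain F where F: "F \<subseteq> S" "finite F" "\<kappa> ` S = \<kappa> ` F"
    by (meson finite_subset_image subset_refl)
  show ?thesis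
  proof (rule that[OF F(2,1)])
    fix w assume "w \<in> S"
    then obtain f where f: "f \<in> F" "\<kappa> w = \<kappa> f"
      using F(3) by blast
    have "\<bar>w x - f x\<bar> < e" if "0 \<le> x" "x < int p" for x
    proof -
      have "\<lfloor>w x / e\<rfloor> = \<lfloor>f x / e\<rfloor>"
        using fun_cong[OF f(2), of x] that by (simp add: \<kappa>_def)
      then have "\<bar>w x / e - f x / e\<bar> < 1"
        by linarith
      then show ?thesis
        using e by (simp add: field_simps flip: diff_divide_distrib)
    qed
    then show "\<exists>f\<in>F. \<forall>x. 0 \<le> x \<and> x < int p \<longrightarrow> \<bar>w x - f x\<bar> < e"
      using f(1) by blast
  qed
qed

text \<open>The two copies of the net \<open>u\<close> may be padded, so that the density of free positions
  can be lowered to any value just above \<open>P\<close>.\<close>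

lemma extension_exists:
  fixes B :: "(int \<Rightarrow> real) set" and P d :: real
  assumes "p > 0" "r > 0" "B \<noteq> {}" "0 \<le> P" "P < real r / real p" "d > 0"
    and vals: "\<forall>w\<in>B. \<forall>x. 0 \<le> x \<and> x < int p \<longrightarrow> w x \<in> {0..1}" and e: "e > 0"
  obtains u and q l :: nat where "q > 0" "l > 0" "\<forall>i<q. u i \<in> B"
    "\<forall>w\<in>B. \<exists>i<q. \<forall>x. 0 \<le> x \<and> x < int p \<longrightarrow> \<bar>w x - u i x\<bar> < e"
    "P < real (r * l) / real ((2 * q + l) * p)" "real (r * l) / real ((2 * q + l) * p) < P + d"
proof -
  obtain F where F: "finite F" "F \<subseteq> B"
    "\<And>w. w \<in> B \<Longrightarrow> \<exists>f\<in>F. \<forall>x. 0 \<le> x \<and> x < int p \<longrightarrow> \<bar>w x - f x\<bar> < e"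
    by (rule word_net[of B p e]) (use vals e in auto)
  have "F \<noteq> {}"
    using F(3) \<open>B \<noteq> {}\<close> by blast
  obtain xs where xs: "set xs = F"
    using F(1) finite_list by blast
  define n where "n = length xs"
  have "n > 0"
    using \<open>F \<noteq> {}\<close> xs by (auto simp: n_def)
  define \<rho> where "\<rho> = real r / real p"
  have \<rho>: "\<rho> > 0" "P < \<rho>"
    using assms by (auto simp: \<rho>_def)
  \<comment> \<open>\<open>\<rho>\<close> is the density of free positions so far and
    \<open>x\<close> the factor by which the next order changes it: \<open>\<rho> * x\<close> has to
    lie between \<open>P\<close> and \<open>P + d\<close>, and \<open>x < 1\<close> leaves room for
    the fixed list.\<close>
  have "P / \<rho> < min 1 ((P + d) / \<rho>)"
    using \<rho> \<open>d > 0\<close> by (auto simp: divide_strict_right_mono)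
  then obtain x where x: "x \<in> \<rat>" "P / \<rho> < x" "x < min 1 ((P + d) / \<rho>)"
    using Rats_dense_in_real by blast
  have "0 \<le> P / \<rho>"
    using \<rho> \<open>0 \<le> P\<close> by simp
  then have "x > 0"
    using x(2) by linarith
  obtain l0 m0 :: nat where m0: "m0 \<noteq> 0" "\<bar>x\<bar> = real l0 / real m0"
    using Rats_abs_nat_div_natE[OF x(1)] by metis
  then have xe: "x = real l0 / real m0"
    using \<open>x > 0\<close> by simp
  have "l0 > 0" "l0 < m0"
    using x(3) \<open>x > 0\<close> m0(1) by (auto simp: xe field_simps)
  \<comment> \<open>With these values \<open>2 * q + l = 2 * n * m0\<close>, so
    \<open>l / (2 * q + l) = x\<close>; the multiple \<open>n\<close> lets \<open>u\<close> run
    through the whole list \<open>xs\<close> periodically.\<close>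
  define q where "q = (m0 - l0) * n"
  define l where "l = 2 * n * l0"
  have ml: "2 * q + l = 2 * n * m0"
  proof -
    obtain d where "m0 = l0 + d"
      using \<open>l0 < m0\<close> less_imp_add_positive by blast
    then show ?thesis
      by (simp add: q_def l_def algebra_simps)
  qed
  define u where "u i = xs ! (i mod n)" for i
  have ratio: "real (r * l) / real ((2 * q + l) * p) = \<rho> * x"
    using \<open>n > 0\<close> unfolding ml by (simp add: \<rho>_def xe l_def field_simps)
  show ?thesis
  proof (rule that[of q l u])
    show "q > 0" "l > 0"
      using \<open>n > 0\<close> \<open>l0 > 0\<close> \<open>l0 < m0\<close> by (auto simp: q_def l_def)
    have "u i \<in> B" for i
    proof -
      have "xs ! (i mod n) \<in> set xs"
        using \<open>n > 0\<close> by (intro nth_mem) (simp add: n_def)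
      then show ?thesis
        using F(2) xs by (auto simp: u_def)
    qed
    then show "\<forall>i<q. u i \<in> B"
      by blast
    show "\<forall>w\<in>B. \<exists>i<q. \<forall>x. 0 \<le> x \<and> x < int p \<longrightarrow> \<bar>w x - u i x\<bar> < e"
    proof
      fix w assume w: "w \<in> B"
      obtain f where f: "f \<in> F" "\<forall>x. 0 \<le> x \<and> x < int p \<longrightarrow> \<bar>w x - f x\<bar> < e"
        using F(3)[OF w] by blast
      then obtain i where i: "i < n" "f = xs ! i"
        using xs by (metis in_set_conv_nth n_def)
      have "n \<le> q"
        using \<open>l0 < m0\<close> by (simp add: q_def Suc_le_eq)
      then show "\<exists>i<q. \<forall>x. 0 \<le> x \<and> x < int p \<longrightarrow> \<bar>w x - u i x\<bar> < e"
        using i f by (intro exI[of _ i]) (auto simp: u_def)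
    qed
    show "P < real (r * l) / real ((2 * q + l) * p)"
      unfolding ratio using x(2) \<rho> by (simp add: field_simps)
    show "real (r * l) / real ((2 * q + l) * p) < P + d"
      unfolding ratio using x(3) \<rho> by (simp add: field_simps)
  qed
qed

lemma int_div_less:
  fixes x m P :: int
  assumes "0 < P" "x < m * P"
  shows "x div P < m"
proof -
  have "x div P * P \<le> x"
    using div_mult_mod_eq[of x P] pos_mod_sign[OF assms(1), of x] by linarith
  then have "x div P * P < m * P"
    using assms(2) by linarith
  then show ?thesis
    using assms(1) by (simp add: mult_less_cancel_right)
qed

lemma compact_nested_nonempty:
  fixes F :: "nat \<Rightarrow> 'a::t2_space set"
  assumes "\<And>n. compact (F n)" "\<And>n. F n \<noteq> {}" "\<And>m n. m \<le> n \<Longrightarrow> F n \<subseteq> F m"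
  shows "\<Inter> (range F) \<noteq> {}"
proof -
  have "F 0 \<inter> \<Inter> (range F) \<noteq> {}"
  proof (rule compact_imp_fip)
    show "compact (F 0)" by (rule assms)
    show "closed T" if "T \<in> range F" for T
      using that assms(1) compact_imp_closed by blast
    fix F' assume "finite F'" "F' \<subseteq> range F"
    then obtain I where I: "finite I" "F' = F ` I"
      by (meson finite_subset_image)
    have "F (Max (insert 0 I)) \<subseteq> F 0 \<inter> \<Inter> F'"
    proof -
      have "F (Max (insert 0 I)) \<subseteq> F i" if "i \<in> insert 0 I" for i
        using that I(1) by (intro assms(3) Max_ge) auto
      then show ?thesis
        unfolding I(2) by blast
    qed
    then show "F 0 \<inter> \<Inter> F' \<noteq> {}"
      using assms(2) by blast
  qed
  then show ?thesis by blast
qed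

text \<open>\<open>r k\<close> counts the free positions among the \<open>p k\<close> positions of a
  block of order \<open>k\<close>. Each block of order \<open>k\<close> recurs, up to
  \<open>1 / Suc k\<close>, in every block of order \<open>Suc k\<close>. Countability of the
  alphabet is used when the paths in the suspension are classified.\<close>

locale block_words =
  fixes A :: "real set" and B :: "nat \<Rightarrow> (int \<Rightarrow> real) set" and p q l r :: "nat \<Rightarrow> nat"
    and u :: "nat \<Rightarrow> nat \<Rightarrow> int \<Rightarrow> real"
  assumes B_0: "B 0 = {w. w 0 \<in> A}"
    and p_0: "p 0 = 1" and r_0: "r 0 = 1"
    and B_Suc: "\<And>k. B (Suc k) = extend_words (p k) (B k) (u k) (q k) (l k)"
    and p_Suc: "\<And>k. p (Suc k) = (2 * q k + l k) * p k"
    and r_Suc: "\<And>k. r (Suc k) = r k * l k"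
    and q_pos: "\<And>k. 0 < q k" and l_pos: "\<And>k. 0 < l k"
    and u_in: "\<And>k i. i < q k \<Longrightarrow> u k i \<in> B k"
    and net: "\<And>k w. w \<in> B k \<Longrightarrow>
      \<exists>i<q k. \<forall>x. 0 \<le> x \<and> x < int (p k) \<longrightarrow> \<bar>w x - u k i x\<bar> < 1 / real (Suc k)"
    and A_closed: "closed A" and A_sub: "A \<subseteq> {0..1}" and A_countable: "countable A"
    and A_two: "\<exists>a\<in>A. \<exists>b\<in>A. a \<noteq> b"
begin

section \<open>Points with a block structure of every order\<close>

definition blocks :: "nat \<Rightarrow> int \<Rightarrow> (int \<Rightarrow> real) \<Rightarrow> bool" where
  "blocks k a c \<longleftrightarrow> (\<forall>j::int. shift (a + j * int (p k)) c \<in> B k)"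

text \<open>The phase \<open>a\<close> may depend on \<open>k\<close> and no compatibility of phases
  is demanded: by \<open>blocks_Suc\<close> a phase for a higher order is one for all lower orders
  as well.\<close>

definition C :: "(int \<Rightarrow> real) set" where
  "C = {c. \<forall>k. \<exists>a. blocks k a c}"

lemma p_pos [simp]: "0 < p k"
  by (induction k) (use q_pos in \<open>auto simp: p_0 p_Suc\<close>)

lemma local_B: "local_words (p k) (B k)"
proof (induction k)
  case 0
  then show ?case
    by (auto simp: local_words_def B_0 p_0 agree_def)
next
  case (Suc k)
  then show ?case
    unfolding B_Suc p_Suc by (rule local_extend_words)
qed

lemma B_cong: "w \<in> B k \<Longrightarrow> agree (p k) w w' \<Longrightarrow> w' \<in> B k"
  using local_B[of k] unfolding local_words_def by blast

lemma sub_block: "w \<in> B (Suc k) \<Longrightarrow> b < 2 * q k + l k \<Longrightarrow> shift (int (b * p k)) w \<in> B k"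
  unfolding B_Suc by (rule extend_words_block[OF _ local_B]) (auto intro: u_in)

lemma B_values: "w \<in> B k \<Longrightarrow> 0 \<le> x \<Longrightarrow> x < int (p k) \<Longrightarrow> w x \<in> A"
proof (induction k arbitrary: w x)
  case 0
  then have "x = 0"
    by (simp add: p_0)
  with 0 show ?case by (simp add: B_0)
next
  case (Suc k)
  define b where "b = nat (x div int (p k))"
  have b: "int b = x div int (p k)"
    using Suc.prems(2) by (simp add: b_def pos_imp_zdiv_nonneg_iff)
  have "b < 2 * q k + l k"
  proof -
    have "x < int (2 * q k + l k) * int (p k)"
      using Suc.prems(3) by (simp add: p_Suc)
    then have "x div int (p k) < int (2 * q k + l k)"
      by (intro int_div_less) auto
    then show ?thesis
      using b by linarith
  qed
  then have "shift (int (b * p k)) w \<in> B k"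
    using sub_block Suc.prems(1) by blast
  then have "shift (int (b * p k)) w (x mod int (p k)) \<in> A"
    by (rule Suc.IH) auto
  then show ?case
    using b by (simp add: mult.commute)
qed

lemma blocks_Suc:
  assumes "blocks (Suc k) a c"
  shows "blocks k a c"
  unfolding blocks_def
proof
  fix j :: int
  define m where "m = 2 * q k + l k"
  have "m > 0"
    using q_pos[of k] by (simp add: m_def)
  \<comment> \<open>Block number \<open>j\<close> of order \<open>k\<close> is block
    \<open>j mod m\<close> inside block number \<open>j div m\<close> of order
    \<open>Suc k\<close>.\<close>
  have "shift (int (nat (j mod int m) * p k)) (shift (a + (j div int m) * int (p (Suc k))) c) \<in> B k"
  proof (rule sub_block)
    show "shift (a + (j div int m) * int (p (Suc k))) c \<in> B (Suc k)"
      using assms unfolding blocks_def by blast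
    show "nat (j mod int m) < 2 * q k + l k"
      using \<open>m > 0\<close> pos_mod_bound[of "int m" j] by (simp only: m_def[symmetric]) (simp add: nat_less_iff)
  qed
  moreover have "int (nat (j mod int m) * p k) + (a + (j div int m) * int (p (Suc k)))
      = a + j * int (p k)"
  proof -
    have "int (nat (j mod int m) * p k) = (j mod int m) * int (p k)"
      using \<open>m > 0\<close> by simp
    moreover have "(j mod int m) * int (p k) + (j div int m) * (int m * int (p k)) = j * int (p k)"
      by (metis distrib_right mod_div_mult_eq mult.assoc)
    ultimately show ?thesis
      by (simp only: p_Suc m_def[symmetric] of_nat_mult)
  qed
  ultimately show "shift (a + j * int (p k)) c \<in> B k"
    by (simp only: shift_shift)
qed

lemma blocks_le: "blocks k a c \<Longrightarrow> j \<le> k \<Longrightarrow> blocks j a c"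
  by (induction k arbitrary: j) (auto simp: le_Suc_eq blocks_Suc)

lemma blocks_shift: "blocks k a c \<Longrightarrow> blocks k (a - s) (shift s c)"
  by (simp add: blocks_def algebra_simps)

lemma blocks_add_period: "blocks k a c \<Longrightarrow> blocks k (a + i * int (p k)) c"
  unfolding blocks_def by (metis add.assoc distrib_right)

lemma shift_C: "c \<in> C \<Longrightarrow> shift s c \<in> C"
  unfolding C_def using blocks_shift by blast

lemma closed_B: "closed (B k)"
proof (induction k)
  case 0
  have "B 0 = (\<lambda>w. w 0) -` A"
    by (auto simp: B_0)
  moreover have "continuous_on UNIV (\<lambda>w::int \<Rightarrow> real. w 0)"
    by (rule continuous_on_product_then_coordinatewise) (rule continuous_on_id)
  ultimately show ?case
    using A_closed by (metis closed_vimage continuous_on_eq_continuous_within continuous_on_closed_vimage closed_UNIV Int_UNIV_right)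
next
  case (Suc k)
  have ev: "continuous_on UNIV (\<lambda>w::int \<Rightarrow> real. w x)" for x
    by (rule continuous_on_product_then_coordinatewise) (rule continuous_on_id)
  have 1: "closed {w. agree (p k) (shift a w) v}" for a and v :: "int \<Rightarrow> real"
    unfolding agree_def shift_apply
    by (intro closed_Collect_all closed_Collect_imp open_Collect_const closed_Collect_eq ev continuous_on_const)
  have 2: "closed {w. shift a w \<in> B k}" for a
  proof -
    have "{w. shift a w \<in> B k} = shift a -` B k"
      by auto
    moreover have "continuous_on UNIV (shift a :: (int \<Rightarrow> real) \<Rightarrow> _)"
      using continuous_on_shift[OF continuous_on_id] .
    ultimately show ?thesis
      using Suc.IH by (metis closed_UNIV continuous_on_closed_vimage Int_UNIV_right)
  qed
  show ?case
    unfolding B_Suc extend_words_def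
    by (intro closed_Collect_conj closed_Collect_all closed_Collect_imp open_Collect_const allI 1 2)
qed

lemma closed_blocks: "closed {c. blocks k a c}"
proof -
  have "closed {w. shift b w \<in> B k}" for b
  proof -
    have "{w. shift b w \<in> B k} = shift b -` B k"
      by auto
    moreover have "continuous_on UNIV (shift b :: (int \<Rightarrow> real) \<Rightarrow> _)"
      using continuous_on_shift[OF continuous_on_id] .
    ultimately show ?thesis
      using closed_B by (metis closed_UNIV continuous_on_closed_vimage Int_UNIV_right)
  qed
  then show ?thesis
    unfolding blocks_def by (intro closed_Collect_all allI)
qed

text \<open>Phases count only modulo \<open>p k\<close>, which turns the existential quantifier into
  a finite union; this is why \<open>C\<close> is closed.\<close>

lemma ex_blocks_eq: "{c. \<exists>a. blocks k a c} = (\<Union>a\<in>{0..<int (p k)}. {c. blocks k a c})"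
proof -
  have "\<exists>b\<in>{0..<int (p k)}. blocks k b c" if "blocks k a c" for a c
  proof
    show "blocks k (a mod int (p k)) c"
      using blocks_add_period[OF that, of "- (a div int (p k))"]
      by (simp add: minus_div_mult_eq_mod)
  qed simp
  then show ?thesis by blast
qed

lemma closed_ex_blocks: "closed {c. \<exists>a. blocks k a c}"
  unfolding ex_blocks_eq by (intro closed_UN ballI closed_blocks) auto

lemma compact_values: "compact (PiE UNIV (\<lambda>_::int. A))"
proof -
  have "compact A"
    using A_closed A_sub by (meson bounded_subset bounded_closed_interval compact_eq_bounded_closed)
  then have "compactin (product_topology (\<lambda>_. euclidean) UNIV) (PiE UNIV (\<lambda>_::int. A))"
    by (simp add: compactin_PiE)
  then show ?thesis
    by (simp add: euclidean_product_topology)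
qed

lemma blocks_values:
  assumes "blocks k a c"
  shows "c x \<in> A"
proof -
  have "shift (a + (x - a) div int (p k) * int (p k)) c \<in> B k"
    using assms unfolding blocks_def by blast
  then have "shift (a + (x - a) div int (p k) * int (p k)) c ((x - a) mod int (p k)) \<in> A"
    by (rule B_values) auto
  moreover have "(x - a) mod int (p k) + (a + (x - a) div int (p k) * int (p k)) = x"
    using div_mult_mod_eq[of "x - a" "int (p k)"] by linarith
  ultimately show ?thesis
    by simp
qed

lemma C_values: "c \<in> C \<Longrightarrow> c x \<in> A"
  unfolding C_def using blocks_values by blast

lemma compact_C: "compact C"
proof -
  have "C \<subseteq> PiE UNIV (\<lambda>_. A)"
    using C_values by auto
  moreover have "closed C"
    unfolding C_def by (intro closed_Collect_all allI closed_ex_blocks)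
  ultimately show ?thesis
    using compact_values by (metis compact_Int_closed inf.absorb_iff2)
qed

lemma blocks_periodic:
  assumes "w \<in> B k"
  shows "blocks k 0 (\<lambda>i. w (i mod int (p k)))"
  unfolding blocks_def by (intro allI B_cong[OF assms]) (simp add: agree_def)

text \<open>At each order the block is placed in the first free slot, right after the
  \<open>q K\<close> blocks of the opening list.\<close>

lemma word_embeds:
  assumes "w \<in> B k" "k \<le> K"
  obtains w' x where "w' \<in> B K" "0 \<le> x" "x + int (p k) \<le> int (p K)" "agree (p k) (shift x w') w"
proof -
  have "\<exists>w' x. w' \<in> B K \<and> 0 \<le> x \<and> x + int (p k) \<le> int (p K) \<and> agree (p k) (shift x w') w"
    using assms(2)
  proof (induction K rule: dec_induct)
    case base
    then show ?case
      using assms(1) by (intro exI[of _ w] exI[of _ 0]) (auto simp: agree_def)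
  next
    case (step K)
    then obtain v x where v: "v \<in> B K" "0 \<le> x" "x + int (p k) \<le> int (p K)" "agree (p k) (shift x v) w"
      by blast
    define v' where "v' = cat (p K)
      (\<lambda>b. if b < q K then u K b else if b < q K + l K then v else u K (b - (q K + l K)))"
    have "v' \<in> B (Suc K)"
      unfolding v'_def B_Suc using v(1) by (intro cat_in_extend_words local_B) auto
    have "agree (p K) (shift (int (q K * p K)) v') v"
      using agree_cat[OF p_pos[of K], of "q K", where W = "\<lambda>b. if b < q K then u K b
        else if b < q K + l K then v else u K (b - (q K + l K))"] l_pos[of K]
      unfolding v'_def by simp
    then have "agree (p k) (shift x (shift (int (q K * p K)) v')) (shift x v)"
      using v by (intro agree_shift)
    then have "agree (p k) (shift (x + int (q K * p K)) v') w"
      using v(4) agree_trans by fastforce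
    moreover have "x + int (q K * p K) + int (p k) \<le> int (p (Suc K))"
    proof -
      have "(q K + 1) * p K \<le> (2 * q K + l K) * p K"
        using l_pos[of K] by (intro mult_right_mono) auto
      then have "int (q K * p K) + int (p K) \<le> int (p (Suc K))"
        unfolding p_Suc by (metis add_mult_distrib mult_1 of_nat_add of_nat_mono)
      then show ?thesis
        using v(3) by linarith
    qed
    ultimately show ?case
      using \<open>v' \<in> B (Suc K)\<close> v(2) by (metis add_nonneg_nonneg of_nat_0_le_iff)
  qed
  then show ?thesis
    using that by blast
qed

text \<open>Repeating a block of order \<open>k + K\<close> that contains \<open>w\<close> gives a
  point with block structure up to this order only. The sets of such points starting with
  \<open>w\<close> are compact and decrease with \<open>K\<close>, and a common point has block
  structure of all orders.\<close>

lemma word_in_C: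
  assumes "w \<in> B k"
  obtains c where "c \<in> C" "agree (p k) c w"
proof -
  define F where "F K = PiE UNIV (\<lambda>_::int. A) \<inter> {c. \<exists>a. blocks (k + K) a c} \<inter> {c. agree (p k) c w}" for K
  have ev: "continuous_on UNIV (\<lambda>w::int \<Rightarrow> real. w x)" for x
    by (rule continuous_on_product_then_coordinatewise) (rule continuous_on_id)
  have cl: "closed {c. agree (p k) c w}"
    unfolding agree_def
    by (intro allI closed_Collect_all closed_Collect_imp open_Collect_const closed_Collect_eq ev continuous_on_const)
  have "\<Inter> (range F) \<noteq> {}"
  proof (rule compact_nested_nonempty)
    fix K
    show "compact (F K)"
      unfolding F_def by (intro compact_Int_closed compact_values closed_ex_blocks cl)
    obtain w' x where w': "w' \<in> B (k + K)" "0 \<le> x" "x + int (p k) \<le> int (p (k + K))"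
      "agree (p k) (shift x w') w"
      using word_embeds[OF assms le_add1] by metis
    define c where "c = shift x (\<lambda>i. w' (i mod int (p (k + K))))"
    have "blocks (k + K) (0 - x) c"
      unfolding c_def by (intro blocks_shift blocks_periodic w')
    moreover have "agree (p k) c w"
      using w'(2-4) by (auto simp: agree_def c_def)
    ultimately have "c \<in> F K"
      using blocks_values unfolding F_def by blast
    then show "F K \<noteq> {}"
      by blast
  next
    fix K L :: nat assume "K \<le> L"
    then show "F L \<subseteq> F K"
      unfolding F_def using blocks_le[of "k + L" _ _ "k + K"] by auto
  qed
  then obtain c where c: "\<And>K. c \<in> F K"
    by blast
  have "\<exists>a. blocks K a c" for K
    using c[of K] blocks_le[of "k + K" _ c K] unfolding F_def by auto
  then show ?thesis
    using that[of c] c[of 0] unfolding C_def F_def by blast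
qed

section \<open>Recurrence of windows along arithmetic progressions\<close>

lemma less_p: "k < p k"
proof (induction k)
  case (Suc k)
  have "2 * p k \<le> (2 * q k + l k) * p k"
    using q_pos[of k] by (intro mult_right_mono) auto
  then show ?case
    using Suc unfolding p_Suc by linarith
qed (simp add: p_0)

text \<open>A window of a point of \<open>C\<close> lies inside a block, which is approximated in the net of the
  next level, or it meets two neighbouring blocks, whose adjacent ends are always the same.\<close>

lemma window_recurs:
  assumes c': "c' \<in> C" and e: "e > 0"
  obtains P :: nat where "P > 0"
    "\<And>c. c \<in> C \<Longrightarrow> \<exists>a. \<forall>j i. \<bar>i\<bar> \<le> int N \<longrightarrow> \<bar>c (a + j * int P + i) - c' i\<bar> < e"
proof -
  obtain k0 :: nat where "1 / e < real k0"
    using reals_Archimedean2 by blast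
  \<comment> \<open>\<open>k0\<close> makes the lists precise to less than \<open>e\<close>; the
    summand \<open>2 * N + 1\<close> makes blocks of order \<open>k\<close> longer than
    \<open>2 * N\<close>, so the window from \<open>- N\<close> to \<open>N\<close> stays within one
    block of order \<open>k\<close> on either side of a boundary that it meets.\<close>
  define k where "k = k0 + 2 * N + 1"
  have k: "2 * N < p k" "1 / real (Suc (Suc k)) < e"
  proof -
    show "2 * N < p k"
      using less_p[of k] by (simp add: k_def)
    have "1 / e < real (Suc (Suc k))"
      using \<open>1 / e < real k0\<close> by (simp add: k_def)
    then show "1 / real (Suc (Suc k)) < e"
      using e by (simp add: field_simps)
  qed
  define P1 where "P1 = int (p (Suc k))"
  have "P1 > 0"
    by (simp add: P1_def)
  have pP: "int (p k) \<le> P1"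
    using q_pos[of k] by (simp add: P1_def p_Suc)
  obtain a' where a': "blocks (Suc k) a' c'"
    using c' unfolding C_def by blast
  define b where "b = (- int N - a') div P1"
  define s where "s = (- int N - a') mod P1"
  have bs: "- int N = a' + b * P1 + s" "0 \<le> s" "s < P1"
    using div_mult_mod_eq[of "- int N - a'" P1] \<open>P1 > 0\<close> by (auto simp: b_def s_def)
  \<comment> \<open>\<open>s\<close> is the offset of the left end \<open>- N\<close> of the window
    in its block of order \<open>Suc k\<close>; the condition says that the window ends inside the
    same block.\<close>
  show ?thesis
  proof (cases "s + 2 * int N < P1")
    case True
    define w where "w = shift (a' + b * P1) c'"
    have "w \<in> B (Suc k)"
      using a' unfolding blocks_def w_def P1_def by blast
    then obtain i0 where i0: "i0 < q (Suc k)"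
      "\<And>x. 0 \<le> x \<Longrightarrow> x < P1 \<Longrightarrow> \<bar>w x - u (Suc k) i0 x\<bar> < 1 / real (Suc (Suc k))"
      using net[of w "Suc k"] unfolding P1_def by blast
    show ?thesis
    proof (rule that)
      show "p (Suc (Suc k)) > 0" by simp
      fix c assume "c \<in> C"
      then obtain a where a: "blocks (Suc (Suc k)) a c"
        unfolding C_def by blast
      \<comment> \<open>Every block of order \<open>Suc (Suc k)\<close> contains an approximate copy
        of \<open>w\<close> as entry \<open>i0\<close> of its opening list, so there is one copy per
        period \<open>p (Suc (Suc k))\<close>, always at the same place.\<close>
      define a0 where "a0 = a + int i0 * P1 - (a' + b * P1)"
      have "\<bar>c (a0 + j * int (p (Suc (Suc k))) + i) - c' i\<bar> < e" if i: "\<bar>i\<bar> \<le> int N" for i j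
      proof -
        define x where "x = i - (a' + b * P1)"
        have x: "0 \<le> x" "x < P1"
          using i bs True by (auto simp: x_def)
        have "shift (a + j * int (p (Suc (Suc k)))) c \<in> B (Suc (Suc k))"
          using a unfolding blocks_def by blast
        then have "agree (p (Suc k)) (shift (int (i0 * p (Suc k))) (shift (a + j * int (p (Suc (Suc k)))) c))
            (u (Suc k) i0)"
          unfolding B_Suc[of "Suc k"] extend_words_def using i0(1) by blast
        then have "c (x + (int (i0 * p (Suc k)) + (a + j * int (p (Suc (Suc k)))))) = u (Suc k) i0 x"
          using x unfolding agree_def P1_def by auto
        moreover have "x + (int (i0 * p (Suc k)) + (a + j * int (p (Suc (Suc k)))))
            = a0 + j * int (p (Suc (Suc k))) + i"
          by (simp add: x_def a0_def P1_def)
        moreover have "w x = c' i"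
          by (simp add: w_def x_def)
        ultimately show ?thesis
          using i0(2)[OF x] k(2) by (metis abs_minus_commute less_trans)
      qed
      then show "\<exists>a. \<forall>j i. \<bar>i\<bar> \<le> int N \<longrightarrow> \<bar>c (a + j * int (p (Suc (Suc k))) + i) - c' i\<bar> < e"
        by blast
    qed
  next
    case False
    define z where "z = a' + (b + 1) * P1"
    have z: "- int N < z" "z \<le> int N"
      using bs False by (auto simp: z_def algebra_simps)
    \<comment> \<open>\<open>v\<close> is the common pattern around a boundary between two blocks of
      order \<open>Suc k\<close>: on the left the last entry of the closing list, on the right the
      first entry of the opening list.\<close>
    define v where "v x = (if x < 0 then u k (q k - 1) (x + int (p k)) else u k 0 x)" for x
    have boundary: "c (a + j * P1 + x) = v x" if a: "blocks (Suc k) a c" and x: "\<bar>x\<bar> < int (p k)"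
      for a j x c
    proof (cases "x < 0")
      case True
      have "shift (a + (j - 1) * P1) c \<in> B (Suc k)"
        using a unfolding blocks_def P1_def by blast
      then have "agree (p k) (shift (int ((q k + l k + (q k - 1)) * p k)) (shift (a + (j - 1) * P1) c))
          (u k (q k - 1))"
        unfolding B_Suc extend_words_def using q_pos[of k]
        by (metis (no_types, lifting) diff_less less_one mem_Collect_eq)
      then have "c (x + int (p k) + (int ((q k + l k + (q k - 1)) * p k) + (a + (j - 1) * P1)))
          = u k (q k - 1) (x + int (p k))"
        using True x unfolding agree_def by auto
      moreover have "P1 = int (p k) + int ((q k + l k + (q k - 1)) * p k)"
      proof -
        have "p (Suc k) = p k + (q k + l k + (q k - 1)) * p k"
          using q_pos[of k] unfolding p_Suc by (cases "q k") (simp_all add: algebra_simps)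
        then show ?thesis
          unfolding P1_def by simp
      qed
      ultimately show ?thesis
        using True by (simp add: v_def algebra_simps)
    next
      case False
      have "shift (a + j * P1) c \<in> B (Suc k)"
        using a unfolding blocks_def P1_def by blast
      then have "agree (p k) (shift (int (0 * p k)) (shift (a + j * P1) c)) (u k 0)"
        unfolding B_Suc extend_words_def using q_pos[of k] by blast
      then show ?thesis
        using False x by (auto simp: agree_def v_def add.commute)
    qed
    show ?thesis
    proof (rule that)
      show "p (Suc k) > 0" by simp
      fix c assume "c \<in> C"
      then obtain a where a: "blocks (Suc k) a c"
        unfolding C_def by blast
      have "\<bar>c ((a - z) + j * int (p (Suc k)) + i) - c' i\<bar> < e" if i: "\<bar>i\<bar> \<le> int N" for i j
      proof -
        have x: "\<bar>i - z\<bar> < int (p k)"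
          using i z k(1) by linarith
        have "c ((a - z) + j * int (p (Suc k)) + i) = v (i - z)"
          using boundary[OF a x, of j] by (simp add: P1_def algebra_simps)
        moreover have "c' i = v (i - z)"
          using boundary[OF a' x, of "b + 1"] by (simp add: z_def)
        ultimately show ?thesis
          using e by simp
      qed
      then show "\<exists>a. \<forall>j i. \<bar>i\<bar> \<le> int N \<longrightarrow> \<bar>c (a + j * int (p (Suc k)) + i) - c' i\<bar> < e"
        by blast
    qed
  qed
qed

section \<open>Counting words, and absence of periods\<close>

lemma many_words:
  assumes F: "finite F" "F \<subseteq> A" and "\<eta> > 0"
    and gap: "\<And>a b. a \<in> F \<Longrightarrow> b \<in> F \<Longrightarrow> a \<noteq> b \<Longrightarrow> \<eta> \<le> \<bar>a - b\<bar>"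
  obtains G where "finite G" "G \<subseteq> B k" "card G = card F ^ r k"
    "\<forall>w\<in>G. \<forall>w'\<in>G. w \<noteq> w' \<longrightarrow> (\<exists>x. 0 \<le> x \<and> x < int (p k) \<and> \<eta> \<le> \<bar>w x - w' x\<bar>)"
proof -
  have "\<exists>G. finite G \<and> G \<subseteq> B k \<and> card G = card F ^ r k \<and>
    (\<forall>w\<in>G. \<forall>w'\<in>G. w \<noteq> w' \<longrightarrow> (\<exists>x. 0 \<le> x \<and> x < int (p k) \<and> \<eta> \<le> \<bar>w x - w' x\<bar>))"
  proof (induction k)
    case 0
    have "inj_on (\<lambda>a (i::int). a) F"
      by (auto simp: inj_on_def fun_eq_iff)
    then have "card ((\<lambda>a (i::int). a) ` F) = card F"
      by (rule card_image)
    moreover have "\<exists>x. 0 \<le> x \<and> x < int (p 0) \<and> \<eta> \<le> \<bar>w x - w' x\<bar>"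
      if "w \<in> (\<lambda>a i. a) ` F" "w' \<in> (\<lambda>a i. a) ` F" "w \<noteq> w'" for w w' :: "int \<Rightarrow> real"
    proof -
      have "\<eta> \<le> \<bar>w 0 - w' 0\<bar>"
        using that gap by blast
      then show ?thesis
        by (intro exI[of _ 0]) (simp add: p_0)
    qed
    moreover have "(\<lambda>a (i::int). a) ` F \<subseteq> B 0"
      using F(2) unfolding B_0 by blast
    moreover have "finite ((\<lambda>a (i::int). a) ` F)"
      using F(1) by blast
    ultimately show ?case
      unfolding r_0 power_one_right by blast
  next
    case (Suc k)
    obtain G where G: "finite G" "G \<subseteq> B k" "card G = card F ^ r k"
      and sepG: "\<forall>w\<in>G. \<forall>w'\<in>G. w \<noteq> w' \<longrightarrow>
        (\<exists>x. 0 \<le> x \<and> x < int (p k) \<and> \<eta> \<le> \<bar>w x - w' x\<bar>)"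
      using Suc.IH by (elim exE conjE)
    \<comment> \<open>Only the \<open>l k\<close> free slots vary. A difference in a slot is kept at
      its place, so separated choices give separated words, and
      \<open>(card F ^ r k) ^ l k = card F ^ r (Suc k)\<close>.\<close>
    define glue where "glue g = cat (p k)
      (\<lambda>b. if b < q k then u k b else if b < q k + l k then g (b - q k) else u k (b - (q k + l k)))" for g
    let ?S = "PiE {..<l k} (\<lambda>_. G)"
    have free: "agree (p k) (shift (int ((q k + i) * p k)) (glue g)) (g i)" if "i < l k" for g i
      using agree_cat[OF p_pos[of k], of "q k + i", where W = "\<lambda>b. if b < q k then u k b
        else if b < q k + l k then g (b - q k) else u k (b - (q k + l k))"] that
      unfolding glue_def by simp
    have sep: "\<exists>x. 0 \<le> x \<and> x < int (p (Suc k)) \<and> \<eta> \<le> \<bar>glue g x - glue g' x\<bar>"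
      if gs: "g \<in> ?S" "g' \<in> ?S" "g \<noteq> g'" for g g'
    proof -
      obtain i where i: "i < l k" "g i \<noteq> g' i"
        using PiE_ext[OF gs(1,2)] gs(3) by (metis lessThan_iff)
      then have "g i \<in> G" "g' i \<in> G"
        using gs by auto
      then obtain x where x: "0 \<le> x" "x < int (p k)" "\<eta> \<le> \<bar>g i x - g' i x\<bar>"
        using sepG i(2) by blast
      have "(q k + i + 1) * p k \<le> (2 * q k + l k) * p k"
        using i(1) by (intro mult_right_mono) auto
      then have "int ((q k + i) * p k) + int (p k) \<le> int (p (Suc k))"
        unfolding p_Suc by (metis add_mult_distrib mult_1 of_nat_add of_nat_mono)
      then have "x + int ((q k + i) * p k) < int (p (Suc k))"
        using x(2) by linarith
      moreover have "glue h (x + int ((q k + i) * p k)) = h i x" for h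
        using agreeD[OF free[OF i(1), of h] x(1,2)] by simp
      ultimately show ?thesis
        using x by (intro exI[of _ "x + int ((q k + i) * p k)"]) simp
    qed
    have "inj_on glue ?S"
    proof (rule inj_onI, rule ccontr)
      fix g g' assume "g \<in> ?S" "g' \<in> ?S" "glue g = glue g'" "g \<noteq> g'"
      then show False
        using sep[of g g'] \<open>\<eta> > 0\<close> by auto
    qed
    then have "card (glue ` ?S) = card F ^ r (Suc k)"
      by (simp add: card_image card_PiE G(3) r_Suc power_mult)
    moreover have "glue g \<in> B (Suc k)" if "g \<in> ?S" for g
      unfolding glue_def B_Suc using that G(2) by (intro cat_in_extend_words local_B) auto
    moreover have "finite (glue ` ?S)"
      using G(1) by (intro finite_imageI finite_PiE) auto
    moreover have "\<forall>w\<in>glue ` ?S. \<forall>w'\<in>glue ` ?S. w \<noteq> w' \<longrightarrow>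
        (\<exists>x. 0 \<le> x \<and> x < int (p (Suc k)) \<and> \<eta> \<le> \<bar>w x - w' x\<bar>)"
    proof (intro ballI impI)
      fix w w' assume "w \<in> glue ` ?S" "w' \<in> glue ` ?S" "w \<noteq> w'"
      then obtain g g' where "g \<in> ?S" "g' \<in> ?S" "g \<noteq> g'" "w = glue g" "w' = glue g'"
        by blast
      then show "\<exists>x. 0 \<le> x \<and> x < int (p (Suc k)) \<and> \<eta> \<le> \<bar>w x - w' x\<bar>"
        using sep by simp
    qed
    moreover have "glue ` ?S \<subseteq> B (Suc k)"
      using calculation(2) by blast
    ultimately show ?case
      by (intro exI[of _ "glue ` ?S"] conjI)
  qed
  then obtain G where "finite G" "G \<subseteq> B k" "card G = card F ^ r k"
    and "\<forall>w\<in>G. \<forall>w'\<in>G. w \<noteq> w' \<longrightarrow> (\<exists>x. 0 \<le> x \<and> x < int (p k) \<and> \<eta> \<le> \<bar>w x - w' x\<bar>)"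
    by (elim exE conjE)
  then show ?thesis
    by (intro that[of G])
qed

text \<open>By recurrence a period of one point is a period of all points of \<open>C\<close>.
  Blocks of order \<open>Suc k\<close> with \<open>p k > j\<close> all start with
  \<open>u k 0\<close>, which covers a full period, so any two of them would coincide; but two
  symbols already give more than one such block.\<close>

lemma not_periodic:
  assumes c: "c \<in> C" and per: "\<And>i. c (i + j) = c i" and j: "j > 0"
  shows False
proof -
  have all: "c' (i + j) = c' i" if c': "c' \<in> C" for c' i
  proof (rule ccontr)
    assume "c' (i + j) \<noteq> c' i"
    then have "\<bar>c' (i + j) - c' i\<bar> / 2 > 0"
      by simp
    then obtain P :: nat where "\<exists>a. \<forall>j' i'. \<bar>i'\<bar> \<le> int (nat (\<bar>i\<bar> + j)) \<longrightarrow>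
        \<bar>c (a + j' * int P + i') - c' i'\<bar> < \<bar>c' (i + j) - c' i\<bar> / 2"
      using window_recurs[OF c', of _ "nat (\<bar>i\<bar> + j)"] c by metis
    then obtain a where a: "\<And>j' i'. \<bar>i'\<bar> \<le> int (nat (\<bar>i\<bar> + j)) \<Longrightarrow>
        \<bar>c (a + j' * int P + i') - c' i'\<bar> < \<bar>c' (i + j) - c' i\<bar> / 2"
      by blast
    have "\<bar>c (a + i) - c' i\<bar> < \<bar>c' (i + j) - c' i\<bar> / 2"
      using a[of i 0] j by simp
    moreover have "\<bar>c (a + (i + j)) - c' (i + j)\<bar> < \<bar>c' (i + j) - c' i\<bar> / 2"
      using a[of "i + j" 0] j by simp
    moreover have "c (a + (i + j)) = c (a + i)"
      using per[of "a + i"] by (simp add: add.assoc)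
    ultimately show False
      by (simp add: abs_if split: if_splits)
  qed
  obtain x y where xy: "x \<in> A" "y \<in> A" "x \<noteq> y"
    using A_two by blast
  define k where "k = nat j"
  have xyF: "finite {x, y}" "{x, y} \<subseteq> A" "\<bar>x - y\<bar> > 0"
    "\<And>a b. a \<in> {x, y} \<Longrightarrow> b \<in> {x, y} \<Longrightarrow> a \<noteq> b \<Longrightarrow> \<bar>x - y\<bar> \<le> \<bar>a - b\<bar>"
    using xy by (auto simp: abs_minus_commute)
  obtain G where G: "finite G" "G \<subseteq> B (Suc k)" "card G = card {x, y} ^ r (Suc k)"
    and sepG: "\<forall>w\<in>G. \<forall>w'\<in>G. w \<noteq> w' \<longrightarrow>
      (\<exists>i. 0 \<le> i \<and> i < int (p (Suc k)) \<and> \<bar>x - y\<bar> \<le> \<bar>w i - w' i\<bar>)"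
    by (rule many_words[OF xyF, of "Suc k"])
  have r: "r m > 0" for m
    by (induction m) (use l_pos in \<open>auto simp: r_0 r_Suc\<close>)
  have "card G > 1"
  proof -
    have "card {x, y} = 2"
      using xy by simp
    then show ?thesis
      unfolding G(3) using one_less_power[OF _ r[of "Suc k"], of "2::nat"] by (metis one_less_numeral_iff semiring_norm(76))
  qed
  then obtain w w' where w: "w \<in> G" "w' \<in> G" "w \<noteq> w'"
    by (metis One_nat_def card_le_Suc0_iff_eq G(1) not_less)
  obtain i where i: "0 \<le> i" "i < int (p (Suc k))" "\<bar>x - y\<bar> \<le> \<bar>w i - w' i\<bar>"
    using sepG w by blast
  obtain d where d: "d \<in> C" "agree (p (Suc k)) d w"
    using word_in_C w(1) G(2) by blast
  obtain d' where d': "d' \<in> C" "agree (p (Suc k)) d' w'"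
    using word_in_C w(2) G(2) by blast
  have start: "agree (p k) v (u k 0)" if "v \<in> B (Suc k)" for v
  proof -
    have "agree (p k) (shift (int (0 * p k)) v) (u k 0)"
      using that q_pos[of k] unfolding B_Suc extend_words_def by blast
    then show ?thesis
      by simp
  qed
  have "int (p k) \<le> int (p (Suc k))"
    using q_pos[of k] by (simp add: p_Suc)
  have "j < int (p k)"
    using less_p[of k] j by (simp add: k_def)
  have period: "e i = e (i mod j)" if "e \<in> C" for e
  proof -
    have "e (m + int n * j) = e m" for n :: nat and m
    proof (induction n)
      case (Suc n)
      then show ?case
        using all[OF that, of "m + int n * j"] by (simp add: algebra_simps)
    qed simp
    from this[of "i mod j" "nat (i div j)"] show ?thesis
      using i(1) j by (simp add: pos_imp_zdiv_nonneg_iff mod_div_mult_eq)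
  qed
  have im: "0 \<le> i mod j" "i mod j < int (p k)" "i mod j < int (p (Suc k))"
    using j \<open>j < int (p k)\<close> \<open>int (p k) \<le> int (p (Suc k))\<close> pos_mod_bound[of j i] pos_mod_sign[of j i] by linarith+
  have "w i = d i"
    using agreeD[OF d(2) i(1,2)] by simp
  also have "\<dots> = d (i mod j)"
    by (rule period[OF d(1)])
  also have "\<dots> = u k 0 (i mod j)"
    using agreeD[OF d(2) im(1,3)] agreeD[OF start im(1,2)] w(1) G(2) by auto
  also have "\<dots> = d' (i mod j)"
    using agreeD[OF d'(2) im(1,3)] agreeD[OF start im(1,2)] w(2) G(2) by auto
  also have "\<dots> = d' i"
    using period[OF d'(1)] by simp
  also have "\<dots> = w' i"
    using agreeD[OF d'(2) i(1,2)] by simp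
  finally show False
    using i(3) xy by simp
qed

lemma C_nonempty: "C \<noteq> {}"
proof -
  obtain w where "w \<in> B 0"
    using A_two by (auto simp: B_0)
  then show ?thesis
    using word_in_C by blast
qed

text \<open>A block of order \<open>Suc k\<close> is determined by the blocks in its
  \<open>l k\<close> free slots. Restriction to the positions in use makes words that agree equal,
  so that they can be counted.\<close>

lemma card_words:
  assumes "finite A"
  shows "finite ((\<lambda>w. restrict w {0..<int (p k)}) ` B k) \<and>
    card ((\<lambda>w. restrict w {0..<int (p k)}) ` B k) \<le> card A ^ r k"
proof (induction k)
  case 0
  let ?f = "\<lambda>a. \<lambda>i\<in>{0..<int (p 0)}. a"
  have "{0..<int (p 0)} = {0}"
    by (auto simp: p_0)
  then have "(\<lambda>w. restrict w {0..<int (p 0)}) ` B 0 \<subseteq> ?f ` A"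
    by (auto simp: B_0 image_iff fun_eq_iff restrict_def intro!: bexI)
  moreover have "finite (?f ` A)" "card (?f ` A) \<le> card A"
    using assms card_image_le by auto
  ultimately show ?case
    unfolding r_0 power_one_right by (meson card_mono finite_subset order_trans)
next
  case (Suc k)
  let ?R = "\<lambda>w. restrict w {0..<int (p k)}" and ?R' = "\<lambda>w. restrict w {0..<int (p (Suc k))}"
  define W where "W g b = (if b < q k then u k b else if b < q k + l k then g (b - q k)
    else u k (b - (q k + l k)))" for g b
  define dec where "dec g = ?R' (cat (p k) (W g))" for g
  let ?S = "PiE {..<l k} (\<lambda>_. ?R ` B k)"
  have "?R' w \<in> dec ` ?S" if w: "w \<in> B (Suc k)" for w
  proof
    define g where "g = (\<lambda>i\<in>{..<l k}. ?R (shift (int ((q k + i) * p k)) w))"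
    show "g \<in> ?S"
      using w unfolding g_def B_Suc extend_words_def by auto
    have "w x = cat (p k) (W g) x" if x: "0 \<le> x" "x < int (p (Suc k))" for x
    proof -
      define b where "b = nat (x div int (p k))"
      have b: "int b = x div int (p k)"
        using x(1) by (simp add: b_def pos_imp_zdiv_nonneg_iff)
      have "x div int (p k) < int (2 * q k + l k)"
        using x(2) by (intro int_div_less) (auto simp: p_Suc)
      then have "b < 2 * q k + l k"
        using b by linarith
      define y where "y = x mod int (p k)"
      have y: "0 \<le> y" "y < int (p k)"
        by (auto simp: y_def)
      have xy: "x = y + int (b * p k)"
        using b by (simp add: y_def)
      have "w x = W g b y"
      proof (cases "b < q k")
        case True
        then have "agree (p k) (shift (int (b * p k)) w) (u k b)"
          using w unfolding B_Suc extend_words_def by blast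
        then show ?thesis
          using agreeD[OF _ y] True unfolding xy W_def by fastforce
      next
        case nq: False
        show ?thesis
        proof (cases "b < q k + l k")
          case True
          then have "b - q k < l k" "q k + (b - q k) = b"
            using nq by auto
          then have "g (b - q k) = ?R (shift (int (b * p k)) w)"
            unfolding g_def by (simp only: restrict_apply' lessThan_iff)
          then show ?thesis
            using nq True y unfolding xy W_def by simp
        next
          case False
          then have "b - (q k + l k) < q k" "q k + l k + (b - (q k + l k)) = b"
            using \<open>b < 2 * q k + l k\<close> by auto
          then have "agree (p k) (shift (int (b * p k)) w) (u k (b - (q k + l k)))"
            using w unfolding B_Suc extend_words_def by (metis (no_types, lifting) mem_Collect_eq)
          then show ?thesis
            using agreeD[OF _ y] False nq unfolding xy W_def by fastforce
        qed
      qed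
      then show ?thesis
        by (simp add: cat_def b_def y_def)
    qed
    then show "?R' w = dec g"
      by (auto simp: dec_def restrict_def fun_eq_iff)
  qed
  then have sub: "?R' ` B (Suc k) \<subseteq> dec ` ?S"
    by blast
  have "finite ?S"
    using Suc by (intro finite_PiE) (auto simp del: restrict_apply)
  then have "finite (?R' ` B (Suc k))"
    using sub by (meson finite_imageI finite_subset)
  moreover have "card (?R' ` B (Suc k)) \<le> card ?S"
    using sub \<open>finite ?S\<close> by (meson card_image_le card_mono finite_imageI order_trans)
  moreover have "card ?S \<le> card A ^ r (Suc k)"
    using Suc by (simp add: card_PiE r_Suc power_mult power_mono del: restrict_apply)
  ultimately show ?case
    by linarith
qed

text \<open>A window of length \<open>n\<close> is determined by its phase, one of
  \<open>p k\<close>, and by the at most \<open>n div p k + 2\<close> blocks of order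
  \<open>k\<close> that it meets; \<open>dec\<close> is the decoding map.\<close>

lemma card_windows:
  assumes "finite A"
  shows "finite ((\<lambda>c. restrict c {s..<s + int n}) ` C)" (is ?fin)
    and "card ((\<lambda>c. restrict c {s..<s + int n}) ` C) \<le> p k * (card A ^ r k) ^ (n div p k + 2)" (is ?le)
proof -
  let ?W = "{s..<s + int n}" and ?J = "{..<n div p k + 2}"
  let ?R = "\<lambda>w. restrict w {0..<int (p k)}"
  let ?S = "{0..<int (p k)} \<times> PiE ?J (\<lambda>_. ?R ` B k)"
  define dec :: "int \<times> (nat \<Rightarrow> int \<Rightarrow> real) \<Rightarrow> int \<Rightarrow> real"
    where "dec = (\<lambda>(a, g). restrict (\<lambda>x. g (nat ((x - s + a) div int (p k))) ((x - s + a) mod int (p k))) ?W)"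
  have "restrict c ?W \<in> dec ` ?S" if c: "c \<in> C" for c
  proof -
    obtain a' where a': "blocks k a' c"
      using c unfolding C_def by blast
    define a where "a = (s - a') mod int (p k)"
    have a: "0 \<le> a" "a < int (p k)"
      by (auto simp: a_def)
    have "blocks k (a' + ((s - a') div int (p k)) * int (p k)) c"
      by (rule blocks_add_period[OF a'])
    moreover have "a' + ((s - a') div int (p k)) * int (p k) = s - a"
      using div_mult_mod_eq[of "s - a'" "int (p k)"] unfolding a_def by linarith
    ultimately have bl: "blocks k (s - a) c"
      by simp
    define g where "g = (\<lambda>j\<in>?J. ?R (shift (s - a + int j * int (p k)) c))"
    have "g \<in> PiE ?J (\<lambda>_. ?R ` B k)"
      using bl unfolding g_def blocks_def by auto
    moreover have "restrict c ?W = dec (a, g)"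
    proof
      fix x
      show "restrict c ?W x = dec (a, g) x"
      proof (cases "x \<in> ?W")
        case True
        define j where "j = nat ((x - s + a) div int (p k))"
        have j: "int j = (x - s + a) div int (p k)"
          using True a by (simp add: j_def pos_imp_zdiv_nonneg_iff)
        have "x - s + a < int n + int (p k)"
          using True a by auto
        also have "\<dots> < int (n div p k + 2) * int (p k)"
          using dividend_less_times_div[OF p_pos[of k], of n]
          by (simp only: of_nat_mult[symmetric] of_nat_add[symmetric] of_nat_less_iff) (simp add: algebra_simps)
        finally have "j < n div p k + 2"
          using j int_div_less[of "int (p k)"] by (metis of_nat_less_iff of_nat_0_less_iff p_pos)
        moreover have "(x - s + a) mod int (p k) + (s - a + int j * int (p k)) = x"
          using div_mult_mod_eq[of "x - s + a" "int (p k)"] unfolding j by linarith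
        ultimately show ?thesis
          using True by (simp add: dec_def g_def flip: j_def)
      next
        case False
        then show ?thesis
          unfolding dec_def case_prod_conv by (simp only: restrict_apply if_False)
      qed
    qed
    ultimately show ?thesis
      using a by auto
  qed
  then have sub: "(\<lambda>c. restrict c ?W) ` C \<subseteq> dec ` ?S"
    by blast
  have "finite ?S"
    using card_words[OF assms, of k] by (intro finite_SigmaI finite_PiE) auto
  then show ?fin
    using sub by (meson finite_imageI finite_subset)
  have "card ((\<lambda>c. restrict c ?W) ` C) \<le> card ?S"
    using sub \<open>finite ?S\<close> by (meson card_image_le card_mono finite_imageI order_trans)
  also have "\<dots> \<le> p k * (card A ^ r k) ^ (n div p k + 2)"
    using card_words[OF assms, of k]
    by (simp add: card_cartesian_product card_PiE del: restrict_apply power_add_numeral power_Suc add_2_eq_Suc')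
  finally show ?le .
qed

end

section \<open>Blocks with a prescribed limit density of free positions\<close>

lemma block_words_exist:
  fixes A :: "real set" and P :: real
  assumes A: "closed A" "A \<subseteq> {0..1}" "countable A" "\<exists>a\<in>A. \<exists>b\<in>A. a \<noteq> b"
    and P: "0 \<le> P" "P < 1"
  obtains B p q l r u where "block_words A B p q l r u"
    "(\<lambda>k. real (r k) / real (p k)) \<longlonglongrightarrow> P" "\<And>k. P < real (r k) / real (p k)"
proof -
  \<comment> \<open>\<open>ok\<close> is the invariant of the recursive choice and
    \<open>next_ok\<close> one extension step. The density starts at \<open>1\<close>, stays
    strictly above \<open>P\<close> by \<open>ok\<close> and falls below
    \<open>P + 1 / Suc k\<close> by \<open>next_ok\<close>, so it tends to \<open>P\<close>.\<close>
  define ok :: "nat \<Rightarrow> (int \<Rightarrow> real) set \<times> nat \<times> nat \<Rightarrow> bool" where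
    "ok k = (\<lambda>(B, p, r). 0 < p \<and> 0 < r \<and> B \<noteq> {} \<and> local_words p B \<and>
      (\<forall>w\<in>B. \<forall>x. 0 \<le> x \<and> x < int p \<longrightarrow> w x \<in> A) \<and> P < real r / real p \<and>
      (k = 0 \<longrightarrow> B = {w. w 0 \<in> A} \<and> p = 1 \<and> r = 1))" for k
  define next_ok :: "nat \<Rightarrow> (int \<Rightarrow> real) set \<times> nat \<times> nat \<Rightarrow> (int \<Rightarrow> real) set \<times> nat \<times> nat \<Rightarrow>
      (nat \<Rightarrow> int \<Rightarrow> real) \<times> nat \<times> nat \<Rightarrow> bool" where
    "next_ok k = (\<lambda>(B, p, r) (B', p', r') (u, q, l). B' = extend_words p B u q l \<and> p' = (2 * q + l) * p \<and>
       r' = r * l \<and> 0 < q \<and> 0 < l \<and> (\<forall>i<q. u i \<in> B) \<and>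
       (\<forall>w\<in>B. \<exists>i<q. \<forall>x. 0 \<le> x \<and> x < int p \<longrightarrow> \<bar>w x - u i x\<bar> < 1 / real (Suc k)) \<and>
       real r' / real p' < P + 1 / real (Suc k))" for k
  have "\<exists>S. \<forall>k. ok k (S k) \<and> (\<exists>t. next_ok k (S k) (S (Suc k)) t)"
  proof (rule dependent_nat_choice)
    have "ok 0 ({w. w 0 \<in> A}, 1, 1)"
    proof -
      obtain a where "a \<in> A"
        using A(4) by blast
      then have ne: "{w :: int \<Rightarrow> real. w 0 \<in> A} \<noteq> {}"
        by (auto intro!: exI[of _ "\<lambda>_. a"])
      have loc: "local_words 1 {w :: int \<Rightarrow> real. w 0 \<in> A}"
        by (auto simp: local_words_def agree_def)
      have vals: "\<forall>w\<in>{w. w 0 \<in> A}. \<forall>x. 0 \<le> x \<and> x < int 1 \<longrightarrow> w x \<in> A"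
      proof (intro ballI allI impI)
        fix w :: "int \<Rightarrow> real" and x :: int
        assume w: "w \<in> {w. w 0 \<in> A}" and "0 \<le> x \<and> x < int 1"
        then have "x = 0"
          by simp
        then show "w x \<in> A"
          using w by simp
      qed
      show ?thesis
        unfolding ok_def prod.case by (intro conjI impI ne loc vals refl) (use P(2) in simp_all)
    qed
    then show "\<exists>S. ok 0 S" ..
  next
    fix S :: "(int \<Rightarrow> real) set \<times> nat \<times> nat" and k
    obtain B p r where S: "S = (B, p, r)"
      by (cases S) auto
    assume "ok k S"
    then have ok: "0 < p" "0 < r" "B \<noteq> {}" "local_words p B" "P < real r / real p"
      and vals: "\<And>w x. w \<in> B \<Longrightarrow> 0 \<le> x \<Longrightarrow> x < int p \<Longrightarrow> w x \<in> A"
      by (auto simp: S ok_def)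
    have unit: "\<forall>w\<in>B. \<forall>x. 0 \<le> x \<and> x < int p \<longrightarrow> w x \<in> {0..1}"
      using vals A(2) by blast
    have pos: "1 / real (Suc k) > 0"
      by simp
    obtain u q l where u: "q > 0" "l > 0" "\<forall>i<q. u i \<in> B"
      "\<forall>w\<in>B. \<exists>i<q. \<forall>x. 0 \<le> x \<and> x < int p \<longrightarrow> \<bar>w x - u i x\<bar> < 1 / real (Suc k)"
      "P < real (r * l) / real ((2 * q + l) * p)"
      "real (r * l) / real ((2 * q + l) * p) < P + 1 / real (Suc k)"
      by (rule extension_exists[OF ok(1-3) P(1) ok(5) pos unit pos])
    define B' where "B' = extend_words p B u q l"
    have nx: "next_ok k S (B', (2 * q + l) * p, r * l) (u, q, l)"
      unfolding next_ok_def S B'_def using u by simp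
    obtain v where "v \<in> B"
      using ok(3) by blast
    then have "B' \<noteq> {}"
      using cat_in_extend_words[OF ok(1,4), of l "\<lambda>_. v"] unfolding B'_def by blast
    moreover have "w x \<in> A" if "w \<in> B'" "0 \<le> x" "x < int ((2 * q + l) * p)" for w x
    proof -
      define b where "b = nat (x div int p)"
      have b: "int b = x div int p"
        using that(2) by (simp add: b_def pos_imp_zdiv_nonneg_iff ok(1))
      have "x div int p < int (2 * q + l)"
        using that(3) ok(1) by (intro int_div_less) auto
      then have "b < 2 * q + l"
        using b by linarith
      then have "shift (int (b * p)) w \<in> B"
        using that(1) ok(4) u(3) unfolding B'_def by (intro extend_words_block) auto
      then have "shift (int (b * p)) w (x mod int p) \<in> A"
        by (rule vals) (use ok(1) in auto)
      then show ?thesis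
        using b by (simp add: mult.commute)
    qed
    moreover have "local_words ((2 * q + l) * p) B'"
      unfolding B'_def by (rule local_extend_words[OF ok(4)])
    ultimately have "ok (Suc k) (B', (2 * q + l) * p, r * l)"
      unfolding ok_def using u(1,2,5) ok(1,2) by simp
    then show "\<exists>S'. ok (Suc k) S' \<and> (\<exists>t. next_ok k S S' t)"
      using nx by blast
  qed
  then obtain S where S': "\<forall>k. ok k (S k) \<and> (\<exists>t. next_ok k (S k) (S (Suc k)) t)"
    by (rule exE)
  have S: "ok k (S k)" "\<exists>t. next_ok k (S k) (S (Suc k)) t" for k
    using S'[rule_format, of k] by simp_all
  \<comment> \<open>The lists and the numbers \<open>q\<close> and \<open>l\<close> are only
    witnesses of the single steps so far; a second choice fixes them.\<close>
  have "\<exists>t. \<forall>k. next_ok k (S k) (S (Suc k)) (t k)"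
    using S(2) by (intro choice allI)
  then obtain t where t: "\<forall>k. next_ok k (S k) (S (Suc k)) (t k)"
    by (rule exE)
  define B p r u q l where "B k = fst (S k)" and "p k = fst (snd (S k))" and "r k = snd (snd (S k))"
    and "u k = fst (t k)" and "q k = fst (snd (t k))" and "l k = snd (snd (t k))" for k
  note defs = B_def p_def r_def u_def q_def l_def
  have ok: "0 < p k \<and> 0 < r k \<and> P < real (r k) / real (p k) \<and>
      (k = 0 \<longrightarrow> B k = {w. w 0 \<in> A} \<and> p k = 1 \<and> r k = 1)" for k
    using S(1)[of k] unfolding ok_def defs case_prod_unfold by (elim conjE) (intro conjI)
  have nx: "B (Suc k) = extend_words (p k) (B k) (u k) (q k) (l k) \<and> p (Suc k) = (2 * q k + l k) * p k \<and>
       r (Suc k) = r k * l k \<and> 0 < q k \<and> 0 < l k \<and> (\<forall>i<q k. u k i \<in> B k) \<and>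
       (\<forall>w\<in>B k. \<exists>i<q k. \<forall>x. 0 \<le> x \<and> x < int (p k) \<longrightarrow> \<bar>w x - u k i x\<bar> < 1 / real (Suc k)) \<and>
       real (r (Suc k)) / real (p (Suc k)) < P + 1 / real (Suc k)" for k
    using t[rule_format, of k] unfolding next_ok_def defs case_prod_unfold .
  have "block_words A B p q l r u"
  proof
    show "B 0 = {w. w 0 \<in> A}" "p 0 = 1" "r 0 = 1"
      using ok[of 0] by simp_all
  next
    fix k
    show "B (Suc k) = extend_words (p k) (B k) (u k) (q k) (l k)" "p (Suc k) = (2 * q k + l k) * p k"
      "r (Suc k) = r k * l k" "0 < q k" "0 < l k"
      using nx[of k] by (simp_all only: simp_thms)
  next
    fix k i assume "i < q k"
    moreover have "\<forall>i<q k. u k i \<in> B k"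
      using nx[of k] by (elim conjE)
    ultimately show "u k i \<in> B k"
      by simp
  next
    fix k w assume "w \<in> B k"
    moreover have "\<forall>w\<in>B k. \<exists>i<q k. \<forall>x. 0 \<le> x \<and> x < int (p k) \<longrightarrow> \<bar>w x - u k i x\<bar> < 1 / real (Suc k)"
      using nx[of k] by (elim conjE)
    ultimately show "\<exists>i<q k. \<forall>x. 0 \<le> x \<and> x < int (p k) \<longrightarrow> \<bar>w x - u k i x\<bar> < 1 / real (Suc k)"
      by (rule bspec[rotated])
  qed (rule A)+
  moreover have "(\<lambda>k. real (r (Suc k)) / real (p (Suc k))) \<longlonglongrightarrow> P"
  proof (rule tendsto_sandwich)
    have "P < real (r (Suc k)) / real (p (Suc k))" for k
      using ok[of "Suc k"] by (elim conjE)
    then show "eventually (\<lambda>k. P \<le> real (r (Suc k)) / real (p (Suc k))) sequentially"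
      by (intro always_eventually allI less_imp_le)
    have "real (r (Suc k)) / real (p (Suc k)) < P + 1 / real (Suc k)" for k
      using nx[of k] by (elim conjE)
    then show "eventually (\<lambda>k. real (r (Suc k)) / real (p (Suc k)) \<le> P + 1 / real (Suc k)) sequentially"
      by (intro always_eventually allI less_imp_le)
    show "(\<lambda>k. P + 1 / real (Suc k)) \<longlonglongrightarrow> P"
      using tendsto_add[OF tendsto_const LIMSEQ_Suc[OF lim_inverse_n'], of P] by simp
  qed simp
  then have "(\<lambda>k. real (r k) / real (p k)) \<longlonglongrightarrow> P"
    by (rule LIMSEQ_imp_Suc)
  moreover have "P < real (r k) / real (p k)" for k
    using ok[of k] by (elim conjE)
  ultimately show ?thesis
    by (rule that)
qed

section \<open>Transport along an injection, and entropy of integer actions\<close>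

text \<open>The construction yields a subset of a product type, but the spaces are to live over one
  fixed type. The metric is carried along \<open>e\<close>, which thereby becomes an isometry, so a
  mere injection suffices.\<close>

definition image_metric :: "('a::metric_space \<Rightarrow> 'b) \<Rightarrow> 'a set \<Rightarrow> 'b metric" where
  "image_metric e S = metric (e ` S, \<lambda>a b. dist (inv_into S e a) (inv_into S e b))"

lemma Metric_space_image:
  assumes "inj_on e S"
  shows "Metric_space (e ` S) (\<lambda>a b. dist (inv_into S e a) (inv_into S e b))"
  by unfold_locales (use assms in \<open>auto simp: dist_commute dist_triangle\<close>)

lemma mspace_image_metric: "inj_on e S \<Longrightarrow> mspace (image_metric e S) = e ` S"
  unfolding image_metric_def by (rule Metric_space.mspace_metric[OF Metric_space_image])

lemma mdist_image_metric:
  "inj_on e S \<Longrightarrow> x \<in> S \<Longrightarrow> y \<in> S \<Longrightarrow> mdist (image_metric e S) (e x) (e y) = dist x y"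
  unfolding image_metric_def by (simp add: Metric_space.mdist_metric[OF Metric_space_image])

lemma homeomorphic_maps_image_metric:
  assumes "inj_on e S"
  shows "homeomorphic_maps (top_of_set S) (mtopology_of (image_metric e S)) e (inv_into S e)"
proof -
  interpret Metric_space12 S dist "e ` S" "\<lambda>a b. dist (inv_into S e a) (inv_into S e b)"
    using Metric_space_image[OF assms] Metric_space.subspace[OF Met_TC.Metric_space_axioms, of S]
    by (simp add: Metric_space12_def)
  have "Metric_space.mtopology S (dist :: 'a \<Rightarrow> _) = top_of_set S"
  proof -
    interpret Submetric UNIV dist S
      by unfold_locales simp
    show ?thesis
      using mtopology_submetric by simp
  qed
  moreover have "homeomorphic_map M1.mtopology M2.mtopology e"
    by (rule isometry_imp_homeomorphic_map) (use assms in auto)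
  moreover have "mtopology_of (image_metric e S) = M2.mtopology"
    unfolding image_metric_def by simp
  ultimately have "homeomorphic_map (top_of_set S) (mtopology_of (image_metric e S)) e"
    by simp
  then obtain g where g: "homeomorphic_maps (top_of_set S) (mtopology_of (image_metric e S)) e g"
    by (auto simp: homeomorphic_map_maps)
  have "g y = inv_into S e y" if "y \<in> e ` S" for y
    using g that assms mspace_image_metric[OF assms] unfolding homeomorphic_maps_def by auto
  then show ?thesis
    using homeomorphic_maps_eq[OF g, of e "inv_into S e"] mspace_image_metric[OF assms] by simp
qed

section \<open>Coverings and separated sets\<close>

definition covered :: "'a::metric_space set \<Rightarrow> (int \<Rightarrow> 'a \<Rightarrow> 'a) \<Rightarrow> nat \<Rightarrow> real \<Rightarrow> real \<Rightarrow> bool" where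
  "covered S A n \<epsilon> N \<longleftrightarrow> (\<exists>\<P>. finite \<P> \<and> real (card \<P>) \<le> N \<and> S \<subseteq> \<Union>\<P> \<and>
     (\<forall>P\<in>\<P>. \<forall>x\<in>P \<inter> S. \<forall>y\<in>P \<inter> S. \<forall>i<n. dist (A (int i) x) (A (int i) y) \<le> \<epsilon>))"

definition separated :: "'a::metric_space set \<Rightarrow> (int \<Rightarrow> 'a \<Rightarrow> 'a) \<Rightarrow> nat \<Rightarrow> real \<Rightarrow> 'a set \<Rightarrow> bool" where
  "separated S A n \<epsilon> F \<longleftrightarrow> F \<subseteq> S \<and>
     (\<forall>x\<in>F. \<forall>y\<in>F. x \<noteq> y \<longrightarrow> (\<exists>i<n. dist (A (int i) x) (A (int i) y) > \<epsilon>))"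

lemma covered_code:
  assumes "finite (\<kappa> ` S)" "real (card (\<kappa> ` S)) \<le> N"
    and "\<And>x y i. x \<in> S \<Longrightarrow> y \<in> S \<Longrightarrow> \<kappa> x = \<kappa> y \<Longrightarrow> i < n \<Longrightarrow> dist (A (int i) x) (A (int i) y) \<le> \<epsilon>"
  shows "covered S A n \<epsilon> N"
proof -
  let ?\<P> = "(\<lambda>c. {x. \<kappa> x = c}) ` (\<kappa> ` S)"
  show ?thesis
    unfolding covered_def
  proof (rule exI[of _ ?\<P>], intro conjI)
    show "finite ?\<P>"
      using assms(1) by (rule finite_imageI)
    have "card ?\<P> \<le> card (\<kappa> ` S)"
      using assms(1) by (rule card_image_le)
    then show "real (card ?\<P>) \<le> N"
      using assms(2) by linarith
    show "S \<subseteq> \<Union>?\<P>"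
      by auto
    show "\<forall>P\<in>?\<P>. \<forall>x\<in>P \<inter> S. \<forall>y\<in>P \<inter> S. \<forall>i<n. dist (A (int i) x) (A (int i) y) \<le> \<epsilon>"
    proof (intro ballI allI impI)
      fix P x y i assume P: "P \<in> ?\<P>" and xy: "x \<in> P \<inter> S" "y \<in> P \<inter> S" and i: "i < n"
      obtain c where "P = {x. \<kappa> x = c}"
        using P by blast
      then have "x \<in> S" "y \<in> S" "\<kappa> x = \<kappa> y"
        using xy by simp_all
      then show "dist (A (int i) x) (A (int i) y) \<le> \<epsilon>"
        using i by (rule assms(3))
    qed
  qed
qed

text \<open>A cell has Bowen diameter at most \<open>\<epsilon>\<close>, whereas separated points
  are strictly more than \<open>\<epsilon>\<close> apart; so each cell holds at most one point of
  \<open>F\<close>.\<close>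

lemma card_separated_le:
  assumes "covered S A n \<epsilon> N" "finite F" "separated S A n \<epsilon> F"
  shows "real (card F) \<le> N"
proof -
  obtain \<P> where \<P>: "finite \<P>" "real (card \<P>) \<le> N" "S \<subseteq> \<Union>\<P>"
    and close: "\<forall>P\<in>\<P>. \<forall>x\<in>P \<inter> S. \<forall>y\<in>P \<inter> S. \<forall>i<n. dist (A (int i) x) (A (int i) y) \<le> \<epsilon>"
    using assms(1) unfolding covered_def by (elim exE conjE)
  have F: "F \<subseteq> S"
    using assms(3) by (simp add: separated_def)
  have "\<exists>P. P \<in> \<P> \<and> x \<in> P" if "x \<in> F" for x
    using that F \<P>(3) by blast
  then obtain p where p: "\<And>x. x \<in> F \<Longrightarrow> p x \<in> \<P> \<and> x \<in> p x"
    by metis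
  have "inj_on p F"
  proof (rule inj_onI, rule ccontr)
    fix x y assume xy: "x \<in> F" "y \<in> F" "p x = p y" "x \<noteq> y"
    then obtain i where i: "i < n" "dist (A (int i) x) (A (int i) y) > \<epsilon>"
      using assms(3) unfolding separated_def by blast
    have "x \<in> p x \<inter> S" "y \<in> p x \<inter> S" "p x \<in> \<P>"
      using xy p F by auto
    then have "dist (A (int i) x) (A (int i) y) \<le> \<epsilon>"
      using close i(1) by blast
    then show False
      using i by simp
  qed
  moreover have "p ` F \<subseteq> \<P>"
    using p by blast
  ultimately have "card F \<le> card \<P>"
    using \<P>(1) by (rule card_inj_on_le)
  then show ?thesis
    using \<P>(2) by linarith
qed

locale compact_action =
  fixes S :: "'a::metric_space set" and A :: "int \<Rightarrow> 'a \<Rightarrow> 'a"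
  assumes compact_S: "compact S" and S_nonempty: "S \<noteq> {}"
    and A_in: "\<And>n x. x \<in> S \<Longrightarrow> A n x \<in> S"
    and A_0: "\<And>x. x \<in> S \<Longrightarrow> A 0 x = x"
    and A_add: "\<And>m n x. x \<in> S \<Longrightarrow> A (m + n) x = A m (A n x)"
    and A_cont: "\<And>n. continuous_on S (A n)"
begin

text \<open>Compactness provides some covering. It bounds the cardinalities of separated sets,
  without which their supremum in \<open>nat\<close> would say nothing.\<close>

lemma ex_covered:
  assumes "\<epsilon> > 0"
  shows "\<exists>N. covered S A n \<epsilon> N"
proof -
  have "\<exists>U. open U \<and> U \<inter> S = S \<inter> {y. \<forall>i<n. dist (A (int i) x) (A (int i) y) < \<epsilon> / 2}" for x
  proof -
    have "openin (top_of_set S) (S \<inter> {y. dist (A (int i) x) (A (int i) y) < \<epsilon> / 2})" for i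
    proof -
      have "continuous_on S (\<lambda>y. dist (A (int i) x) (A (int i) y))"
        by (intro continuous_intros A_cont)
      then have "openin (top_of_set S) (S \<inter> (\<lambda>y. dist (A (int i) x) (A (int i) y)) -` {..<\<epsilon> / 2})"
        by (rule continuous_openin_preimage_gen) simp
      then show ?thesis
        by (simp add: vimage_def)
    qed
    then have "openin (top_of_set S) (S \<inter> {y. \<forall>i<n. dist (A (int i) x) (A (int i) y) < \<epsilon> / 2})"
    proof (induction n)
      case (Suc n)
      have "S \<inter> {y. \<forall>i<Suc n. dist (A (int i) x) (A (int i) y) < \<epsilon> / 2} =
          (S \<inter> {y. \<forall>i<n. dist (A (int i) x) (A (int i) y) < \<epsilon> / 2}) \<inter>
          (S \<inter> {y. dist (A (int n) x) (A (int n) y) < \<epsilon> / 2})"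
        by (auto simp: less_Suc_eq)
      then show ?case
        using Suc.IH[OF Suc.prems] Suc.prems[of n] by (simp only: openin_Int)
    qed simp
    then show ?thesis
      unfolding openin_open by (metis Int_commute)
  qed
  then obtain U where U: "\<And>x. open (U x)"
    "\<And>x. U x \<inter> S = S \<inter> {y. \<forall>i<n. dist (A (int i) x) (A (int i) y) < \<epsilon> / 2}"
    by metis
  have "x \<in> U x" if "x \<in> S" for x
    using U(2)[of x] that assms by auto
  then have "S \<subseteq> (\<Union>x\<in>S. U x)"
    by blast
  then obtain D where D: "D \<subseteq> S" "finite D" "S \<subseteq> (\<Union>x\<in>D. U x)"
    by (rule compactE_image[OF compact_S U(1)])
  have "dist (A (int i) y) (A (int i) z) \<le> \<epsilon>" if yz: "y \<in> U x \<inter> S" "z \<in> U x \<inter> S" "i < n" for x y z i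
  proof -
    have "dist (A (int i) x) (A (int i) y) < \<epsilon> / 2" "dist (A (int i) x) (A (int i) z) < \<epsilon> / 2"
      using yz unfolding U(2) by auto
    then show ?thesis
      using dist_triangle3[of "A (int i) y" "A (int i) z" "A (int i) x"] by linarith
  qed
  then show ?thesis
    unfolding covered_def using D
    by (intro exI[of _ "real (card (U ` D))"] exI[of _ "U ` D"]) auto
qed

section \<open>The transported action inside the group of homeomorphisms\<close>

context
  fixes e :: "'a \<Rightarrow> 'b" and X :: "'b metric" and E :: "int \<Rightarrow> 'b \<Rightarrow> 'b"
  assumes e_inj: "inj_on e S"
  defines "X \<equiv> image_metric e S"
    and "E \<equiv> \<lambda>n. restrict (\<lambda>y. e (A n (inv_into S e y))) (e ` S)"
begin

lemma mspace_X: "mspace X = e ` S"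
  unfolding X_def by (rule mspace_image_metric[OF e_inj])

lemma mdist_X: "x \<in> S \<Longrightarrow> y \<in> S \<Longrightarrow> mdist X (e x) (e y) = dist x y"
  unfolding X_def by (rule mdist_image_metric[OF e_inj])

lemma E_apply: "x \<in> S \<Longrightarrow> E n (e x) = e (A n x)"
  unfolding E_def using e_inj by simp

lemma E_in_Bij: "E n \<in> Bij (mspace X)"
proof -
  have "bij_betw (E n) (e ` S) (e ` S)"
  proof (rule bij_betw_byWitness[where f' = "E (- n)"])
    show "\<forall>a\<in>e ` S. E (- n) (E n a) = a" "\<forall>a\<in>e ` S. E n (E (- n) a) = a"
      using A_in A_add A_0 by (auto simp: E_apply simp flip: A_add)
  qed (use A_in in \<open>auto simp: E_apply\<close>)
  moreover have "E n \<in> extensional (e ` S)"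
    unfolding E_def by simp
  ultimately show ?thesis
    unfolding Bij_def mspace_X by blast
qed

lemma homeomorphic_map_conjugate:
  assumes g: "g ` S \<subseteq> S" and h: "h ` S \<subseteq> S"
    and gh: "\<And>x. x \<in> S \<Longrightarrow> h (g x) = x" "\<And>x. x \<in> S \<Longrightarrow> g (h x) = x"
    and cont: "continuous_on S g" "continuous_on S h"
    and f: "\<And>x. x \<in> S \<Longrightarrow> f (e x) = e (g x)"
  shows "homeomorphic_map (mtopology_of X) (mtopology_of X) f"
proof -
  have *: "homeomorphic_maps (top_of_set S) (mtopology_of X) e (inv_into S e)"
    unfolding X_def by (rule homeomorphic_maps_image_metric[OF e_inj])
  have "homeomorphic_maps (top_of_set S) (top_of_set S) g h"
    unfolding homeomorphic_maps_def using assms by auto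
  then have "homeomorphic_map (top_of_set S) (top_of_set S) g"
    using homeomorphic_map_maps by blast
  moreover have "homeomorphic_map (top_of_set S) (mtopology_of X) e"
    "homeomorphic_map (mtopology_of X) (top_of_set S) (inv_into S e)"
    using * homeomorphic_maps_sym homeomorphic_map_maps by blast+
  ultimately have "homeomorphic_map (mtopology_of X) (mtopology_of X) (e \<circ> (g \<circ> inv_into S e))"
    by (meson homeomorphic_map_compose)
  then show ?thesis
    by (rule homeomorphic_map_eq) (use f e_inj in \<open>auto simp: mspace_X\<close>)
qed

lemma E_in_carrier: "E n \<in> carrier (homeo_group X)"
proof -
  have "homeomorphic_map (mtopology_of X) (mtopology_of X) (E n)"
    by (rule homeomorphic_map_conjugate[of "A n" "A (- n)"])
      (use A_in A_cont A_0 in \<open>auto simp: E_apply simp flip: A_add\<close>)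
  then show ?thesis
    using E_in_Bij by (simp add: homeo_group_def)
qed

lemma E_mult: "E m \<otimes>\<^bsub>homeo_group X\<^esub> E n = E (m + n)"
proof -
  have "compose (e ` S) (E m) (E n) = E (m + n)"
  proof
    fix y
    show "compose (e ` S) (E m) (E n) y = E (m + n) y"
    proof (cases "y \<in> e ` S")
      case True
      then show ?thesis
        using A_in by (auto simp: compose_def E_apply A_add)
    next
      case False
      then show ?thesis
        by (simp add: compose_def E_def)
    qed
  qed
  then show ?thesis
    using E_in_Bij by (simp add: homeo_group_def BijGroup_def mspace_X[symmetric])
qed

lemma E_one: "E 0 = \<one>\<^bsub>homeo_group X\<^esub>"
  using A_0 e_inj by (auto simp: homeo_group_def BijGroup_def mspace_X E_def fun_eq_iff)

lemma E_pow: "E m [^]\<^bsub>homeo_group X\<^esub> (n::int) = E (m * n)"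
proof -
  interpret group "homeo_group X"
    by (rule group_homeo_group)
  have nat: "E m [^]\<^bsub>homeo_group X\<^esub> (k::nat) = E (m * int k)" for k
    by (induction k) (simp_all add: E_one E_mult algebra_simps)
  show ?thesis
  proof (cases n rule: int_cases2)
    case (nonneg k)
    then show ?thesis
      by (simp add: int_pow_int nat)
  next
    case (nonpos k)
    have "inv\<^bsub>homeo_group X\<^esub> (E (m * int k)) = E (m * - int k)"
      by (rule inv_equality) (simp_all add: E_mult E_one E_in_carrier)
    then show ?thesis
      using nonpos by (simp add: int_pow_neg_int E_in_carrier nat)
  qed
qed

lemma funpow_E: "x \<in> S \<Longrightarrow> (E m ^^ n) (e x) = e (A (m * int n) x)"
proof (induction n)
  case (Suc n)
  then show ?case
    using A_in by (simp add: E_apply algebra_simps flip: A_add)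
qed (simp add: A_0)

section \<open>Entropy of the transported action\<close>

lemma separated_set_iff:
  assumes "F \<subseteq> S"
  shows "separated_set X (E m) n \<epsilon> (e ` F) \<longleftrightarrow> separated S (\<lambda>i. A (m * i)) n \<epsilon> F"
proof -
  have "mdist X ((E m ^^ i) (e x)) ((E m ^^ i) (e y)) = dist (A (m * int i) x) (A (m * int i) y)"
    if "x \<in> S" "y \<in> S" for i x y
    using that A_in by (simp add: funpow_E mdist_X)
  moreover have "e x = e y \<longleftrightarrow> x = y" if "x \<in> S" "y \<in> S" for x y
    using that e_inj by (auto simp: inj_on_def)
  ultimately show ?thesis
    unfolding separated_set_def separated_def mspace_X using assms by (auto simp: subset_iff)
qed

lemma separated_cards:
  "card ` {F. finite F \<and> separated_set X (E m) n \<epsilon> F} =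
   card ` {F. finite F \<and> separated S (\<lambda>i. A (m * i)) n \<epsilon> F}" (is "?L = ?R")
proof
  show "?L \<subseteq> ?R"
  proof
    fix c assume "c \<in> ?L"
    then obtain F where F: "finite F" "separated_set X (E m) n \<epsilon> F" "c = card F"
      by blast
    then have "F \<subseteq> e ` S"
      by (simp add: separated_set_def mspace_X)
    then obtain G where G: "G \<subseteq> S" "F = e ` G"
      by (auto simp: subset_image_iff)
    have "inj_on e G"
      using G(1) e_inj inj_on_subset by blast
    then have "finite G" "card F = card G"
      using F(1) G(2) by (auto simp: finite_image_iff card_image)
    then show "c \<in> ?R"
      using F G separated_set_iff by auto
  qed
  show "?R \<subseteq> ?L"
  proof
    fix c assume "c \<in> ?R"
    then obtain G where G: "finite G" "separated S (\<lambda>i. A (m * i)) n \<epsilon> G" "c = card G"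
      by blast
    then have "G \<subseteq> S"
      by (simp add: separated_def)
    then have "card (e ` G) = card G"
      using e_inj by (meson card_image inj_on_subset)
    then show "c \<in> ?L"
      using G \<open>G \<subseteq> S\<close> separated_set_iff by (auto intro!: image_eqI[of _ _ "e ` G"])
  qed
qed

lemma separated_card_bounds:
  shows "finite F \<Longrightarrow> separated S A n \<epsilon> F \<Longrightarrow> \<epsilon> > 0 \<Longrightarrow> card F \<le> separated_card X (E 1) n \<epsilon>"
    and "covered S A n \<epsilon> N \<Longrightarrow> real (separated_card X (E 1) n \<epsilon>) \<le> N"
    and "\<epsilon> > 0 \<Longrightarrow> 1 \<le> separated_card X (E 1) n \<epsilon>"
proof -
  let ?R = "card ` {F. finite F \<and> separated S A n \<epsilon> F}"
  have eq: "separated_card X (E 1) n \<epsilon> = Sup ?R"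
    unfolding separated_card_def separated_cards by simp
  have le: "c \<le> nat \<lfloor>N\<rfloor>" if cov: "covered S A n \<epsilon> N" and c: "c \<in> ?R" for c N
  proof -
    obtain F where "finite F" "separated S A n \<epsilon> F" "c = card F"
      using c by blast
    then have "real c \<le> N"
      using card_separated_le[OF cov] by simp
    then show ?thesis
      by (simp add: le_nat_floor)
  qed
  show 1: "card F \<le> separated_card X (E 1) n \<epsilon>" if "finite F" "separated S A n \<epsilon> F" "\<epsilon> > 0" for F
    unfolding eq
  proof (rule cSup_upper)
    obtain N where "covered S A n \<epsilon> N"
      using ex_covered[OF \<open>\<epsilon> > 0\<close>] by blast
    then show "bdd_above ?R"
      using le by (intro bdd_aboveI)
  qed (use that in blast)
  \<comment> \<open>The empty set is separated; so the set of cardinalities is nonempty, as the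
    least upper bound property in \<open>nat\<close> requires.\<close>
  have empty: "0 \<in> ?R"
    by (auto simp: separated_def intro!: image_eqI[of _ _ "{}"])
  show "real (separated_card X (E 1) n \<epsilon>) \<le> N" if N: "covered S A n \<epsilon> N"
  proof -
    have "Sup ?R \<le> nat \<lfloor>N\<rfloor>"
      using empty le[OF N] by (intro cSup_least) blast+
    moreover have "0 \<le> N"
      using N unfolding covered_def by (meson of_nat_0_le_iff order_trans)
    ultimately show ?thesis
      unfolding eq using of_nat_floor[of N] by linarith
  qed
  show "1 \<le> separated_card X (E 1) n \<epsilon>" if "\<epsilon> > 0"
  proof -
    obtain x where "x \<in> S"
      using S_nonempty by blast
    then show ?thesis
      using 1[of "{x}"] that by (simp add: separated_def)
  qed
qed

lemma entropy_le:
  assumes "\<And>\<epsilon> h'. \<epsilon> > 0 \<Longrightarrow> h' > h \<Longrightarrow> eventually (\<lambda>n. covered S A n \<epsilon> (exp (h' * real n))) sequentially"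
  shows "top_entropy X (E 1) \<le> ereal h"
  unfolding top_entropy_def
proof (rule SUP_least, rule ereal_le_epsilon2)
  fix \<epsilon> d :: real assume "\<epsilon> \<in> {0<..}" "0 < d"
  then have \<epsilon>: "\<epsilon> > 0" by simp
  have "eventually (\<lambda>n. covered S A n \<epsilon> (exp ((h + d) * real n))) sequentially"
    using assms[OF \<epsilon>] \<open>0 < d\<close> by simp
  then have "eventually (\<lambda>n. ereal (ln (real (separated_card X (E 1) n \<epsilon>)) / real n) \<le> ereal (h + d)) sequentially"
    using eventually_gt_at_top[of 0]
  proof eventually_elim
    case (elim n)
    have "real (separated_card X (E 1) n \<epsilon>) \<le> exp ((h + d) * real n)"
      using separated_card_bounds(2) elim(1) .
    moreover have "real (separated_card X (E 1) n \<epsilon>) \<ge> 1"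
      using separated_card_bounds(3)[OF \<epsilon>] by simp
    ultimately have "ln (real (separated_card X (E 1) n \<epsilon>)) \<le> (h + d) * real n"
      by (metis ln_exp ln_le_cancel_iff exp_gt_zero less_le_trans zero_less_one)
    then show ?case
      using elim(2) by (simp add: field_simps)
  qed
  then show "limsup (\<lambda>n. ereal (ln (real (separated_card X (E 1) n \<epsilon>)) / real n)) \<le> ereal h + ereal d"
    by (simp add: Limsup_bounded)
qed

text \<open>Since the entropy is a limit superior, large separated sets along a sequence of times
  suffice; for the suspension these times are about \<open>p k / speed\<close>.\<close>

lemma entropy_ge:
  assumes "\<epsilon> > 0"
    and freq: "frequently (\<lambda>n. \<exists>F. finite F \<and> separated S A n \<epsilon> F \<and> exp (h * real n) \<le> real (card F)) sequentially"
  shows "ereal h \<le> top_entropy X (E 1)"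
proof -
  let ?f = "\<lambda>n. ereal (ln (real (separated_card X (E 1) n \<epsilon>)) / real n)"
  have "ereal h \<le> limsup ?f"
  proof (rule ccontr)
    assume "\<not> ereal h \<le> limsup ?f"
    then have "eventually (\<lambda>n. ?f n < ereal h) sequentially"
      by (intro Limsup_lessD) (simp add: not_le)
    then have "eventually (\<lambda>n. ?f n < ereal h \<and> n > 0) sequentially"
      using eventually_gt_at_top[of 0] by eventually_elim simp
    then obtain n F where n: "?f n < ereal h" "n > 0"
      and F: "finite F" "separated S A n \<epsilon> F" "exp (h * real n) \<le> real (card F)"
      using frequently_eventually_conj[OF freq] by (blast dest: frequently_ex)
    have "exp (h * real n) \<le> real (separated_card X (E 1) n \<epsilon>)"
      using separated_card_bounds(1)[OF F(1,2) assms(1)] F(3) by linarith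
    then have "h * real n \<le> ln (real (separated_card X (E 1) n \<epsilon>))"
      by (metis exp_gt_zero less_le_trans ln_exp ln_le_cancel_iff)
    then show False
      using n by (simp add: field_simps)
  qed
  also have "\<dots> \<le> top_entropy X (E 1)"
    unfolding top_entropy_def using assms(1) by (intro SUP_upper) simp
  finally show ?thesis .
qed

text \<open>The map \<open>A (m * (n - 1))\<close> carries a point to the far end of its orbit
  segment: running backwards from there, time \<open>n - 1 - i\<close> is time \<open>i\<close> of
  the original segment.\<close>

lemma separated_reverse:
  assumes "finite F" "separated S (\<lambda>i. A (m * i)) n \<epsilon> F"
  shows "\<exists>G. finite G \<and> card G = card F \<and> separated S (\<lambda>i. A (- m * i)) n \<epsilon> G"
proof -
  let ?s = "m * (int n - 1)"
  have F: "F \<subseteq> S"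
    using assms(2) by (simp add: separated_def)
  have inj: "inj_on (A ?s) F"
    by (rule inj_on_inverseI[of _ "A (- ?s)"]) (use F A_0 in \<open>auto simp: subset_iff simp flip: A_add\<close>)
  have "separated S (\<lambda>i. A (- m * i)) n \<epsilon> (A ?s ` F)"
    unfolding separated_def
  proof (intro conjI ballI impI)
    show "A ?s ` F \<subseteq> S"
      using F A_in by blast
    fix x' y' assume "x' \<in> A ?s ` F" "y' \<in> A ?s ` F" "x' \<noteq> y'"
    then obtain x y where xy: "x \<in> F" "y \<in> F" "x \<noteq> y" "x' = A ?s x" "y' = A ?s y"
      by blast
    then obtain i where i: "i < n" "dist (A (m * int i) x) (A (m * int i) y) > \<epsilon>"
      using assms(2) unfolding separated_def by blast
    have "- m * int (n - 1 - i) + ?s = m * int i"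
      using i(1) by (simp add: of_nat_diff algebra_simps)
    then have "A (- m * int (n - 1 - i)) (A ?s z) = A (m * int i) z" if "z \<in> F" for z
      using that F by (subst A_add[symmetric]) auto
    then show "\<exists>i<n. dist (A (- m * int i) x') (A (- m * int i) y') > \<epsilon>"
      using i xy by (intro exI[of _ "n - 1 - i"]) auto
  qed
  then show ?thesis
    using assms(1) inj by (intro exI[of _ "A ?s ` F"]) (auto simp: card_image)
qed

lemma top_entropy_inverse: "top_entropy X (E (- 1)) = top_entropy X (E 1)"
proof -
  have sub: "card ` {F. finite F \<and> separated S (\<lambda>i. A (- m * i)) n \<epsilon> F} \<subseteq>
      card ` {F. finite F \<and> separated S (\<lambda>i. A (m * i)) n \<epsilon> F}" for m n \<epsilon>
  proof
    fix c assume "c \<in> card ` {F. finite F \<and> separated S (\<lambda>i. A (- m * i)) n \<epsilon> F}"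
    then obtain F where F: "finite F" "separated S (\<lambda>i. A (- m * i)) n \<epsilon> F" "c = card F"
      by blast
    obtain G where "finite G" "card G = card F" "separated S (\<lambda>i. A (- (- m) * i)) n \<epsilon> G"
      using separated_reverse[OF F(1,2)] by blast
    then have "G \<in> {F. finite F \<and> separated S (\<lambda>i. A (m * i)) n \<epsilon> F}" "c = card G"
      using F(3) by simp_all
    then show "c \<in> card ` {F. finite F \<and> separated S (\<lambda>i. A (m * i)) n \<epsilon> F}"
      by (rule rev_image_eqI)
  qed
  have "card ` {F. finite F \<and> separated S (\<lambda>i. A (- 1 * i)) n \<epsilon> F} =
      card ` {F. finite F \<and> separated S (\<lambda>i. A (1 * i)) n \<epsilon> F}" for n \<epsilon>
  proof (rule subset_antisym)
    show "card ` {F. finite F \<and> separated S (\<lambda>i. A (- 1 * i)) n \<epsilon> F} \<subseteq>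
        card ` {F. finite F \<and> separated S (\<lambda>i. A (1 * i)) n \<epsilon> F}"
      by (rule sub)
    show "card ` {F. finite F \<and> separated S (\<lambda>i. A (1 * i)) n \<epsilon> F} \<subseteq>
        card ` {F. finite F \<and> separated S (\<lambda>i. A (- 1 * i)) n \<epsilon> F}"
      using sub[where m = "- 1" and n = n and \<epsilon> = \<epsilon>] by simp
  qed
  then show ?thesis
    unfolding top_entropy_def separated_card_def separated_cards by simp
qed

text \<open>Freeness is used twice: an orbit has three different points, and
  \<open>n \<mapsto> E n\<close> is injective, so that a generator \<open>E a\<close> satisfies
  \<open>a * b = 1\<close>. Both candidates \<open>a = 1\<close> and \<open>a = - 1\<close> have the
  same entropy, which makes the definite description in \<open>slovak_entropy\<close>
  meaningful.\<close>

lemma slovak_space_X: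
  assumes free: "\<And>x n. x \<in> S \<Longrightarrow> A n x = x \<Longrightarrow> n = 0"
    and dense: "\<And>x y d. x \<in> S \<Longrightarrow> y \<in> S \<Longrightarrow> d > 0 \<Longrightarrow> \<exists>n::nat. dist (A (int n) x) y < d"
    and rigid: "\<And>f g. continuous_on S f \<Longrightarrow> continuous_on S g \<Longrightarrow> f ` S \<subseteq> S \<Longrightarrow> g ` S \<subseteq> S \<Longrightarrow>
      (\<And>x. x \<in> S \<Longrightarrow> g (f x) = x) \<Longrightarrow> (\<And>x. x \<in> S \<Longrightarrow> f (g x) = x) \<Longrightarrow>
      \<exists>k. \<forall>x\<in>S. f x = A k x"
  shows "slovak_space X" and "slovak_entropy X = top_entropy X (E 1)"
proof -
  have maps: "homeomorphic_maps (top_of_set S) (mtopology_of X) e (inv_into S e)"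
    unfolding X_def by (rule homeomorphic_maps_image_metric[OF e_inj])
  have E_inj: "m = n" if "E m = E n" for m n
  proof -
    obtain x where x: "x \<in> S"
      using S_nonempty by blast
    have "e (A m x) = e (A n x)"
      using that x E_apply by metis
    then have "A m x = A n x"
      using e_inj A_in x by (auto simp: inj_on_def)
    then have "A (- n + m) x = x"
      using A_add[OF x, of "- n" m] A_add[OF x, of "- n" n] A_0[OF x] by simp
    then show ?thesis
      using free[OF x] by fastforce
  qed
  have carrier: "carrier (homeo_group X) = range E"
  proof
    show "range E \<subseteq> carrier (homeo_group X)"
      using E_in_carrier by blast
    show "carrier (homeo_group X) \<subseteq> range E"
    proof
      fix h assume "h \<in> carrier (homeo_group X)"
      then have h: "h \<in> Bij (mspace X)" "homeomorphic_map (mtopology_of X) (mtopology_of X) h"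
        by (auto simp: homeo_group_def)
      then have "homeomorphic_map (top_of_set S) (mtopology_of X) (h \<circ> e)"
        using maps by (meson homeomorphic_map_compose homeomorphic_map_maps)
      then have "homeomorphic_map (top_of_set S) (top_of_set S) (inv_into S e \<circ> (h \<circ> e))"
        using maps by (meson homeomorphic_map_compose homeomorphic_map_maps homeomorphic_maps_sym)
      then obtain g where "homeomorphic_maps (top_of_set S) (top_of_set S) (inv_into S e \<circ> (h \<circ> e)) g"
        by (auto simp: homeomorphic_map_maps)
      then have g: "continuous_on S (inv_into S e \<circ> (h \<circ> e))" "continuous_on S g"
        "(inv_into S e \<circ> (h \<circ> e)) ` S \<subseteq> S" "g ` S \<subseteq> S"
        "\<And>x. x \<in> S \<Longrightarrow> g ((inv_into S e \<circ> (h \<circ> e)) x) = x"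
        "\<And>x. x \<in> S \<Longrightarrow> (inv_into S e \<circ> (h \<circ> e)) (g x) = x"
        by (auto simp: homeomorphic_maps_def)
      obtain k where k: "\<forall>x\<in>S. (inv_into S e \<circ> (h \<circ> e)) x = A k x"
        using rigid[OF g] by blast
      have "h = E k"
      proof
        fix y
        show "h y = E k y"
        proof (cases "y \<in> e ` S")
          case True
          then obtain x where x: "x \<in> S" "y = e x" by blast
          have "h y \<in> e ` S"
            using h(1) True unfolding Bij_def bij_betw_def mspace_X by blast
          then have "h y = e (A k x)"
            using k x f_inv_into_f[of "h y" e S] by auto
          then show ?thesis
            using x by (simp add: E_apply)
        next
          case False
          then show ?thesis
            using h(1) by (auto simp: Bij_def mspace_X E_def extensional_def)
        qed
      qed
      then show "h \<in> range E" by blast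
    qed
  qed
  have gen: "homeo_generator X (E 1)"
    unfolding homeo_generator_def using E_in_carrier by (simp add: carrier E_pow image_def)
  have "minimal_homeo X (E 1)"
    unfolding minimal_homeo_def
  proof (intro conjI ballI E_in_carrier)
    fix y assume "y \<in> mspace X"
    then obtain x where x: "x \<in> S" "y = e x"
      by (auto simp: mspace_X)
    have "mtopology_of X closure_of range (\<lambda>n. (E 1 ^^ n) y) = {z \<in> mspace X. \<forall>r>0.
        \<exists>w \<in> range (\<lambda>n. (E 1 ^^ n) y). w \<in> Metric_space.mball (mspace X) (mdist X) z r}"
      unfolding mtopology_of_def
      by (rule Metric_space.metric_closure_of) simp
    also have "\<dots> = mspace X"
    proof -
      have "\<exists>w \<in> range (\<lambda>n. (E 1 ^^ n) y). w \<in> Metric_space.mball (mspace X) (mdist X) z r"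
        if z: "z \<in> mspace X" and r: "r > 0" for z r
      proof -
        obtain x' where x': "x' \<in> S" "z = e x'"
          using z by (auto simp: mspace_X)
        obtain n :: nat where "dist (A (int n) x) x' < r"
          using dense[OF x(1) x'(1) r] by blast
        then have "mdist X z ((E 1 ^^ n) y) < r"
          using x x' A_in by (simp add: funpow_E mdist_X dist_commute)
        moreover have "(E 1 ^^ n) y \<in> mspace X"
          using x A_in by (simp add: funpow_E mspace_X)
        ultimately have "(E 1 ^^ n) y \<in> Metric_space.mball (mspace X) (mdist X) z r"
          using z by (simp add: Metric_space.in_mball[OF Metric_space_mspace_mdist])
        then show ?thesis
          by blast
      qed
      then show ?thesis by blast
    qed
    finally show "mtopology_of X closure_of range (\<lambda>n. (E 1 ^^ n) y) = mspace X" .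
  qed
  moreover have "compact_space (mtopology_of X)"
    using homeomorphic_maps_imp_homeomorphic_space[OF maps] homeomorphic_compact_space compact_S
    by (metis compact_space_subtopology compactin_euclidean_iff)
  moreover have "\<exists>x \<in> mspace X. \<exists>y \<in> mspace X. \<exists>z \<in> mspace X. x \<noteq> y \<and> x \<noteq> z \<and> y \<noteq> z"
  proof -
    obtain x where x: "x \<in> S"
      using S_nonempty by blast
    have "e (A m x) \<noteq> e (A n x)" if "m \<noteq> n" for m n
    proof
      assume "e (A m x) = e (A n x)"
      then have "A m x = A n x"
        using e_inj A_in x by (auto simp: inj_on_def)
      then have "A (- n + m) x = x"
        using A_add[OF x, of "- n" m] A_add[OF x, of "- n" n] A_0[OF x] by simp
      then show False
        using free[OF x] that by fastforce
    qed
    from this[of 0 1] this[of 0 2] this[of 1 2] show ?thesis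
      unfolding mspace_X using x A_in by (intro bexI[of _ "e (A 0 x)"] bexI[of _ "e (A 1 x)"] bexI[of _ "e (A 2 x)"]) auto
  qed
  ultimately show "slovak_space X"
    unfolding slovak_space_def using gen by blast
  have "top_entropy X T = top_entropy X (E 1)" if T: "homeo_generator X T" for T
  proof -
    obtain a where a: "T = E a"
      using T carrier unfolding homeo_generator_def by auto
    have "E 1 \<in> range (\<lambda>n::int. T [^]\<^bsub>homeo_group X\<^esub> n)"
      using T E_in_carrier unfolding homeo_generator_def by blast
    then obtain b :: int where "E 1 = E (a * b)"
      by (auto simp: a E_pow)
    then have "a * b = 1"
      using E_inj by metis
    then have "a = 1 \<or> a = - 1"
      using zmult_eq_1_iff by blast
    then show ?thesis
      using top_entropy_inverse a by auto
  qed
  then show "slovak_entropy X = top_entropy X (E 1)"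
    unfolding slovak_entropy_def using gen by (intro the_equality) blast+
qed

end

end

section \<open>Blowing up an orbit of a minimal flow\<close>

lemma tendsto_fun_iff:
  fixes f :: "'a \<Rightarrow> 'i \<Rightarrow> 'b::topological_space"
  shows "(f \<longlongrightarrow> l) F \<longleftrightarrow> (\<forall>i. ((\<lambda>x. f x i) \<longlongrightarrow> l i) F)"
  using limitin_componentwise[of "\<lambda>_. euclidean" UNIV f l F]
  by (simp add: euclidean_product_topology)

lemma closure_image_homeo:
  fixes h g :: "'a::metric_space \<Rightarrow> 'a"
  assumes Z: "compact Z" "W \<subseteq> Z" and h: "continuous_on Z h"
  shows "h ` closure W = closure (h ` W)"
proof
  have W: "closure W \<subseteq> Z"
    using Z by (simp add: closure_minimal compact_imp_closed)
  have "compact (closure W)"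
    using compact_Int_closed[OF Z(1) closed_closure[of W]] W by (simp add: inf.absorb2)
  then have "compact (h ` closure W)"
    using h W by (meson compact_continuous_image continuous_on_subset)
  then have "closed (h ` closure W)"
    by (rule compact_imp_closed)
  then show "closure (h ` W) \<subseteq> h ` closure W"
    by (intro closure_minimal image_mono closure_subset)
  show "h ` closure W \<subseteq> closure (h ` W)"
    using W h by (intro image_closure_subset closure_subset) (auto intro: continuous_on_subset)
qed

text \<open>Density is demanded for the forward orbits of the time-one map, not only for the flow.
  \<open>\<phi>_paths\<close> is all that is known about path components: a path in \<open>Y\<close>
  moves along one flow line, with a continuous time.\<close>

locale minimal_flow =
  fixes Y :: "'a::metric_space set" and \<phi> :: "real \<Rightarrow> 'a \<Rightarrow> 'a" and y0 :: 'a
  assumes compact_Y: "compact Y" and y0_in: "y0 \<in> Y"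
    and \<phi>_in: "\<And>t y. y \<in> Y \<Longrightarrow> \<phi> t y \<in> Y"
    and \<phi>_0: "\<And>y. y \<in> Y \<Longrightarrow> \<phi> 0 y = y"
    and \<phi>_add: "\<And>s t y. y \<in> Y \<Longrightarrow> \<phi> (s + t) y = \<phi> s (\<phi> t y)"
    and \<phi>_cont: "continuous_on (UNIV \<times> Y) (\<lambda>(t, y). \<phi> t y)"
    and \<phi>_free: "\<And>t y. y \<in> Y \<Longrightarrow> \<phi> t y = y \<Longrightarrow> t = 0"
    and \<phi>_dense: "\<And>y z d. y \<in> Y \<Longrightarrow> z \<in> Y \<Longrightarrow> d > 0 \<Longrightarrow> \<exists>n::nat. dist (\<phi> (real n) y) z < d"
    and \<phi>_paths: "\<And>\<gamma>. continuous_on {0..1::real} \<gamma> \<Longrightarrow> \<gamma> ` {0..1} \<subseteq> Y \<Longrightarrow>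
      \<exists>\<tau>. continuous_on {0..1} \<tau> \<and> (\<forall>u\<in>{0..1}. \<gamma> u = \<phi> (\<tau> u) (\<gamma> 0))"
begin

lemma continuous_on_\<phi>:
  assumes "continuous_on S s" "continuous_on S y" "y ` S \<subseteq> Y"
  shows "continuous_on S (\<lambda>x. \<phi> (s x) (y x))"
  using continuous_on_compose2[OF \<phi>_cont continuous_on_Pair[OF assms(1,2)]] assms(3) by auto

lemma \<phi>_inj: "y \<in> Y \<Longrightarrow> \<phi> s y = \<phi> t y \<Longrightarrow> s = t"
  using \<phi>_free[of y "s - t"] \<phi>_add[of y "- t" s] \<phi>_add[of y "- t" t] \<phi>_0[of y] by simp

lemma \<phi>_swap: "y \<in> Y \<Longrightarrow> \<phi> t y = z \<Longrightarrow> y = \<phi> (- t) z"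
  using \<phi>_add[of y "- t" t] \<phi>_0[of y] by simp

text \<open>The quotient of distances in \<open>osc\<close> is a Urysohn function off
  \<open>y0\<close>, with value \<open>0\<close> on \<open>lseg\<close> and \<open>1\<close> on
  \<open>rseg\<close>. The two closed segments meet only in \<open>y0\<close>, so it is continuous
  elsewhere, and the full oscillation of the sine remains on the right part of the flow
  line.\<close>

definition lseg :: "'a set" where "lseg = (\<lambda>t. \<phi> t y0) ` {-1/2..0}"

definition rseg :: "'a set" where "rseg = (\<lambda>t. \<phi> t y0) ` {0..1/2}"

text \<open>At \<open>y0\<close> both distances vanish, and \<open>x / 0 = 0\<close> gives the limit from the left.\<close>

definition osc :: "'a \<Rightarrow> real" where
  "osc y = infdist y lseg / (infdist y lseg + infdist y rseg) * sin (1 / dist y y0)"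

definition osc_seq :: "'a \<Rightarrow> int \<Rightarrow> real" where
  "osc_seq y = (\<lambda>n. osc (\<phi> (of_int n) y))"

text \<open>This describes the closure of the graph by coordinates: since the flow is free, at most
  one \<open>n\<close> takes \<open>y\<close> to \<open>y0\<close>; that coordinate is free between
  \<open>- 1\<close> and \<open>1\<close>, and all others are forced. By
  \<open>singular_limit\<close> every point with a free coordinate is indeed a limit of points of
  the graph.\<close>

definition Z :: "('a \<times> (int \<Rightarrow> real)) set" where
  "Z = {(y, v). y \<in> Y \<and> (\<forall>n::int. \<phi> (of_int n) y \<noteq> y0 \<and> v n = osc (\<phi> (of_int n) y) \<or>
     \<phi> (of_int n) y = y0 \<and> v n \<in> {-1..1})}"

definition act :: "int \<Rightarrow> 'a \<times> (int \<Rightarrow> real) \<Rightarrow> 'a \<times> (int \<Rightarrow> real)" where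
  "act n = (\<lambda>(y, v). (\<phi> (of_int n) y, shift n v))"

section \<open>The oscillating function\<close>

lemma continuous_on_line: "continuous_on S (\<lambda>t. \<phi> t y0)"
  using y0_in by (intro continuous_on_\<phi> continuous_on_id continuous_on_const) auto

lemma line_in: "\<phi> t y0 \<in> Y"
  by (rule \<phi>_in[OF y0_in])

lemma line_eq_iff: "\<phi> s y0 = \<phi> t y0 \<longleftrightarrow> s = t"
  using \<phi>_inj[OF y0_in] by blast

lemma line_eq_y0: "\<phi> s y0 = y0 \<longleftrightarrow> s = 0"
  using \<phi>_free[OF y0_in] \<phi>_0[OF y0_in] by blast

lemma closed_seg: "closed lseg" "closed rseg" "lseg \<noteq> {}" "rseg \<noteq> {}"
  unfolding lseg_def rseg_def
  by (auto intro!: compact_imp_closed compact_continuous_image continuous_on_line)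

lemma lseg_rseg: "y \<in> lseg \<Longrightarrow> y \<in> rseg \<Longrightarrow> y = y0"
  unfolding lseg_def rseg_def using line_eq_iff \<phi>_0[OF y0_in] by auto

lemma infdist_sum_pos: "y \<noteq> y0 \<Longrightarrow> infdist y lseg + infdist y rseg > 0"
proof (rule ccontr)
  assume "y \<noteq> y0" "\<not> infdist y lseg + infdist y rseg > 0"
  then have "infdist y lseg = 0" "infdist y rseg = 0"
    using infdist_nonneg[of y lseg] infdist_nonneg[of y rseg] by linarith+
  then have "y \<in> lseg" "y \<in> rseg"
    using in_closed_iff_infdist_zero[OF closed_seg(1,3)] in_closed_iff_infdist_zero[OF closed_seg(2,4)]
    by auto
  then show False
    using lseg_rseg \<open>y \<noteq> y0\<close> by blast
qed

lemma osc_bound: "osc y \<in> {-1..1}"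
proof -
  have "\<bar>infdist y lseg / (infdist y lseg + infdist y rseg)\<bar> \<le> 1"
    using infdist_nonneg[of y lseg] infdist_nonneg[of y rseg] by (auto simp: divide_le_eq_1)
  then have "\<bar>osc y\<bar> \<le> 1 * 1"
    unfolding osc_def abs_mult by (intro mult_mono) auto
  then show ?thesis by auto
qed

lemma osc_left: "-1/2 \<le> t \<Longrightarrow> t \<le> 0 \<Longrightarrow> osc (\<phi> t y0) = 0"
proof -
  assume "-1/2 \<le> t" "t \<le> 0"
  then have "\<phi> t y0 \<in> lseg"
    by (auto simp: lseg_def)
  then have "infdist (\<phi> t y0) lseg = 0"
    by simp
  then show ?thesis
    by (simp add: osc_def)
qed

lemma osc_y0: "osc y0 = 0"
  using osc_left[of 0] \<phi>_0[OF y0_in] by simp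

lemma osc_right:
  assumes "0 < t" "t \<le> 1/2"
  shows "osc (\<phi> t y0) = sin (1 / dist (\<phi> t y0) y0)"
proof -
  have "\<phi> t y0 \<in> rseg"
    using assms by (auto simp: rseg_def)
  then have "infdist (\<phi> t y0) rseg = 0"
    by simp
  moreover have "\<phi> t y0 \<noteq> y0"
    using assms line_eq_y0 by simp
  ultimately show ?thesis
    using infdist_sum_pos[of "\<phi> t y0"] by (simp add: osc_def)
qed

lemma continuous_on_osc: "continuous_on (- {y0}) osc"
proof -
  have "infdist y lseg + infdist y rseg \<noteq> 0" if "y \<in> - {y0}" for y
    using infdist_sum_pos[of y] that by auto
  then show ?thesis
    unfolding osc_def by (intro continuous_intros) auto
qed

lemma tendsto_osc:
  assumes "(g \<longlongrightarrow> y) F" "y \<noteq> y0"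
  shows "((\<lambda>x. osc (g x)) \<longlongrightarrow> osc y) F"
proof (rule continuous_on_tendsto_compose[OF continuous_on_osc assms(1)])
  show "eventually (\<lambda>x. g x \<in> - {y0}) F"
    using assms by (intro topological_tendstoD) auto
qed (use assms in auto)

text \<open>The distance to \<open>y0\<close> along the flow line is continuous and vanishes at time
  \<open>0\<close>, hence takes the value \<open>1 / x\<close> for every large \<open>x\<close>;
  here \<open>x\<close> is a large solution of \<open>sin x = a\<close>.\<close>

lemma osc_values:
  assumes a: "a \<in> {-1..1}" and d: "d > 0"
  obtains t where "0 < t" "t < d" "osc (\<phi> t y0) = a"
proof -
  define b where "b = min d 1 / 2"
  have b: "0 < b" "b < d" "b \<le> 1/2"
    using d by (auto simp: b_def min_def)
  define \<rho> where "\<rho> t = dist (\<phi> t y0) y0" for t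
  have \<rho>0: "\<rho> 0 = 0"
    using \<phi>_0[OF y0_in] by (simp add: \<rho>_def)
  have \<rho>b: "\<rho> b > 0"
    using b line_eq_y0 by (simp add: \<rho>_def)
  \<comment> \<open>As \<open>arcsin a \<ge> - 2\<close>, this \<open>n\<close> makes
    \<open>x\<close> exceed \<open>1 / \<rho> b\<close>, so that \<open>1 / x\<close> lies between
    \<open>\<rho> 0\<close> and \<open>\<rho> b\<close>.\<close>
  obtain n :: nat where n: "1 / \<rho> b + 2 < real n"
    using reals_Archimedean2 by blast
  define x where "x = arcsin a + of_int (int n) * (2 * pi)"
  have "arcsin a \<ge> - 2"
    using arcsin_bounded[of a] a pi_less_4 by auto
  moreover have "real n \<le> real n * (2 * pi)"
    using pi_gt3 mult_left_mono[of 1 "2 * pi" "real n"] by simp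
  ultimately have x: "1 / \<rho> b < x"
    using n by (simp add: x_def)
  have "x > 0"
    using x \<rho>b by (meson divide_pos_pos less_trans zero_less_one)
  have "sin x = a"
  proof -
    have "sin x = sin (arcsin a)"
      using sin.plus_of_int[of "arcsin a" "int n"] by (simp add: x_def)
    then show ?thesis
      using a by simp
  qed
  have "continuous_on {0..b} \<rho>"
    unfolding \<rho>_def by (intro continuous_intros continuous_on_line)
  moreover have "1 / x \<le> \<rho> b" "0 \<le> 1 / x"
    using x \<open>x > 0\<close> \<rho>b by (auto simp: field_simps)
  ultimately obtain t where t: "0 \<le> t" "t \<le> b" "\<rho> t = 1 / x"
    using IVT'[of \<rho> 0 "1 / x" b] \<rho>0 b by auto
  then have "t > 0"
    using \<rho>0 \<open>x > 0\<close> by (cases "t = 0") auto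
  have "osc (\<phi> t y0) = sin (1 / \<rho> t)"
    unfolding \<rho>_def using \<open>t > 0\<close> t b by (intro osc_right) auto
  then show ?thesis
    using that[of t] t \<open>t > 0\<close> b \<open>sin x = a\<close> by simp
qed

section \<open>The blown-up space and its minimality\<close>

lemma Z_eq: "(y, v) \<in> Z \<Longrightarrow> \<phi> (of_int n) y \<noteq> y0 \<Longrightarrow> v n = osc_seq y n"
  by (auto simp: Z_def osc_seq_def)

lemma Z_nonsingular: "(y, v) \<in> Z \<Longrightarrow> (\<And>n::int. \<phi> (of_int n) y \<noteq> y0) \<Longrightarrow> v = osc_seq y"
  using Z_eq by (intro ext) blast

lemma osc_seq_in_Z: "y \<in> Y \<Longrightarrow> (y, osc_seq y) \<in> Z"
  using osc_bound by (auto simp: Z_def osc_seq_def)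

lemma Z_values:
  assumes "(y, v) \<in> Z"
  shows "v n \<in> {-1..1}"
proof (cases "\<phi> (of_int n) y = y0")
  case True
  have "\<phi> (of_int n) y \<noteq> y0 \<and> v n = osc (\<phi> (of_int n) y) \<or> \<phi> (of_int n) y = y0 \<and> v n \<in> {-1..1}"
    using assms unfolding Z_def by simp
  then show ?thesis
    using True by simp
next
  case False
  then show ?thesis
    using Z_eq[OF assms False] osc_bound by (simp add: osc_seq_def)
qed

lemma Z_in_Y: "(y, v) \<in> Z \<Longrightarrow> y \<in> Y"
  by (simp add: Z_def)

lemma singular_unique:
  fixes m n :: int
  assumes "y \<in> Y" "\<phi> (of_int m) y = y0" "\<phi> (of_int n) y = y0"
  shows "m = n"
  using \<phi>_inj[OF assms(1), of "of_int m" "of_int n"] assms(2,3) by simp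

lemma tendsto_\<phi>:
  assumes "(g \<longlongrightarrow> y) F" "eventually (\<lambda>x. g x \<in> Y) F" "y \<in> Y"
  shows "((\<lambda>x. \<phi> t (g x)) \<longlongrightarrow> \<phi> t y) F"
proof (rule continuous_on_tendsto_compose[OF _ assms(1,3,2)])
  show "continuous_on Y (\<phi> t)"
    by (rule continuous_on_\<phi>) (auto intro: continuous_intros)
qed

lemma compact_Z: "compact Z"
proof -
  have "closed Z"
    unfolding closed_sequential_limits
  proof (intro allI impI)
    fix x :: "nat \<Rightarrow> 'a \<times> (int \<Rightarrow> real)" and l assume A: "(\<forall>n. x n \<in> Z) \<and> x \<longlonglongrightarrow> l"
    obtain y v where l: "l = (y, v)"
      by (cases l)
    have y: "(\<lambda>k. fst (x k)) \<longlonglongrightarrow> y" and "(\<lambda>k. snd (x k)) \<longlonglongrightarrow> v"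
      using A tendsto_fst[of x l sequentially] tendsto_snd[of x l sequentially] by (auto simp: l)
    then have v: "(\<lambda>k. snd (x k) n) \<longlonglongrightarrow> v n" for n
      unfolding tendsto_fun_iff[of "\<lambda>k. snd (x k)"] by blast
    have xZ: "(fst (x k), snd (x k)) \<in> Z" for k
      using A by simp
    then have xY: "fst (x k) \<in> Y" for k
      using Z_in_Y by blast
    have yY: "y \<in> Y"
      using closed_sequentially[OF compact_imp_closed[OF compact_Y] xY y] .
    have "\<phi> (of_int n) y \<noteq> y0 \<and> v n = osc (\<phi> (of_int n) y) \<or> \<phi> (of_int n) y = y0 \<and> v n \<in> {-1..1}" for n
    proof (cases "\<phi> (of_int n) y = y0")
      case True
      have "v n \<in> {-1..1}"
        using closed_sequentially[OF _ _ v, of "{-1..1}"] Z_values[OF xZ] by auto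
      then show ?thesis
        using True by simp
    next
      case False
      have lim: "(\<lambda>k. \<phi> (of_int n) (fst (x k))) \<longlonglongrightarrow> \<phi> (of_int n) y"
        using y xY yY by (intro tendsto_\<phi>) auto
      then have "(\<lambda>k. osc (\<phi> (of_int n) (fst (x k)))) \<longlonglongrightarrow> osc (\<phi> (of_int n) y)"
        using False by (rule tendsto_osc)
      moreover have "eventually (\<lambda>k. \<phi> (of_int n) (fst (x k)) \<in> - {y0}) sequentially"
        using lim False by (intro topological_tendstoD) auto
      then have "eventually (\<lambda>k. osc (\<phi> (of_int n) (fst (x k))) = snd (x k) n) sequentially"
        by eventually_elim (use Z_eq[OF xZ] in \<open>auto simp: osc_seq_def\<close>)
      ultimately have "(\<lambda>k. snd (x k) n) \<longlonglongrightarrow> osc (\<phi> (of_int n) y)"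
        using tendsto_cong by fast
      then show ?thesis
        using LIMSEQ_unique v False by blast
    qed
    then show "l \<in> Z"
      using yY by (simp add: l Z_def)
  qed
  moreover have "compact (Y \<times> PiE UNIV (\<lambda>_::int. {-1..1::real}))"
  proof (intro compact_Times compact_Y)
    have "compactin (product_topology (\<lambda>_. euclidean) UNIV) (PiE UNIV (\<lambda>_::int. {-1..1::real}))"
      by (simp add: compactin_PiE)
    then show "compact (PiE UNIV (\<lambda>_::int. {-1..1::real}))"
      by (simp add: euclidean_product_topology)
  qed
  moreover have "Z \<subseteq> Y \<times> PiE UNIV (\<lambda>_::int. {-1..1::real})"
    using Z_values Z_in_Y by auto
  ultimately show ?thesis
    by (metis compact_Int_closed inf.absorb_iff2)
qed

lemma act_in: "z \<in> Z \<Longrightarrow> act n z \<in> Z"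
  unfolding Z_def act_def using \<phi>_in by (auto simp flip: \<phi>_add of_int_add)

lemma act_action: "compact_action Z act"
proof
  show "compact Z" by (rule compact_Z)
  show "Z \<noteq> {}"
    using osc_seq_in_Z y0_in by blast
  show "act n z \<in> Z" if "z \<in> Z" for n z
    using that by (rule act_in)
  show "act 0 z = z" if "z \<in> Z" for z
    using that \<phi>_0 Z_in_Y by (auto simp: act_def split: prod.splits)
  show "act (m + n) z = act m (act n z)" if "z \<in> Z" for m n z
    using that \<phi>_add Z_in_Y by (auto simp: act_def split: prod.splits)
  show "continuous_on Z (act n)" for n
    unfolding act_def case_prod_unfold using Z_in_Y
    by (intro continuous_on_Pair continuous_on_\<phi> continuous_on_shift continuous_intros) force
qed

sublocale compact_action Z act
  by (rule act_action)

lemma act_free: "z \<in> Z \<Longrightarrow> act n z = z \<Longrightarrow> n = 0"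
  using \<phi>_free[of "fst z" "of_int n"] Z_in_Y[of "fst z" "snd z"]
  by (auto simp: act_def case_prod_unfold prod_eq_iff)

text \<open>The point is approached along its flow line from the right, at times where the singular
  coordinate has exactly the value \<open>v m\<close>; the other coordinates converge because
  \<open>osc\<close> is continuous off \<open>y0\<close>. As \<open>y\<close> reaches
  \<open>y0\<close> at an integer time, a delay strictly between \<open>0\<close> and
  \<open>1\<close> leads to nonsingular points.\<close>

lemma singular_limit:
  assumes z: "(y, v) \<in> Z" and m: "\<phi> (of_int m) y = y0"
  obtains t where "\<forall>k. 0 < t k \<and> t k < 1" "\<forall>k n. \<phi> (of_int n) (\<phi> (t k) y) \<noteq> y0"
    "(\<lambda>k. (\<phi> (t k) y, osc_seq (\<phi> (t k) y))) \<longlonglongrightarrow> (y, v)" "t \<longlonglongrightarrow> 0"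
proof -
  have y: "y \<in> Y"
    using z Z_in_Y by blast
  have "\<exists>t. 0 < t \<and> t < 1 / real (Suc k) \<and> osc (\<phi> t y0) = v m" for k
    using osc_values[OF Z_values[OF z, of m], of "1 / real (Suc k)"] by auto
  then obtain t where t: "\<And>k. 0 < t k" "\<And>k. t k < 1 / real (Suc k)" "\<And>k. osc (\<phi> (t k) y0) = v m"
    by metis
  have "1 / real (Suc k) \<le> 1" for k
    by simp
  then have t1: "t k < 1" for k
    using t(2)[of k] less_le_trans by blast
  have ns: "\<phi> (of_int n) (\<phi> (t k) y) \<noteq> y0" for n k
  proof
    assume "\<phi> (of_int n) (\<phi> (t k) y) = y0"
    then have "\<phi> (of_int n + t k) y = \<phi> (of_int m) y"
      using m \<phi>_add[OF y] by simp
    then have "of_int n + t k = of_int m"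
      by (rule \<phi>_inj[OF y])
    then have "t k = of_int (m - n)"
      by simp
    then have "0 < m - n" "m - n < 1"
      using t(1)[of k] t1[of k] by (metis of_int_0_less_iff, metis of_int_less_1_iff)
    then show False by simp
  qed
  have lim0: "t \<longlonglongrightarrow> 0"
  proof (rule tendsto_sandwich)
    show "eventually (\<lambda>k. 0 \<le> t k) sequentially" "eventually (\<lambda>k. t k \<le> 1 / real (Suc k)) sequentially"
      using less_imp_le[OF t(1)] less_imp_le[OF t(2)] by (auto intro!: always_eventually)
    show "(\<lambda>k. 1 / real (Suc k)) \<longlonglongrightarrow> 0"
      by (rule LIMSEQ_Suc[OF lim_inverse_n'])
  qed simp
  have "continuous_on UNIV (\<lambda>s. \<phi> s y)"
    using y by (intro continuous_on_\<phi>) (auto intro: continuous_intros)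
  then have limy: "(\<lambda>k. \<phi> (t k) y) \<longlonglongrightarrow> y"
    using continuous_on_tendsto_compose[OF _ lim0, of UNIV "\<lambda>s. \<phi> s y"] \<phi>_0[OF y] by simp
  have "(\<lambda>k. osc_seq (\<phi> (t k) y) n) \<longlonglongrightarrow> v n" for n
  proof (cases "n = m")
    case True
    have "osc_seq (\<phi> (t k) y) m = v m" for k
      using \<phi>_add[OF y, of "of_int m" "t k"] \<phi>_add[OF y, of "t k" "of_int m"] m t(3)
      by (simp add: osc_seq_def add.commute)
    then show ?thesis
      using True by simp
  next
    case False
    then have nn: "\<phi> (of_int n) y \<noteq> y0"
      using singular_unique[OF y] m by blast
    have "(\<lambda>k. \<phi> (of_int n) (\<phi> (t k) y)) \<longlonglongrightarrow> \<phi> (of_int n) y"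
      using limy y \<phi>_in[OF y] by (intro tendsto_\<phi>) auto
    then have "(\<lambda>k. osc (\<phi> (of_int n) (\<phi> (t k) y))) \<longlonglongrightarrow> osc (\<phi> (of_int n) y)"
      using nn by (rule tendsto_osc)
    then show ?thesis
      using Z_eq[OF z nn] by (simp add: osc_seq_def)
  qed
  then have "(\<lambda>k. osc_seq (\<phi> (t k) y)) \<longlonglongrightarrow> v"
    by (subst tendsto_fun_iff) blast
  then have "(\<lambda>k. (\<phi> (t k) y, osc_seq (\<phi> (t k) y))) \<longlonglongrightarrow> (y, v)"
    using limy by (intro tendsto_Pair)
  then show ?thesis
    using that t(1) t1 ns lim0 by blast
qed

text \<open>Over a nonsingular \<open>y'\<close> there is only one point of \<open>Z\<close>: if the
  base orbit returns to \<open>y'\<close>, then by compactness a subsequence of the lifts converges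
  to that point. Singular points are limits of such points.\<close>

lemma orbit_closure:
  assumes z: "z \<in> Z"
  shows "Z \<subseteq> closure (range (\<lambda>n::nat. act (int n) z))" (is "_ \<subseteq> closure ?O")
proof
  obtain y v where zy: "z = (y, v)"
    by (cases z)
  have y: "y \<in> Y"
    using z Z_in_Y zy by blast
  have regular: "(y', osc_seq y') \<in> closure ?O" if y': "y' \<in> Y" "\<And>n::int. \<phi> (of_int n) y' \<noteq> y0" for y'
  proof -
    have "\<exists>n::nat. dist (\<phi> (real n) y) y' < 1 / real (Suc k)" for k
      using \<phi>_dense[OF y y'(1)] by simp
    then obtain n :: "nat \<Rightarrow> nat" where n: "\<And>k. dist (\<phi> (real (n k)) y) y' < 1 / real (Suc k)"
      by metis
    have "(\<lambda>k. dist (\<phi> (real (n k)) y) y') \<longlonglongrightarrow> 0"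
    proof (rule tendsto_sandwich)
      show "eventually (\<lambda>k. 0 \<le> dist (\<phi> (real (n k)) y) y') sequentially"
        "eventually (\<lambda>k. dist (\<phi> (real (n k)) y) y' \<le> 1 / real (Suc k)) sequentially"
        using less_imp_le[OF n] by (auto intro!: always_eventually)
      show "(\<lambda>k. 1 / real (Suc k)) \<longlonglongrightarrow> 0"
        by (rule LIMSEQ_Suc[OF lim_inverse_n'])
    qed simp
    then have lim: "(\<lambda>k. \<phi> (real (n k)) y) \<longlonglongrightarrow> y'"
      by (rule iffD2[OF tendsto_dist_iff])
    define w where "w k = act (int (n k)) z" for k
    have "w k \<in> Z" for k
      using act_in z by (simp add: w_def)
    then obtain l r where l: "l \<in> Z" "strict_mono r" "(w \<circ> r) \<longlonglongrightarrow> l"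
      using compact_Z unfolding compact_eq_seq_compact_metric seq_compact_def by metis
    have "(\<lambda>k. fst ((w \<circ> r) k)) \<longlonglongrightarrow> fst l"
      using l(3) by (rule tendsto_fst)
    moreover have "(\<lambda>k. fst ((w \<circ> r) k)) = (\<lambda>k. \<phi> (real (n k)) y) \<circ> r"
      by (simp add: fun_eq_iff w_def act_def zy)
    ultimately have "fst l = y'"
      using LIMSEQ_subseq_LIMSEQ[OF lim l(2)] LIMSEQ_unique by metis
    then have "l = (y', osc_seq y')"
      using Z_nonsingular[of y' "snd l"] l(1) y'(2) by (metis prod.collapse)
    moreover have "l \<in> closure ?O"
      unfolding closure_sequential by (intro exI[of _ "w \<circ> r"]) (use l(3) in \<open>auto simp: w_def\<close>)
    ultimately show ?thesis by simp
  qed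
  fix z' assume z': "z' \<in> Z"
  obtain y' v' where zy': "z' = (y', v')"
    by (cases z')
  have y': "y' \<in> Y"
    using z' Z_in_Y zy' by blast
  show "z' \<in> closure ?O"
  proof (cases "\<exists>m::int. \<phi> (of_int m) y' = y0")
    case False
    then show ?thesis
      using regular[OF y'] Z_nonsingular[of y' v'] z' zy' by auto
  next
    case True
    then obtain m :: int where m: "\<phi> (of_int m) y' = y0"
      by blast
    obtain t where t: "\<forall>k. 0 < t k \<and> t k < 1" "\<forall>k n. \<phi> (of_int n) (\<phi> (t k) y') \<noteq> y0"
      "(\<lambda>k. (\<phi> (t k) y', osc_seq (\<phi> (t k) y'))) \<longlonglongrightarrow> (y', v')" "t \<longlonglongrightarrow> 0"
      by (rule singular_limit[OF z'[unfolded zy'] m])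
    have "(\<phi> (t k) y', osc_seq (\<phi> (t k) y')) \<in> closure ?O" for k
      by (rule regular[OF \<phi>_in[OF y']]) (use t(2) in blast)
    then show ?thesis
      using closed_sequentially[OF closed_closure _ t(3)] zy' by blast
  qed
qed

lemma act_dense:
  assumes "z \<in> Z" "z' \<in> Z" "d > 0"
  shows "\<exists>n::nat. dist (act (int n) z) z' < d"
proof -
  have "z' \<in> closure (range (\<lambda>n::nat. act (int n) z))"
    using orbit_closure[OF assms(1)] assms(2) by blast
  then obtain x where "x \<in> range (\<lambda>n::nat. act (int n) z)" "dist x z' < d"
    using assms(3) unfolding closure_approachable by blast
  then show ?thesis
    by blast
qed

end

section \<open>Path components and rigidity\<close>

context minimal_flow
begin

text \<open>Half-open, because the arc over time \<open>m + 1\<close> is joined to the line at the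
  value \<open>0\<close>, the limit from the left, while the arc over time \<open>m\<close> is
  accumulated by the oscillation but not reached by a path.\<close>

definition piece :: "int \<Rightarrow> ('a \<times> (int \<Rightarrow> real)) set" where
  "piece m = {z \<in> Z. \<exists>t. of_int m < t \<and> t \<le> of_int m + 1 \<and> fst z = \<phi> t y0}"

definition fiber :: "int \<Rightarrow> ('a \<times> (int \<Rightarrow> real)) set" where
  "fiber m = {z \<in> Z. fst z = \<phi> (of_int m) y0}"

lemma piece_sub: "piece m \<subseteq> Z"
  by (auto simp: piece_def)

lemma line_shift: "\<phi> (of_int n) (\<phi> t y0) = \<phi> (of_int n + t) y0"
  using \<phi>_add[OF y0_in] by simp

lemma y0_eq_line: "y0 = \<phi> s y0 \<longleftrightarrow> s = 0"
  using line_eq_y0[of s] by (rule subst[OF eq_commute])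

lemma continuous_on_osc_left: "continuous_on {-1<..0} (\<lambda>s. osc (\<phi> s y0))"
proof -
  have "continuous_on ({-1<..<0} \<union> {-1/2<..0}) (\<lambda>s. osc (\<phi> s y0))"
  proof (rule continuous_on_Un_local_open)
    have eq: "{-1<..<0} \<union> {-1/2<..0} = {-1<..0::real}"
      by auto
    have "{-1<..<0::real} = {-1<..0} \<inter> {..<0}" "{-1/2<..0::real} = {-1<..0} \<inter> {-1/2<..}"
      by auto
    then show "openin (top_of_set ({-1<..<0} \<union> {-1/2<..0::real})) {-1<..<0}"
      "openin (top_of_set ({-1<..<0} \<union> {-1/2<..0::real})) {-1/2<..0}"
      unfolding eq openin_open by (metis open_lessThan, metis open_greaterThan)
    show "continuous_on {-1<..<0} (\<lambda>s. osc (\<phi> s y0))"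
      by (rule continuous_on_compose2[OF continuous_on_osc continuous_on_line]) (auto simp: y0_eq_line)
    have "continuous_on {-1/2<..0} (\<lambda>s. 0::real)"
      by (rule continuous_on_const)
    then show "continuous_on {-1/2<..0} (\<lambda>s. osc (\<phi> s y0))"
      by (rule continuous_on_eq) (auto simp: osc_left)
  qed
  moreover have "{-1<..<0} \<union> {-1/2<..0} = {-1<..0::real}"
    by auto
  ultimately show ?thesis by simp
qed

text \<open>The piece is the graph of \<open>osc_seq\<close> over the times in
  \<open>{m<..m + 1}\<close>, continuous up to the right end where \<open>osc y0 = 0\<close> is the
  limit from the left, together with the arc over the right end; the two meet in the value
  \<open>0\<close>.\<close>

lemma path_connected_piece: "path_connected (piece m)"
proof -
  let ?I = "{of_int m<..of_int m + 1::real}"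
  define y1 where "y1 = \<phi> (of_int m + 1) y0"
  define w where "w t = (\<phi> t y0, osc_seq (\<phi> t y0))" for t
  \<comment> \<open>The right end reaches \<open>y0\<close> after time \<open>- m - 1\<close>, so
    this coordinate parametrises the arc over it.\<close>
  define e where "e a = (y1, \<lambda>n. if n = - m - 1 then a else osc_seq y1 n)" for a
  have zero: "\<phi> (of_int (- m - 1)) y1 = y0"
    unfolding y1_def line_shift using \<phi>_0[OF y0_in] by simp
  have y1: "y1 \<in> Y"
    unfolding y1_def by (rule line_in)
  have "piece m = w ` ?I \<union> e ` {-1..1}"
  proof
    show "piece m \<subseteq> w ` ?I \<union> e ` {-1..1}"
    proof
      fix z assume z: "z \<in> piece m"
      then obtain t where t: "of_int m < t" "t \<le> of_int m + 1" "fst z = \<phi> t y0" and zZ: "z \<in> Z"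
        by (auto simp: piece_def)
      obtain v where v: "z = (\<phi> t y0, v)"
        using t(3) by (cases z) auto
      show "z \<in> w ` ?I \<union> e ` {-1..1}"
      proof (cases "t = of_int m + 1")
        case False
        have "\<phi> (of_int n) (\<phi> t y0) \<noteq> y0" for n :: int
        proof
          assume "\<phi> (of_int n) (\<phi> t y0) = y0"
          then have "of_int n + t = 0"
            unfolding line_shift line_eq_y0 .
          then have "t = of_int (- n)"
            by simp
          then have "m < - n" "- n < m + 1"
            using t False by linarith+
          then show False by simp
        qed
        then have "v = osc_seq (\<phi> t y0)"
          using Z_nonsingular[of "\<phi> t y0" v] zZ v by simp
        then have "z = w t"
          by (simp add: v w_def)
        then show ?thesis
          using t by auto
      next
        case True
        then have zv: "z = (y1, v)"
          by (simp add: v y1_def)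
        have "v n = osc_seq y1 n" if "n \<noteq> - m - 1" for n
          using Z_eq[of y1 v n] zZ zv singular_unique[OF y1 _ zero] that by blast
        then have "z = e (v (- m - 1))"
          by (auto simp: zv e_def fun_eq_iff)
        moreover have "v (- m - 1) \<in> {-1..1}"
          using Z_values zZ zv by blast
        ultimately show ?thesis by blast
      qed
    qed
    have "w t \<in> piece m" if "t \<in> ?I" for t
      using that osc_seq_in_Z[OF line_in] by (auto simp: piece_def w_def)
    moreover have "e a \<in> piece m" if "a \<in> {-1..1}" for a
    proof -
      have "(y1, osc_seq y1) \<in> Z"
        by (rule osc_seq_in_Z[OF y1])
      then have "e a \<in> Z"
        using that zero unfolding Z_def e_def by auto
      then show ?thesis
        unfolding piece_def e_def y1_def by (auto intro!: exI[of _ "of_int m + 1"])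
    qed
    ultimately show "w ` ?I \<union> e ` {-1..1} \<subseteq> piece m"
      by blast
  qed
  moreover have "path_connected (w ` ?I \<union> e ` {-1..1})"
  proof (rule path_connected_Un)
    have "continuous_on ?I (\<lambda>t. osc_seq (\<phi> t y0) n)" for n
    proof (cases "n = - m - 1")
      case True
      have "continuous_on ?I (\<lambda>t. osc (\<phi> (of_int n + t) y0))"
        by (rule continuous_on_compose2[OF continuous_on_osc_left]) (auto intro!: continuous_intros simp: True)
      then show ?thesis
        unfolding osc_seq_def line_shift .
    next
      case False
      have ne: "\<phi> (of_int n + t) y0 \<noteq> y0" if "t \<in> ?I" for t
      proof
        assume "\<phi> (of_int n + t) y0 = y0"
        then have "t = of_int (- n)"
          unfolding line_eq_y0 by simp
        then have "m < - n" "- n \<le> m + 1"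
          using that by auto
        then show False
          using False by simp
      qed
      have sub: "(\<lambda>t. \<phi> (of_int n + t) y0) ` ?I \<subseteq> - {y0}"
        by (rule image_subsetI) (use ne in simp)
      have "continuous_on ?I (\<lambda>t. \<phi> (of_int n + t) y0)"
        by (rule continuous_on_compose2[OF continuous_on_line[of UNIV]]) (auto intro!: continuous_intros)
      then have "continuous_on ?I (\<lambda>t. osc (\<phi> (of_int n + t) y0))"
        by (rule continuous_on_compose2[OF continuous_on_osc]) (rule sub)
      then show ?thesis
        unfolding osc_seq_def line_shift .
    qed
    then have "continuous_on ?I w"
      unfolding w_def
      by (intro continuous_on_Pair continuous_on_line continuous_on_coordinatewise_then_product)
    then show "path_connected (w ` ?I)"
      by (rule path_connected_continuous_image) (simp add: convex_imp_path_connected)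
    have "continuous_on {-1..1} (\<lambda>a. if n = - m - 1 then a else osc_seq y1 n)" for n
      by (cases "n = - m - 1") (simp_all add: continuous_on_id)
    then have "continuous_on {-1..1} e"
      unfolding e_def
      by (intro continuous_on_Pair continuous_on_const continuous_on_coordinatewise_then_product)
    then show "path_connected (e ` {-1..1})"
      by (rule path_connected_continuous_image) (simp add: convex_imp_path_connected)
    have "osc_seq y1 (- m - 1) = 0"
      unfolding osc_seq_def zero by (rule osc_y0)
    then have "w (of_int m + 1) = e 0"
      by (auto simp: w_def e_def y1_def fun_eq_iff)
    moreover have "w (of_int m + 1) \<in> w ` ?I" "e 0 \<in> e ` {-1..1}"
      by auto
    ultimately show "w ` ?I \<inter> e ` {-1..1} \<noteq> {}"
      by (metis IntI empty_iff)
  qed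
  ultimately show ?thesis by simp
qed

text \<open>A path in \<open>Z\<close> cannot cross a singular time from the left: immediately to the right of it
  one coordinate takes both values \<open>1\<close> and \<open>-1\<close> arbitrarily close to the crossing.\<close>

lemma path_no_crossing:
  fixes g :: "real \<Rightarrow> 'a \<times> (int \<Rightarrow> real)" and m :: int
  assumes g: "continuous_on {0..1} g" "g ` {0..1} \<subseteq> Z"
    and s: "continuous_on {0..1} s" "\<And>u. u \<in> {0..1} \<Longrightarrow> fst (g u) = \<phi> (s u) y0"
  shows "(\<forall>u\<in>{0..1}. s u \<le> of_int m) \<or> (\<forall>u\<in>{0..1}. of_int m < s u)"
proof -
  define c where "c u = snd (g u) (- m)" for u
  have c_cont: "continuous_on {0..1} c"
    unfolding c_def by (rule continuous_on_product_then_coordinatewise[OF continuous_on_snd[OF g(1)]])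
  have c_eq: "c u = osc (\<phi> (s u - of_int m) y0)" if u: "u \<in> {0..1}" "s u \<noteq> of_int m" for u
  proof -
    have "(fst (g u), snd (g u)) \<in> Z"
      using g(2) u(1) by auto
    moreover have "\<phi> (of_int (- m)) (fst (g u)) \<noteq> y0"
      using u unfolding s(2)[OF u(1)] line_shift line_eq_y0 by simp
    ultimately have "c u = osc_seq (fst (g u)) (- m)"
      unfolding c_def by (rule Z_eq)
    then show ?thesis
      unfolding osc_seq_def s(2)[OF u(1)] line_shift by (simp add: add.commute)
  qed
  \<comment> \<open>This set of times is closed by continuity. It is also open: near a time where
    \<open>s\<close> equals \<open>m\<close>, larger values of \<open>s\<close> would make
    \<open>c\<close> oscillate. As the unit interval is connected, the set is empty or
    everything.\<close>
  let ?S = "{u \<in> {0..1}. s u \<le> of_int m}"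
  have "closedin (top_of_set {0..1}) ({0..1} \<inter> s -` {..of_int m})"
    using s(1) by (intro continuous_closedin_preimage) auto
  moreover have "{0..1} \<inter> s -` {..of_int m} = ?S"
    by auto
  ultimately have cl: "closedin (top_of_set {0..1}) ?S"
    by simp
  have "\<exists>d>0. \<forall>u\<in>{0..1}. dist u u0 < d \<longrightarrow> u \<in> ?S" if u0: "u0 \<in> ?S" for u0
  proof (cases "s u0 = of_int m")
    case False
    then have "of_int m - s u0 > 0"
      using u0 by simp
    then obtain d where "d > 0" "\<forall>u\<in>{0..1}. dist u u0 < d \<longrightarrow> dist (s u) (s u0) < of_int m - s u0"
      using s(1) u0 unfolding continuous_on_iff by blast
    then show ?thesis
      by (intro exI[of _ d]) (force simp: dist_real_def)
  next
    case True
    have "u0 \<in> {0..1}"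
      using u0 by simp
    then have "\<forall>e>0. \<exists>d>0. \<forall>u\<in>{0..1}. dist u u0 < d \<longrightarrow> dist (c u) (c u0) < e"
      by (rule bspec[OF c_cont[unfolded continuous_on_iff]])
    then have "\<exists>d>0. \<forall>u\<in>{0..1}. dist u u0 < d \<longrightarrow> dist (c u) (c u0) < 1/2"
      by (elim allE[of _ "1/2"] impE) simp_all
    then obtain d where d: "d > 0" "\<forall>u\<in>{0..1}. dist u u0 < d \<longrightarrow> dist (c u) (c u0) < 1/2"
      by (elim exE conjE)
    have "u \<in> ?S" if u: "u \<in> {0..1}" "dist u u0 < d" for u
    proof (rule ccontr)
      assume "u \<notin> ?S"
      then have su: "s u > of_int m"
        using u by auto
      have seg: "closed_segment u0 u \<subseteq> {0..1}"
        using u0 u(1) by (intro closed_segment_subset) auto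
      have "connected (s ` closed_segment u0 u)"
        by (intro connected_continuous_image continuous_on_subset[OF s(1) seg]) simp
      then have "{s u0..s u} \<subseteq> s ` closed_segment u0 u"
        by (rule connected_contains_Icc) auto
      then have hit: "\<exists>x\<in>{0..1}. dist x u0 < d \<and> s x = of_int m + t" if "0 < t" "t < s u - of_int m" for t
      proof -
        have "of_int m + t \<in> {s u0..s u}"
          using that True by auto
        then obtain x where x: "x \<in> closed_segment u0 u" "s x = of_int m + t"
          using \<open>{s u0..s u} \<subseteq> s ` closed_segment u0 u\<close> by (metis imageE subsetD)
        have "dist x u0 \<le> dist u u0"
          using dist_in_closed_segment[OF x(1)] by (simp add: dist_commute)
        then show ?thesis
          using x seg u(2) by (intro bexI[of _ x]) auto
      qed
      have near: "\<exists>x\<in>{0..1}. dist x u0 < d \<and> c x = a" if a: "a \<in> {-1..1}" for a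
      proof -
        obtain t where t: "0 < t" "t < s u - of_int m" "osc (\<phi> t y0) = a"
          using osc_values[OF a, of "s u - of_int m"] su by auto
        obtain x where x: "x \<in> {0..1}" "dist x u0 < d" "s x = of_int m + t"
          using hit[OF t(1,2)] by blast
        then have "c x = a"
          using c_eq[OF x(1)] t by simp
        then show ?thesis
          using x by blast
      qed
      \<comment> \<open>Now \<open>c u0\<close> would be within \<open>1/2\<close> of both
        \<open>1\<close> and \<open>- 1\<close>.\<close>
      obtain x1 x2 where x: "x1 \<in> {0..1}" "dist x1 u0 < d" "c x1 = 1"
        "x2 \<in> {0..1}" "dist x2 u0 < d" "c x2 = -1"
        using near[of 1] near[of "-1"] by auto
      have "dist (c x1) (c u0) < 1/2" "dist (c x2) (c u0) < 1/2"
        using d(2) x by blast+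
      then show False
        using x(3,6) by (auto simp: dist_real_def abs_if split: if_splits)
    qed
    then show ?thesis
      using d(1) by blast
  qed
  then have "openin (top_of_set {0..1}) ?S"
    unfolding openin_euclidean_subtopology_iff by (intro conjI ballI subsetI) auto
  moreover have "connected {0..1::real}"
    by simp
  ultimately have "?S = {} \<or> ?S = {0..1}"
    using cl unfolding connected_clopen by blast
  then show ?thesis
  proof
    assume none: "?S = {}"
    have "of_int m < s u" if "u \<in> {0..1}" for u
    proof (rule ccontr)
      assume "\<not> of_int m < s u"
      then have "u \<in> ?S"
        using that by simp
      then show False
        unfolding none by (rule emptyE)
    qed
    then show ?thesis by blast
  next
    assume all: "?S = {0..1}"
    have "s u \<le> of_int m" if "u \<in> {0..1}" for u
    proof -
      have "u \<in> ?S"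
        unfolding all by (rule that)
      then show ?thesis by simp
    qed
    then show ?thesis by blast
  qed
qed

text \<open>A path in \<open>Z\<close> projects to a path in \<open>Y\<close>, which follows the
  flow line of \<open>y0\<close> with a continuous time. By \<open>path_no_crossing\<close> this
  time can cross neither \<open>m\<close> nor \<open>m + 1\<close>.\<close>

lemma path_component_piece:
  assumes z: "z \<in> piece m"
  shows "path_component_set Z z = piece m"
proof
  show "piece m \<subseteq> path_component_set Z z"
    using z path_connected_piece piece_sub by (rule path_component_maximal)
  show "path_component_set Z z \<subseteq> piece m"
  proof
    fix z' assume "z' \<in> path_component_set Z z"
    then obtain g where g: "path g" "path_image g \<subseteq> Z" "pathstart g = z" "pathfinish g = z'"
      by (auto simp: path_component_def)
    have gc: "continuous_on {0..1} g" and gZ: "g ` {0..1} \<subseteq> Z"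
      using g by (auto simp: path_def path_image_def)
    have "fst (g u) \<in> Y" if "u \<in> {0..1}" for u
    proof -
      have "g u \<in> Z"
        using gZ that by blast
      then show ?thesis
        using Z_in_Y[of "fst (g u)" "snd (g u)"] by simp
    qed
    then have "fst ` g ` {0..1} \<subseteq> Y"
      by blast
    then have "(\<lambda>u. fst (g u)) ` {0..1} \<subseteq> Y"
      by (simp add: image_image)
    then have "\<exists>\<tau>. continuous_on {0..1} \<tau> \<and> (\<forall>u\<in>{0..1}. fst (g u) = \<phi> (\<tau> u) (fst (g 0)))"
      by (rule \<phi>_paths[OF continuous_on_fst[OF gc]])
    then obtain \<tau> where \<tau>: "continuous_on {0..1} \<tau>" "\<forall>u\<in>{0..1}. fst (g u) = \<phi> (\<tau> u) (fst (g 0))"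
      by (elim exE conjE)
    obtain t where t: "of_int m < t" "t \<le> of_int m + 1" "fst z = \<phi> t y0"
      using z by (auto simp: piece_def)
    have g0: "g 0 = z" "g 1 = z'"
      using g by (auto simp: pathstart_def pathfinish_def)
    have line: "fst (g u) = \<phi> (\<tau> u + t) y0" if "u \<in> {0..1}" for u
      using bspec[OF \<tau>(2) that] t(3) \<phi>_add[OF y0_in] by (simp add: g0)
    have "\<phi> (\<tau> 0 + t) y0 = \<phi> t y0"
      using line[of 0] t(3) by (simp add: g0)
    then have \<tau>0: "\<tau> 0 + t = t"
      unfolding line_eq_iff .
    have cont: "continuous_on {0..1} (\<lambda>u. \<tau> u + t)"
      by (intro continuous_intros \<tau>)
    have "of_int m < \<tau> 1 + t"
      using path_no_crossing[OF gc gZ cont line, of m] \<tau>0 t(1) by force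
    moreover have "\<tau> 1 + t \<le> of_int (m + 1)"
      using path_no_crossing[OF gc gZ cont line, of "m + 1"] \<tau>0 t(2) by force
    moreover have "z' \<in> Z"
      using gZ g0 by force
    ultimately show "z' \<in> piece m"
      using line[of 1] unfolding piece_def g0 by (intro CollectI conjI exI[of _ "\<tau> 1 + t"]) auto
  qed
qed

text \<open>Off the line of \<open>y0\<close> no coordinate is ever singular, so the whole flow line
  lifts continuously. The lift contains the forward orbit, which is dense.\<close>

lemma path_component_regular:
  assumes z: "z \<in> Z" and off: "\<And>t. fst z \<noteq> \<phi> t y0"
  shows "Z \<subseteq> closure (path_component_set Z z)"
proof -
  obtain y where y: "fst z = y" "y \<in> Y"
    using z Z_in_Y[of "fst z" "snd z"] by simp
  have ns: "\<phi> t y \<noteq> y0" for t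
    using \<phi>_swap[OF y(2), of t y0] off[of "- t"] y(1) by auto
  define w where "w t = (\<phi> t y, osc_seq (\<phi> t y))" for t
  have "snd z = osc_seq y"
    using Z_nonsingular[of y "snd z"] z y ns by (metis prod.collapse)
  then have z_eq: "z = (y, osc_seq y)"
    using y by (metis prod.collapse)
  have "continuous_on UNIV (\<lambda>t. osc (\<phi> (of_int n + t) y))" for n :: int
    using y ns
    by (intro continuous_on_compose2[OF continuous_on_osc] continuous_on_\<phi> continuous_intros) auto
  then have "continuous_on UNIV (\<lambda>t. osc_seq (\<phi> t y) n)" for n
    unfolding osc_seq_def using \<phi>_add[OF y(2)] by simp
  moreover have "continuous_on UNIV (\<lambda>t. \<phi> t y)"
    using y by (intro continuous_on_\<phi> continuous_intros) auto
  ultimately have "continuous_on UNIV w"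
    unfolding w_def by (intro continuous_on_Pair continuous_on_coordinatewise_then_product)
  then have "path_connected (range w)"
    by (rule path_connected_continuous_image) (simp add: convex_imp_path_connected)
  moreover have "z \<in> range w"
    using \<phi>_0[OF y(2)] by (auto simp: w_def z_eq intro!: image_eqI[of _ _ 0])
  moreover have "range w \<subseteq> Z"
    using osc_seq_in_Z \<phi>_in y(2) by (auto simp: w_def)
  ultimately have "range w \<subseteq> path_component_set Z z"
    by (intro path_component_maximal)
  moreover have "range (\<lambda>n::nat. act (int n) z) \<subseteq> range w"
  proof
    fix x assume "x \<in> range (\<lambda>n::nat. act (int n) z)"
    then obtain n :: nat where "x = act (int n) z"
      by blast
    moreover have "act (int n) z = w (real n)"
    proof -
      have "shift (int n) (osc_seq y) = osc_seq (\<phi> (real n) y)"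
      proof
        fix i
        have "\<phi> (of_int (i + int n)) y = \<phi> (of_int i) (\<phi> (real n) y)"
          using \<phi>_add[OF y(2), of "of_int i" "real n"] by simp
        then show "shift (int n) (osc_seq y) i = osc_seq (\<phi> (real n) y) i"
          by (simp add: osc_seq_def)
      qed
      then show ?thesis
        by (simp add: w_def act_def z_eq)
    qed
    ultimately show "x \<in> range w"
      by simp
  qed
  ultimately show ?thesis
    using orbit_closure[OF z] closure_mono by (meson order_trans)
qed

section \<open>Closures of the pieces\<close>

lemma piece_nonempty: "piece m \<noteq> {}"
proof -
  have "(\<phi> (of_int m + 1) y0, osc_seq (\<phi> (of_int m + 1) y0)) \<in> piece m"
    using osc_seq_in_Z[OF line_in] by (auto simp: piece_def intro!: exI[of _ "of_int m + 1"])
  then show ?thesis by blast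
qed

lemma piece_disjoint: "z \<in> piece m \<Longrightarrow> z \<in> piece n \<Longrightarrow> m = n"
proof -
  assume "z \<in> piece m" "z \<in> piece n"
  then obtain s t where s: "of_int m < s" "s \<le> of_int m + 1" "fst z = \<phi> s y0"
    and t: "of_int n < t" "t \<le> of_int n + 1" "fst z = \<phi> t y0"
    unfolding piece_def by blast
  have "s = t"
    using s(3) t(3) line_eq_iff by simp
  then have "m < n + 1" "n < m + 1"
    using s t by linarith+
  then show ?thesis by simp
qed

lemma closure_piece: "closure (piece m) \<subseteq> {z \<in> Z. \<exists>t. of_int m \<le> t \<and> t \<le> of_int m + 1 \<and> fst z = \<phi> t y0}"
proof (rule closure_minimal)
  let ?K = "(\<lambda>t. \<phi> t y0) ` {of_int m..of_int m + 1}"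
  have "closed ?K"
    by (intro compact_imp_closed compact_continuous_image continuous_on_line) simp
  then have "closed (Z \<inter> fst -` ?K)"
    using compact_imp_closed[OF compact_Z] by (intro closed_Int closed_vimage_fst)
  moreover have "Z \<inter> fst -` ?K = {z \<in> Z. \<exists>t. of_int m \<le> t \<and> t \<le> of_int m + 1 \<and> fst z = \<phi> t y0}"
    by auto
  ultimately show "closed {z \<in> Z. \<exists>t. of_int m \<le> t \<and> t \<le> of_int m + 1 \<and> fst z = \<phi> t y0}"
    by simp
  show "piece m \<subseteq> {z \<in> Z. \<exists>t. of_int m \<le> t \<and> t \<le> of_int m + 1 \<and> fst z = \<phi> t y0}"
    unfolding piece_def by (auto intro: less_imp_le)
qed

lemma fiber_sub_closure: "fiber m \<subseteq> closure (piece m)"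
proof
  fix z assume "z \<in> fiber m"
  then obtain v where z: "z = (\<phi> (of_int m) y0, v)" "(\<phi> (of_int m) y0, v) \<in> Z"
    unfolding fiber_def by (cases z) auto
  have "\<phi> (of_int (- m)) (\<phi> (of_int m) y0) = y0"
    unfolding line_shift using \<phi>_0[OF y0_in] by simp
  then obtain t where t: "\<forall>k. 0 < t k \<and> t k < 1"
    "\<forall>k n. \<phi> (of_int n) (\<phi> (t k) (\<phi> (of_int m) y0)) \<noteq> y0"
    "(\<lambda>k. (\<phi> (t k) (\<phi> (of_int m) y0), osc_seq (\<phi> (t k) (\<phi> (of_int m) y0)))) \<longlonglongrightarrow> (\<phi> (of_int m) y0, v)"
    "t \<longlonglongrightarrow> 0"
    by (rule singular_limit[OF z(2)])
  have "(\<phi> (t k) (\<phi> (of_int m) y0), osc_seq (\<phi> (t k) (\<phi> (of_int m) y0))) \<in> piece m" for k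
  proof -
    have "0 < t k" "t k < 1"
      using t(1) by blast+
    then show ?thesis
      unfolding \<phi>_add[OF y0_in, symmetric] piece_def
      by (intro CollectI conjI osc_seq_in_Z line_in exI[of _ "t k + of_int m"]) auto
  qed
  then have "(\<phi> (t k) (\<phi> (of_int m) y0), osc_seq (\<phi> (t k) (\<phi> (of_int m) y0))) \<in> closure (piece m)" for k
    using closure_subset by blast
  then show "z \<in> closure (piece m)"
    using closed_sequentially[OF closed_closure _ t(3)] z(1) by blast
qed

lemma closure_piece_Int: "closure (piece m) \<inter> piece (m - 1) = fiber m"
proof
  show "closure (piece m) \<inter> piece (m - 1) \<subseteq> fiber m"
  proof
    fix z assume z: "z \<in> closure (piece m) \<inter> piece (m - 1)"
    then obtain s where s: "of_int m \<le> s" "fst z = \<phi> s y0" "z \<in> Z"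
      using closure_piece by blast
    obtain t where t: "t \<le> of_int (m - 1) + 1" "fst z = \<phi> t y0"
      using z unfolding piece_def by blast
    have "s = of_int m"
      using s t line_eq_iff[of s t] by simp
    then show "z \<in> fiber m"
      using s by (simp add: fiber_def)
  qed
  have "fiber m \<subseteq> piece (m - 1)"
    unfolding fiber_def piece_def by (auto intro!: exI[of _ "of_int m"])
  then show "fiber m \<subseteq> closure (piece m) \<inter> piece (m - 1)"
    using fiber_sub_closure by blast
qed

lemma closure_piece_meets:
  assumes "closure (piece m) \<inter> piece k \<noteq> {}"
  shows "k = m \<or> k = m - 1"
proof -
  obtain z where z: "z \<in> closure (piece m)" "z \<in> piece k"
    using assms by blast
  obtain s where s: "of_int m \<le> s" "s \<le> of_int m + 1" "fst z = \<phi> s y0"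
    using z(1) closure_piece by blast
  obtain t where t: "of_int k < t" "t \<le> of_int k + 1" "fst z = \<phi> t y0"
    using z(2) unfolding piece_def by blast
  have "s = t"
    using s(3) t(3) line_eq_iff by simp
  then have "k < m + 1" "m \<le> k + 1"
    using s t by linarith+
  then show ?thesis
    by linarith
qed

text \<open>Non-density tells the pieces from all other path components. The witness is a point over
  time \<open>m + 2\<close>, beyond the closed segment of the piece.\<close>

lemma closure_piece_not_all: "closure (piece m) \<noteq> Z"
proof
  assume "closure (piece m) = Z"
  then have "(\<phi> (of_int m + 2) y0, osc_seq (\<phi> (of_int m + 2) y0)) \<in> closure (piece m)"
    using osc_seq_in_Z[OF line_in] by simp
  then have "(\<phi> (of_int m + 2) y0, osc_seq (\<phi> (of_int m + 2) y0)) \<in>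
      {z \<in> Z. \<exists>t. of_int m \<le> t \<and> t \<le> of_int m + 1 \<and> fst z = \<phi> t y0}"
    by (rule subsetD[OF closure_piece])
  then obtain t where "t \<le> of_int m + 1" "\<phi> (of_int m + 2) y0 = \<phi> t y0"
    unfolding mem_Collect_eq fst_conv by (elim conjE exE)
  then show False
    unfolding line_eq_iff by simp
qed

lemma fiber_nonempty: "(\<phi> (of_int m) y0, osc_seq (\<phi> (of_int m) y0)) \<in> fiber m"
  using osc_seq_in_Z[OF line_in] by (simp add: fiber_def)

lemma act_fiber: "z \<in> fiber m \<Longrightarrow> act n z \<in> fiber (m + n)"
  using act_in[of z n] line_shift[of n "of_int m"] unfolding fiber_def act_def
  by (auto simp: case_prod_unfold add.commute)

lemma fiber_eq:
  assumes "z \<in> fiber m" "z' \<in> fiber m"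
  shows "fst z = fst z'" and "i \<noteq> - m \<Longrightarrow> snd z i = snd z' i"
proof -
  show "fst z = fst z'"
    using assms by (simp add: fiber_def)
  assume i: "i \<noteq> - m"
  have "\<phi> (of_int i) (\<phi> (of_int m) y0) \<noteq> y0"
    unfolding line_shift line_eq_y0 using i by (metis add_eq_0_iff2 of_int_add of_int_eq_0_iff)
  then have "snd x i = osc_seq (\<phi> (of_int m) y0) i" if "x \<in> fiber m" for x
  proof (rule Z_eq[rotated])
    have "x \<in> Z" "fst x = \<phi> (of_int m) y0"
      using that by (auto simp: fiber_def)
    then show "(\<phi> (of_int m) y0, snd x) \<in> Z"
      by (cases x) simp
  qed
  then show "snd z i = snd z' i"
    using assms by simp
qed

section \<open>Rigidity of the blown-up space\<close>

lemma homeo_is_act: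
  assumes h: "continuous_on Z h" "h ` Z \<subseteq> Z" and g: "continuous_on Z g" "g ` Z \<subseteq> Z"
    and gh: "\<And>z. z \<in> Z \<Longrightarrow> g (h z) = z" and hg: "\<And>z. z \<in> Z \<Longrightarrow> h (g z) = z"
  shows "\<exists>k. \<forall>z\<in>Z. h z = act k z"
proof -
  have inj: "inj_on h Z"
    using gh by (rule inj_on_inverseI)
  have hZ: "h ` Z = Z"
    using h(2) g(2) hg by (metis image_subset_iff subsetI subset_antisym image_eqI)
  have half: "f ` path_component_set Z z \<subseteq> path_component_set Z (f z)"
    if f: "continuous_on Z f" "f ` Z \<subseteq> Z" and z: "z \<in> Z" for f z
  proof (rule path_component_maximal)
    show "f z \<in> f ` path_component_set Z z"
      using z by (simp add: path_component_refl)
    show "path_connected (f ` path_component_set Z z)"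
      using continuous_on_subset[OF f(1) path_component_subset] path_connected_path_component
      by (rule path_connected_continuous_image)
    show "f ` path_component_set Z z \<subseteq> Z"
      using f(2) path_component_subset by blast
  qed
  have comp: "h ` path_component_set Z z = path_component_set Z (h z)" if z: "z \<in> Z" for z
  proof
    show "h ` path_component_set Z z \<subseteq> path_component_set Z (h z)"
      using half[OF h z] .
    have "g ` path_component_set Z (h z) \<subseteq> path_component_set Z z"
      using half[OF g, of "h z"] z h(2) gh[OF z] by auto
    then have "h ` g ` path_component_set Z (h z) \<subseteq> h ` path_component_set Z z"
      by (rule image_mono)
    moreover have "h ` g ` path_component_set Z (h z) = path_component_set Z (h z)"
    proof -
      have "h (g x) = x" if "x \<in> path_component_set Z (h z)" for x
        using that path_component_subset hg by blast
      then show ?thesis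
        by (simp add: image_image)
    qed
    ultimately show "path_component_set Z (h z) \<subseteq> h ` path_component_set Z z"
      by simp
  qed
  have cl: "h ` closure W = closure (h ` W)" if "W \<subseteq> Z" for W
    using compact_Z that h(1) by (rule closure_image_homeo)
  have clZ: "closure W \<subseteq> Z" if "W \<subseteq> Z" for W
    using that compact_imp_closed[OF compact_Z] by (rule closure_minimal)
  have "\<exists>k. h ` piece m = piece k" for m
  proof -
    obtain z where z: "z \<in> piece m"
      using piece_nonempty by blast
    then have zZ: "z \<in> Z" "h z \<in> Z"
      using piece_sub h(2) by blast+
    have im: "h ` piece m = path_component_set Z (h z)"
      using comp[OF zZ(1)] path_component_piece[OF z] by simp
    \<comment> \<open>The image of a piece is a path component. If it lay off the line of
      \<open>y0\<close>, it would be dense, and so would be \<open>piece m\<close>.\<close>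
    show ?thesis
    proof (cases "\<exists>t. fst (h z) = \<phi> t y0")
      case True
      then obtain t where t: "fst (h z) = \<phi> t y0" by blast
      have "h z \<in> piece (\<lceil>t\<rceil> - 1)"
        unfolding piece_def using t zZ(2) by (auto intro!: exI[of _ t]) linarith
      then show ?thesis
        using path_component_piece im by blast
    next
      case False
      then have "Z \<subseteq> closure (h ` piece m)"
        unfolding im using path_component_regular[OF zZ(2)] by blast
      then have "h ` Z \<subseteq> h ` closure (piece m)"
        using cl[OF piece_sub] hZ by simp
      then have "Z \<subseteq> closure (piece m)"
        using inj_on_image_subset_iff[OF inj subset_refl clZ[OF piece_sub]] by blast
      then show ?thesis
        using closure_piece_not_all clZ[OF piece_sub] by blast
    qed
  qed
  then obtain \<kappa> where \<kappa>: "\<And>m. h ` piece m = piece (\<kappa> m)"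
    by metis
  have fib: "h ` fiber m = closure (piece (\<kappa> m)) \<inter> piece (\<kappa> (m - 1))" for m
  proof -
    have "h ` (closure (piece m) \<inter> piece (m - 1)) = h ` closure (piece m) \<inter> h ` piece (m - 1)"
      by (rule inj_on_image_Int[OF inj clZ[OF piece_sub] piece_sub])
    then show ?thesis
      unfolding closure_piece_Int cl[OF piece_sub] \<kappa> .
  qed
  \<comment> \<open>The incidence is directed: apart from \<open>piece m\<close> itself,
    \<open>closure (piece m)\<close> meets only \<open>piece (m - 1)\<close>. So
    \<open>\<kappa>\<close> commutes with the shift and cannot reverse the order.\<close>
  have step: "\<kappa> (m - 1) = \<kappa> m - 1" for m
  proof -
    have "closure (piece (\<kappa> m)) \<inter> piece (\<kappa> (m - 1)) \<noteq> {}"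
      using fib[of m] fiber_nonempty[of m] by blast
    moreover have "\<kappa> (m - 1) \<noteq> \<kappa> m"
    proof
      assume "\<kappa> (m - 1) = \<kappa> m"
      then have "h ` piece (m - 1) = h ` piece m"
        using \<kappa> by metis
      then have "piece (m - 1) = piece m"
        using inj_on_image_eq_iff[OF inj piece_sub piece_sub] by blast
      then show False
        using piece_nonempty[of m] piece_disjoint[of _ m "m - 1"] by force
    qed
    ultimately show ?thesis
      using closure_piece_meets by blast
  qed
  define k where "k = \<kappa> 0"
  have \<kappa>_eq: "\<kappa> m = m + k" for m
  proof (induction m rule: int_induct[where k = 0])
    case base
    show ?case by (simp add: k_def)
  next
    case (step1 i)
    then show ?case
      using step[of "i + 1"] by simp
  next
    case (step2 i)
    then show ?case
      using step[of i] by simp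
  qed
  have hfib: "h z \<in> fiber (m + k)" if "z \<in> fiber m" for m z
  proof -
    have "h ` fiber m = closure (piece (\<kappa> m)) \<inter> piece (\<kappa> m - 1)"
      using fib[of m] step[of m] by simp
    then show ?thesis
      using that \<kappa>_eq closure_piece_Int by auto
  qed
  have agree: "fst (h z) = fst (act k z) \<and> snd (h z) i = snd (act k z) i" if z: "z \<in> Z" for z i
  proof -
    \<comment> \<open>The forward orbit of \<open>x\<close> lies over the times \<open>N + n\<close>
      with \<open>n \<ge> 0\<close>, and its images lie in \<open>fiber (N + n + k)\<close>. By the
      size of \<open>N\<close> the singular coordinate there is never \<open>i\<close>.\<close>
    define N where "N = \<bar>i\<bar> + \<bar>k\<bar> + 1"
    define x where "x = (\<phi> (of_int N) y0, osc_seq (\<phi> (of_int N) y0))"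
    have x: "x \<in> fiber N"
      unfolding x_def by (rule fiber_nonempty)
    \<comment> \<open>\<open>F\<close> measures the deviation of \<open>h\<close> from
      \<open>act k\<close> in the base and in coordinate \<open>i\<close>; it vanishes on a forward
      orbit, hence by density on \<open>Z\<close>.\<close>
    define F where "F z = dist (fst (h z)) (fst (act k z)) + dist (snd (h z) i) (snd (act k z) i)" for z
    have sc: "continuous_on Z (\<lambda>z. snd (f z) i)" if "continuous_on Z f" for f :: "_ \<Rightarrow> 'a \<times> (int \<Rightarrow> real)"
      by (rule continuous_on_product_then_coordinatewise[OF continuous_on_snd[OF that]])
    have "continuous_on Z F"
      unfolding F_def
      by (intro continuous_on_add continuous_on_dist continuous_on_fst h A_cont sc[OF h(1)] sc[OF A_cont])
    then have "closed {z \<in> Z. F z = 0}"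
      using compact_imp_closed[OF compact_Z] by (rule continuous_closed_preimage_constant)
    moreover have "act (int n) x \<in> {z \<in> Z. F z = 0}" for n
    proof -
      have a: "act (int n) x \<in> fiber (N + int n)"
        using x by (rule act_fiber)
      have "h (act (int n) x) \<in> fiber (N + int n + k)" "act k (act (int n) x) \<in> fiber (N + int n + k)"
        using hfib[OF a] act_fiber[OF a] by auto
      moreover have "i \<noteq> - (N + int n + k)"
        unfolding N_def by linarith
      ultimately have "F (act (int n) x) = 0"
        using fiber_eq unfolding F_def by (metis add.right_neutral dist_self)
      then show ?thesis
        using a by (simp add: fiber_def)
    qed
    then have "range (\<lambda>n::nat. act (int n) x) \<subseteq> {z \<in> Z. F z = 0}"
      by blast
    ultimately have "closure (range (\<lambda>n::nat. act (int n) x)) \<subseteq> {z \<in> Z. F z = 0}"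
      by (intro closure_minimal)
    moreover have "x \<in> Z"
      using x by (simp add: fiber_def)
    ultimately have "F z = 0"
      using orbit_closure z by blast
    then show ?thesis
      unfolding F_def using zero_le_dist by (metis add_nonneg_eq_0_iff dist_eq_0_iff)
  qed
  have "h z = act k z" if "z \<in> Z" for z
    using agree[OF that] by (metis prod_eqI ext)
  then show ?thesis by blast
qed

end

section \<open>Entropy of the extension\<close>

lemma dist_fun_close:
  assumes "\<epsilon> > 0"
  obtains N :: nat and d where "d > 0"
    "\<forall>v v' :: int \<Rightarrow> 'a::metric_space. (\<forall>i. \<bar>i\<bar> \<le> int N \<longrightarrow> dist (v i) (v' i) \<le> d) \<longrightarrow> dist v v' \<le> \<epsilon>"
proof -
  obtain K where K: "(1/2) ^ K < \<epsilon> / 2"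
    using real_arch_pow_inv[of "\<epsilon> / 2" "1/2"] assms by auto
  \<comment> \<open>\<open>N\<close> bounds the first \<open>K + 1\<close> integers in the
    enumeration behind the metric on functions; the coordinates after them contribute at most
    \<open>(1/2) ^ K\<close>.\<close>
  define N where "N = nat (Max ((\<lambda>n. \<bar>from_nat n :: int\<bar>) ` {..K}))"
  have "dist v v' \<le> \<epsilon>" if *: "\<forall>i. \<bar>i\<bar> \<le> int N \<longrightarrow> dist (v i) (v' i) \<le> \<epsilon> / 4"
    for v v' :: "int \<Rightarrow> 'a"
  proof -
    have "\<bar>from_nat n :: int\<bar> \<le> int N" if "n \<le> K" for n
    proof -
      have "\<bar>from_nat n :: int\<bar> \<le> Max ((\<lambda>n. \<bar>from_nat n :: int\<bar>) ` {..K})"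
        using that by (intro Max_ge) auto
      then show ?thesis
        unfolding N_def by linarith
    qed
    then have le: "dist (v (from_nat n)) (v' (from_nat n)) \<le> \<epsilon> / 4" if "n \<le> K" for n
      using * that by blast
    have "{dist (v (from_nat n)) (v' (from_nat n)) |n. n \<le> K} = (\<lambda>n. dist (v (from_nat n)) (v' (from_nat n))) ` {..K}"
      by auto
    then have "Max {dist (v (from_nat n)) (v' (from_nat n)) |n. n \<le> K} \<le> \<epsilon> / 4"
      using le by (simp only:) (intro Max.boundedI, auto)
    then show ?thesis
      using dist_fun_le_dist_first_terms[of v v' K] K by linarith
  qed
  then show ?thesis
    using that[of "\<epsilon> / 4" N] assms by simp
qed

lemma dist_pair_fun_close:
  assumes "\<epsilon> > 0"
  obtains N :: nat and d where "d > 0"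
    "\<forall>z z' :: 'b::metric_space \<times> (int \<Rightarrow> 'a::metric_space).
      dist (fst z) (fst z') \<le> d \<longrightarrow> (\<forall>i. \<bar>i\<bar> \<le> int N \<longrightarrow> dist (snd z i) (snd z' i) \<le> d) \<longrightarrow> dist z z' \<le> \<epsilon>"
proof -
  have "\<epsilon> / 2 > 0"
    using assms by simp
  then obtain N :: nat and d where d: "d > 0"
    "\<forall>v v' :: int \<Rightarrow> 'a. (\<forall>i. \<bar>i\<bar> \<le> int N \<longrightarrow> dist (v i) (v' i) \<le> d) \<longrightarrow> dist v v' \<le> \<epsilon> / 2"
    by (rule dist_fun_close)
  have "dist z z' \<le> \<epsilon>"
    if a: "dist (fst z) (fst z') \<le> min d (\<epsilon> / 2)" and b: "\<forall>i. \<bar>i\<bar> \<le> int N \<longrightarrow> dist (snd z i) (snd z' i) \<le> min d (\<epsilon> / 2)"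
    for z z' :: "'b \<times> (int \<Rightarrow> 'a)"
  proof -
    have "dist (snd z) (snd z') \<le> \<epsilon> / 2"
      using b d(2)[rule_format, of "snd z" "snd z'"] by simp
    moreover have "dist z z' \<le> dist (fst z) (fst z') + dist (snd z) (snd z')"
      unfolding dist_prod_def by (rule sqrt_sum_squares_le_sum) auto
    ultimately show ?thesis
      using a by simp
  qed
  then show ?thesis
    using that[of "min d (\<epsilon> / 2)" N] d(1) assms by simp
qed

lemma card_gapped:
  fixes W :: "nat set"
  assumes "W \<subseteq> {..<n}" "g > 0" and gap: "\<And>i j. i \<in> W \<Longrightarrow> j \<in> W \<Longrightarrow> i < j \<Longrightarrow> g \<le> j - i"
  shows "card W \<le> n div g + 1"
proof -
  have "inj_on (\<lambda>i. i div g) W"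
  proof (rule linorder_inj_onI')
    fix i j assume ij: "i \<in> W" "j \<in> W" "i < j"
    then have "i + g \<le> j"
      using gap[OF ij] by simp
    then have "(i + g) div g \<le> j div g"
      by (rule div_le_mono)
    then show "i div g \<noteq> j div g"
      using assms(2) by simp
  qed
  moreover have "(\<lambda>i. i div g) ` W \<subseteq> {..n div g}"
  proof (rule image_subsetI)
    fix i assume "i \<in> W"
    then have "i \<le> n"
      using assms(1) by auto
    then show "i div g \<in> {..n div g}"
      by (simp add: div_le_mono)
  qed
  ultimately have "card W \<le> card {..n div g}"
    by (intro card_inj_on_le) auto
  then show ?thesis by simp
qed

text \<open>The power of \<open>M\<close> is the cost of recording one value every \<open>g\<close>
  steps. Its rate \<open>ln M / g\<close> is at most \<open>e\<close>; together with
  \<open>h + e\<close> this gives \<open>h + 2 * e\<close>, and the third \<open>e\<close> absorbs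
  the constants for large \<open>n\<close>.\<close>

lemma exp_growth_absorb:
  fixes h e :: real and M g c :: nat
  assumes "e > 0" "M > 0" "g > 0" "ln (real M) \<le> e * real g"
  shows "eventually (\<lambda>n. exp ((h + e) * real (n + c)) * real (M ^ ((n + c) div g + 1)) \<le> exp ((h + 3 * e) * real n)) sequentially"
proof -
  define K where "K = ((h + 2 * e) * real c + ln (real M)) / e"
  have "eventually (\<lambda>n. K \<le> real n) sequentially"
    by (metis eventually_sequentiallyI linorder_le_cases nat_ceiling_le_eq)
  then show ?thesis
  proof eventually_elim
    case (elim n)
    have M1: "ln (real M) \<ge> 0"
      using assms(2) by simp
    have "real ((n + c) div g + 1) * ln (real M) \<le> (real (n + c) / real g + 1) * ln (real M)"
      using M1 of_nat_div_le_of_nat[of "n + c" g] by (intro mult_right_mono) auto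
    also have "\<dots> = real (n + c) * (ln (real M) / real g) + ln (real M)"
      by (simp add: field_simps)
    also have "\<dots> \<le> real (n + c) * e + ln (real M)"
      using assms(3,4) by (intro add_right_mono mult_left_mono) (auto simp: field_simps)
    finally have "(h + e) * real (n + c) + real ((n + c) div g + 1) * ln (real M) \<le> (h + 3 * e) * real n"
      using elim assms(1) by (simp add: K_def field_simps)
    moreover have "real (M ^ ((n + c) div g + 1)) = exp (real ((n + c) div g + 1) * ln (real M))"
      using assms(2) by (simp only: exp_of_nat_mult exp_ln of_nat_power of_nat_0_less_iff)
    ultimately show ?case
      by (simp only: exp_add[symmetric] exp_le_cancel_iff)
  qed
qed

context minimal_flow
begin

definition time_map :: "int \<Rightarrow> 'a \<Rightarrow> 'a" where
  "time_map n = \<phi> (of_int n)"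

text \<open>\<open>y0\<close> is not periodic, so its first \<open>g\<close> images avoid a ball
  around \<open>y0\<close>; by continuity the images of all nearby points avoid a smaller one.
  Visits near \<open>y0\<close> are thus more than \<open>g\<close> steps apart.\<close>

lemma return_gap:
  "\<exists>\<eta>>0. \<forall>y\<in>Y. dist y y0 < 2 * \<eta> \<longrightarrow> (\<forall>i::nat. 1 \<le> i \<and> i \<le> g \<longrightarrow> 2 * \<eta> \<le> dist (\<phi> (real i) y) y0)"
proof (induction g)
  case 0
  then show ?case
    by (intro exI[of _ 1]) auto
next
  case (Suc g)
  obtain \<eta> where \<eta>: "\<eta> > 0"
    "\<forall>y\<in>Y. dist y y0 < 2 * \<eta> \<longrightarrow> (\<forall>i::nat. 1 \<le> i \<and> i \<le> g \<longrightarrow> 2 * \<eta> \<le> dist (\<phi> (real i) y) y0)"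
    using Suc.IH by (elim exE conjE)
  define a where "a = dist (\<phi> (real (Suc g)) y0) y0"
  have "a > 0"
    using line_eq_y0[of "real (Suc g)"] by (simp add: a_def)
  have "continuous_on Y (\<phi> (real (Suc g)))"
    by (rule continuous_on_\<phi>) (auto intro: continuous_intros)
  then have "\<forall>e>0. \<exists>d>0. \<forall>y\<in>Y. dist y y0 < d \<longrightarrow> dist (\<phi> (real (Suc g)) y) (\<phi> (real (Suc g)) y0) < e"
    unfolding continuous_on_iff using y0_in by (rule bspec)
  then have "\<exists>d>0. \<forall>y\<in>Y. dist y y0 < d \<longrightarrow> dist (\<phi> (real (Suc g)) y) (\<phi> (real (Suc g)) y0) < a / 2"
    using \<open>a > 0\<close> by (elim allE[of _ "a / 2"] impE) simp_all
  then obtain d where d: "d > 0"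
    "\<forall>y\<in>Y. dist y y0 < d \<longrightarrow> dist (\<phi> (real (Suc g)) y) (\<phi> (real (Suc g)) y0) < a / 2"
    by (elim exE conjE)
  define \<theta> where "\<theta> = min \<eta> (min (d / 2) (a / 4))"
  have \<theta>: "\<theta> > 0" "\<theta> \<le> \<eta>" "2 * \<theta> \<le> d" "2 * \<theta> \<le> a / 2"
    using \<eta>(1) d(1) \<open>a > 0\<close> by (auto simp: \<theta>_def)
  have "2 * \<theta> \<le> dist (\<phi> (real i) y) y0" if y: "y \<in> Y" "dist y y0 < 2 * \<theta>" and i: "1 \<le> i" "i \<le> Suc g" for y i
  proof (cases "i = Suc g")
    case True
    have "dist (\<phi> (real i) y) (\<phi> (real i) y0) < a / 2"
      using d(2) y \<theta>(3) unfolding True by auto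
    moreover have "a \<le> dist (\<phi> (real i) y0) (\<phi> (real i) y) + dist (\<phi> (real i) y) y0"
      unfolding True a_def by (rule dist_triangle)
    ultimately show ?thesis
      using \<theta>(4) by (simp add: dist_commute)
  next
    case False
    then have "2 * \<eta> \<le> dist (\<phi> (real i) y) y0"
      using \<eta>(2) y i \<theta>(2) by auto
    then show ?thesis
      using \<theta>(2) by linarith
  qed
  then show ?case
    using \<theta>(1) by (intro exI[of _ \<theta>]) auto
qed

text \<open>A point of \<open>Z\<close> is coded by the cell of its base point and by the rounded
  values of those coordinates at which the cell comes near \<open>y0\<close>; elsewhere
  \<open>osc\<close> is uniformly continuous and the cell fixes the coordinate up to
  \<open>d\<close>. Near visits are at least \<open>g\<close> apart, so few values are
  recorded.\<close>

lemma covered_lift: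
  fixes n N g :: nat
  assumes close: "\<forall>z z' :: 'a \<times> (int \<Rightarrow> real).
      dist (fst z) (fst z') \<le> d \<longrightarrow> (\<forall>i. \<bar>i\<bar> \<le> int N \<longrightarrow> dist (snd z i) (snd z' i) \<le> d) \<longrightarrow> dist z z' \<le> \<epsilon>"
    and d: "d > 0" and g: "g > 0"
    and gap: "\<forall>y\<in>Y. dist y y0 < 2 * \<eta> \<longrightarrow> (\<forall>i::nat. 1 \<le> i \<and> i \<le> g \<longrightarrow> 2 * \<eta> \<le> dist (\<phi> (real i) y) y0)"
    and unif: "\<And>x x'. x \<in> Y \<Longrightarrow> x' \<in> Y \<Longrightarrow> \<eta> \<le> dist x y0 \<Longrightarrow> \<eta> \<le> dist x' y0 \<Longrightarrow> dist x x' \<le> \<delta> \<Longrightarrow>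
      dist (osc x) (osc x') \<le> d"
    and \<delta>: "\<delta> \<le> d" "\<delta> < \<eta>" "\<eta> > 0"
    and cov: "covered Y time_map (n + (2 * N + 1)) \<delta> K"
  shows "covered Z act n \<epsilon> (K * real (card {\<lfloor>-1 / d\<rfloor>..\<lfloor>1 / d\<rfloor>} ^ ((n + (2 * N + 1)) div g + 1)))"
proof -
  \<comment> \<open>The coordinates \<open>i + j\<close> with \<open>i < n\<close> and
    \<open>\<bar>j\<bar> \<le> N\<close> are needed, so the base orbit is followed over
    \<open>n + (2 * N + 1)\<close> steps, starting at time \<open>- N\<close>.\<close>
  define n' where "n' = n + (2 * N + 1)"
  define Bn where "Bn = {\<lfloor>-1 / d\<rfloor>..\<lfloor>1 / d\<rfloor>}"
  have Bn: "finite Bn" "card Bn \<ge> 1"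
  proof -
    show "finite Bn" by (simp add: Bn_def)
    have "\<lfloor>-1 / d\<rfloor> \<le> \<lfloor>1 / d\<rfloor>"
      using d by (intro floor_mono) (simp add: field_simps)
    then have "Bn \<noteq> {}"
      by (simp add: Bn_def)
    then show "card Bn \<ge> 1"
      using \<open>finite Bn\<close> by (simp add: Suc_le_eq card_gt_0_iff)
  qed
  obtain \<P> where \<P>: "finite \<P>" "real (card \<P>) \<le> K" "Y \<subseteq> \<Union>\<P>"
    and close_Y: "\<forall>P\<in>\<P>. \<forall>x\<in>P \<inter> Y. \<forall>y\<in>P \<inter> Y. \<forall>i<n'. dist (time_map (int i) x) (time_map (int i) y) \<le> \<delta>"
    using cov unfolding covered_def n'_def by (elim exE conjE)
  define \<kappa> where "\<kappa> y = (SOME P. P \<in> \<P> \<and> y \<in> P)" for y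
  have \<kappa>: "\<kappa> y \<in> \<P>" "y \<in> \<kappa> y" if "y \<in> Y" for y
  proof -
    have "\<exists>P. P \<in> \<P> \<and> y \<in> P"
      using \<P>(3) that by blast
    then show "\<kappa> y \<in> \<P>" "y \<in> \<kappa> y"
      unfolding \<kappa>_def by (metis (mono_tags, lifting) someI_ex)+
  qed
  have near: "dist (\<phi> (real i) x) (\<phi> (real i) y) \<le> \<delta>" if "P \<in> \<P>" "x \<in> P \<inter> Y" "y \<in> P \<inter> Y" "i < n'" for P x y i
    using close_Y[rule_format, OF that] by (simp add: time_map_def)
  \<comment> \<open>Near visits are attributed to the cell, not to the point, so that all points of
    a cell record the same positions. If one of them comes within \<open>\<eta>\<close> of
    \<open>y0\<close>, the others come within \<open>2 * \<eta>\<close>, as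
    \<open>\<delta> < \<eta>\<close>.\<close>
  define Vis where "Vis P = {i\<in>{..<n'}. \<exists>y\<in>P \<inter> Y. dist (\<phi> (real i) y) y0 < \<eta>}" for P
  have Vis_near: "dist (\<phi> (real i) y) y0 < 2 * \<eta>" if P: "P \<in> \<P>" and i: "i \<in> Vis P" and y: "y \<in> P \<inter> Y" for P i y
  proof -
    obtain x where x: "x \<in> P \<inter> Y" "dist (\<phi> (real i) x) y0 < \<eta>" "i < n'"
      using i by (auto simp: Vis_def)
    have "dist (\<phi> (real i) y) (\<phi> (real i) x) \<le> \<delta>"
      using near[OF P y x(1,3)] .
    then show ?thesis
      using dist_triangle[of "\<phi> (real i) y" y0 "\<phi> (real i) x"] x(2) \<delta> by linarith
  qed
  have card_Vis: "card (Vis P) \<le> n' div g + 1" if P: "P \<in> \<P>" for P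
  proof (cases "P \<inter> Y = {}")
    case True
    then show ?thesis by (simp add: Vis_def)
  next
    case False
    then obtain y where y: "y \<in> P \<inter> Y" by blast
    show ?thesis
    proof (rule card_gapped[OF _ g])
      show "Vis P \<subseteq> {..<n'}"
        by (auto simp: Vis_def)
      fix i j assume ij: "i \<in> Vis P" "j \<in> Vis P" "i < j"
      show "g \<le> j - i"
      proof (rule ccontr)
        assume "\<not> g \<le> j - i"
        then have ji: "1 \<le> j - i" "j - i \<le> g"
          using ij(3) by auto
        have "\<phi> (real (j - i)) (\<phi> (real i) y) = \<phi> (real j) y"
          using \<phi>_add[of y "real (j - i)" "real i"] y ij(3) by (simp add: of_nat_diff)
        moreover have "2 * \<eta> \<le> dist (\<phi> (real (j - i)) (\<phi> (real i) y)) y0"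
          using gap \<phi>_in Vis_near[OF P ij(1) y] y ji by blast
        ultimately show False
          using Vis_near[OF P ij(2) y] by simp
      qed
    qed
  qed
  define base where "base z = \<phi> (- real N) (fst z)" for z :: "'a \<times> (int \<Rightarrow> real)"
  have base: "base z \<in> Y" if "z \<in> Z" for z
    using that Z_in_Y[of "fst z" "snd z"] \<phi>_in by (simp add: base_def)
  define code where "code z = (\<kappa> (base z), \<lambda>i\<in>Vis (\<kappa> (base z)). \<lfloor>snd z (int i - int N) / d\<rfloor>)" for z :: "'a \<times> (int \<Rightarrow> real)"
  let ?T = "Sigma \<P> (\<lambda>P. PiE (Vis P) (\<lambda>_. Bn))"
  have fin_Vis: "finite (Vis P)" for P
    by (simp add: Vis_def)
  have finT: "finite ?T"
    using \<P>(1) Bn(1) fin_Vis by (intro finite_SigmaI finite_PiE) auto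
  have "code z \<in> ?T" if z: "z \<in> Z" for z
  proof -
    have "\<lfloor>snd z m / d\<rfloor> \<in> Bn" for m
    proof -
      have "snd z m \<in> {-1..1}"
        using Z_values[of "fst z" "snd z"] z by simp
      then show ?thesis
        unfolding Bn_def atLeastAtMost_iff using d
        by (intro conjI floor_mono divide_right_mono) auto
    qed
    then show ?thesis
      unfolding code_def using \<kappa>(1)[OF base[OF z]] by simp
  qed
  then have sub: "code ` Z \<subseteq> ?T"
    by blast
  have "card (code ` Z) \<le> card ?T"
    using sub finT by (rule card_mono[rotated])
  also have "card ?T = (\<Sum>P\<in>\<P>. card Bn ^ card (Vis P))"
    using \<P>(1) Bn(1) fin_Vis by (subst card_SigmaI) (auto intro: finite_PiE simp: card_PiE)
  also have "\<dots> \<le> (\<Sum>P\<in>\<P>. card Bn ^ (n' div g + 1))"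
    using card_Vis Bn(2) by (intro sum_mono power_increasing) auto
  finally have "card (code ` Z) \<le> card \<P> * card Bn ^ (n' div g + 1)"
    by simp
  then have "real (card (code ` Z)) \<le> real (card \<P> * card Bn ^ (n' div g + 1))"
    by (simp only: of_nat_le_iff)
  also have "\<dots> \<le> K * real (card Bn ^ (n' div g + 1))"
    using \<P>(2) by (simp only: of_nat_mult) (intro mult_right_mono, auto)
  finally have card: "real (card (code ` Z)) \<le> K * real (card Bn ^ (n' div g + 1))" .
  have same: "dist (act (int i) z) (act (int i) z') \<le> \<epsilon>"
    if z: "z \<in> Z" "z' \<in> Z" and eq: "code z = code z'" and i: "i < n" for z z' i
  proof -
    define P where "P = \<kappa> (base z)"
    have P': "\<kappa> (base z') = P"
      using eq by (simp add: code_def P_def)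
    have P: "P \<in> \<P>" "base z \<in> P \<inter> Y" "base z' \<in> P \<inter> Y"
      using \<kappa>[OF base[OF z(1)]] \<kappa>[OF base[OF z(2)]] base[OF z(1)] base[OF z(2)] P' by (auto simp: P_def)
    have shift_base: "\<phi> (real l) (base x) = \<phi> (of_int (int l - int N)) (fst x)" if "x \<in> Z" for x l
      using \<phi>_add[of "fst x" "real l" "- real N"] Z_in_Y[of "fst x" "snd x"] that by (simp add: base_def)
    have coord: "dist (snd z (int l - int N)) (snd z' (int l - int N)) \<le> d" if l: "l < n'" for l
    proof (cases "l \<in> Vis P")
      case True
      have "\<lfloor>snd z (int l - int N) / d\<rfloor> = \<lfloor>snd z' (int l - int N) / d\<rfloor>"
        using fun_cong[OF arg_cong[OF eq, of snd], of l] True P' by (simp add: code_def P_def)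
      then have "\<bar>snd z (int l - int N) / d - snd z' (int l - int N) / d\<bar> < 1"
        by linarith
      then show ?thesis
        using d by (simp add: dist_real_def field_simps flip: diff_divide_distrib)
    next
      case False
      have far: "\<eta> \<le> dist (\<phi> (real l) x) y0" if "x \<in> P \<inter> Y" for x
        using False l that by (auto simp: Vis_def not_less)
      have val: "snd x (int l - int N) = osc (\<phi> (real l) (base x))" if x: "x \<in> Z" "base x \<in> P \<inter> Y" for x
      proof -
        have "\<phi> (of_int (int l - int N)) (fst x) \<noteq> y0"
          using far[OF x(2)] \<delta>(3) shift_base[OF x(1)] by auto
        then have "snd x (int l - int N) = osc_seq (fst x) (int l - int N)"
          using Z_eq[of "fst x" "snd x"] x(1) by simp
        then show ?thesis
          unfolding osc_seq_def shift_base[OF x(1)] .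
      qed
      have in_Y: "\<phi> (real l) (base z) \<in> Y" "\<phi> (real l) (base z') \<in> Y"
        using P \<phi>_in by auto
      show ?thesis
        unfolding val[OF z(1) P(2)] val[OF z(2) P(3)]
        using unif[OF in_Y far[OF P(2)] far[OF P(3)] near[OF P l]] .
    qed
    have "dist (fst (act (int i) z)) (fst (act (int i) z')) \<le> d"
    proof -
      have "i + N < n'"
        using i by (simp add: n'_def)
      then have "dist (\<phi> (real (i + N)) (base z)) (\<phi> (real (i + N)) (base z')) \<le> \<delta>"
        by (rule near[OF P])
      then show ?thesis
        unfolding shift_base[OF z(1)] shift_base[OF z(2)] using \<delta>(1) by (simp add: act_def case_prod_unfold)
    qed
    moreover have "dist (snd (act (int i) z) j) (snd (act (int i) z') j) \<le> d" if "\<bar>j\<bar> \<le> int N" for j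
    proof -
      define l where "l = nat (j + int i + int N)"
      have l: "int l - int N = j + int i" "l < n'"
        using that i by (auto simp: l_def n'_def)
      show ?thesis
        using coord[OF l(2)] unfolding l(1) by (simp add: act_def case_prod_unfold)
    qed
    ultimately show ?thesis
      using close by blast
  qed
  have "covered Z act n \<epsilon> (K * real (card Bn ^ (n' div g + 1)))"
  proof (rule covered_code[of code])
    show "finite (code ` Z)"
      using sub finT by (rule finite_subset)
  qed (fact card, fact same)
  then show ?thesis
    by (simp only: Bn_def n'_def)
qed

lemma covered_Z:
  assumes cov: "\<And>\<delta> h'. \<delta> > 0 \<Longrightarrow> h' > h \<Longrightarrow> eventually (\<lambda>n. covered Y time_map n \<delta> (exp (h' * real n))) sequentially"
    and "\<epsilon> > 0" "h' > h"
  shows "eventually (\<lambda>n. covered Z act n \<epsilon> (exp (h' * real n))) sequentially"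
proof -
  define e where "e = (h' - h) / 3"
  have e: "e > 0" "h' = h + 3 * e"
    using assms(3) by (auto simp: e_def field_simps)
  obtain N :: nat and d where d: "d > 0"
    and close: "\<forall>z z' :: 'a \<times> (int \<Rightarrow> real).
      dist (fst z) (fst z') \<le> d \<longrightarrow> (\<forall>i. \<bar>i\<bar> \<le> int N \<longrightarrow> dist (snd z i) (snd z' i) \<le> d) \<longrightarrow> dist z z' \<le> \<epsilon>"
    by (rule dist_pair_fun_close[OF assms(2)])
  define M where "M = card {\<lfloor>-1 / d\<rfloor>..\<lfloor>1 / d\<rfloor>}"
  have "\<lfloor>-1 / d\<rfloor> \<le> \<lfloor>1 / d\<rfloor>"
    using d by (intro floor_mono) (simp add: field_simps)
  then have M: "M > 0"
    by (simp add: M_def)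
  \<comment> \<open>The gap between near visits is chosen so long that the recorded values add at
    most the rate \<open>e\<close>.\<close>
  obtain g0 :: nat where "ln (real M) / e < real g0"
    using reals_Archimedean2 by blast
  define g where "g = Suc g0"
  have "ln (real M) \<le> e * real g0"
    using \<open>ln (real M) / e < real g0\<close> e(1) by (simp add: field_simps)
  then have g: "g > 0" "ln (real M) \<le> e * real g"
    using e(1) by (auto simp: g_def algebra_simps)
  obtain \<eta> where \<eta>: "\<eta> > 0"
    and gap: "\<forall>y\<in>Y. dist y y0 < 2 * \<eta> \<longrightarrow> (\<forall>i::nat. 1 \<le> i \<and> i \<le> g \<longrightarrow> 2 * \<eta> \<le> dist (\<phi> (real i) y) y0)"
    using return_gap by blast
  define K where "K = Y \<inter> {x. \<eta> \<le> dist x y0}"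
  have "closed {x. \<eta> \<le> dist x y0}"
    by (intro closed_Collect_le continuous_intros)
  then have "compact K"
    unfolding K_def by (rule compact_Int_closed[OF compact_Y])
  moreover have "continuous_on K osc"
    by (rule continuous_on_subset[OF continuous_on_osc]) (use \<eta> in \<open>auto simp: K_def\<close>)
  ultimately have "uniformly_continuous_on K osc"
    by (rule compact_uniformly_continuous[rotated])
  then obtain \<delta>1 where \<delta>1: "\<delta>1 > 0" "\<forall>x\<in>K. \<forall>x'\<in>K. dist x' x < \<delta>1 \<longrightarrow> dist (osc x') (osc x) < d"
    using d unfolding uniformly_continuous_on_def by (elim allE[of _ d] impE exE conjE)
  define \<delta> where "\<delta> = min (\<delta>1 / 2) (min d (\<eta> / 2))"
  have \<delta>: "\<delta> > 0" "\<delta> < \<delta>1" "\<delta> \<le> d" "\<delta> < \<eta>"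
    using \<delta>1(1) d \<eta> by (auto simp: \<delta>_def min_less_iff_disj)
  have unif: "dist (osc x) (osc x') \<le> d"
    if "x \<in> Y" "x' \<in> Y" "\<eta> \<le> dist x y0" "\<eta> \<le> dist x' y0" "dist x x' \<le> \<delta>" for x x'
  proof -
    have "x \<in> K" "x' \<in> K" "dist x x' < \<delta>1"
      using that \<delta>(2) by (auto simp: K_def)
    then show ?thesis
      using \<delta>1(2)[rule_format, of x' x] by simp
  qed
  have "eventually (\<lambda>n. covered Y time_map n \<delta> (exp ((h + e) * real n))) sequentially"
    using cov \<delta>(1) e(1) by simp
  then have "eventually (\<lambda>n. covered Y time_map (n + (2 * N + 1)) \<delta> (exp ((h + e) * real (n + (2 * N + 1))))) sequentially"
    by (rule sequentially_offset)
  moreover have "eventually (\<lambda>n. exp ((h + e) * real (n + (2 * N + 1))) * real (M ^ ((n + (2 * N + 1)) div g + 1))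
      \<le> exp ((h + 3 * e) * real n)) sequentially"
    by (rule exp_growth_absorb[OF e(1) M g])
  ultimately show ?thesis
  proof eventually_elim
    case (elim n)
    have "covered Z act n \<epsilon> (exp ((h + e) * real (n + (2 * N + 1))) * real (M ^ ((n + (2 * N + 1)) div g + 1)))"
      unfolding M_def using close d g(1) gap unif \<delta>(3,4) \<eta> elim(1) by (rule covered_lift)
    then show ?case
      using elim(2) unfolding covered_def e(2) by (meson order_trans)
  qed
qed

text \<open>The projection to \<open>Y\<close> does not increase distances, so lifts of separated
  points stay separated.\<close>

lemma separated_Z:
  assumes "finite F" "separated Y time_map n \<epsilon> F"
  shows "\<exists>G. finite G \<and> card G = card F \<and> separated Z act n \<epsilon> G"
proof (intro exI conjI)
  let ?w = "\<lambda>y. (y, osc_seq y)"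
  show "finite (?w ` F)"
    using assms(1) by simp
  show "card (?w ` F) = card F"
    by (rule card_image) (auto simp: inj_on_def)
  have F: "F \<subseteq> Y"
    using assms(2) by (simp add: separated_def)
  show "separated Z act n \<epsilon> (?w ` F)"
    unfolding separated_def
  proof (intro conjI ballI impI)
    show "?w ` F \<subseteq> Z"
      using F osc_seq_in_Z by blast
    fix z z' assume "z \<in> ?w ` F" "z' \<in> ?w ` F" "z \<noteq> z'"
    then obtain y y' where y: "y \<in> F" "y' \<in> F" "y \<noteq> y'" "z = ?w y" "z' = ?w y'"
      by blast
    then obtain i where i: "i < n" "dist (time_map (int i) y) (time_map (int i) y') > \<epsilon>"
      using assms(2) unfolding separated_def by blast
    have "dist (fst (act (int i) z)) (fst (act (int i) z')) \<le> dist (act (int i) z) (act (int i) z')"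
      by (rule dist_fst_le)
    then show "\<exists>i<n. dist (act (int i) z) (act (int i) z') > \<epsilon>"
      using i y by (intro exI[of _ i]) (auto simp: act_def time_map_def)
  qed
qed

theorem slovak_of_flow:
  assumes e: "inj_on e Z"
  shows "slovak_space (image_metric e Z)"
    and "(\<And>\<delta> h'. \<delta> > 0 \<Longrightarrow> h' > h \<Longrightarrow> eventually (\<lambda>n. covered Y time_map n \<delta> (exp (h' * real n))) sequentially)
      \<Longrightarrow> slovak_entropy (image_metric e Z) \<le> ereal h"
    and "\<epsilon> > 0 \<Longrightarrow> frequently (\<lambda>n. \<exists>F. finite F \<and> separated Y time_map n \<epsilon> F \<and> exp (h * real n) \<le> real (card F)) sequentially
      \<Longrightarrow> ereal h \<le> slovak_entropy (image_metric e Z)"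
proof -
  have rigid: "\<exists>k. \<forall>x\<in>Z. f x = act k x"
    if "continuous_on Z f" "continuous_on Z g" "f ` Z \<subseteq> Z" "g ` Z \<subseteq> Z"
      "\<And>x. x \<in> Z \<Longrightarrow> g (f x) = x" "\<And>x. x \<in> Z \<Longrightarrow> f (g x) = x" for f g
    using homeo_is_act[OF that(1,3,2,4,5,6)] .
  note S = slovak_space_X[OF e act_free act_dense rigid]
  show "slovak_space (image_metric e Z)"
    by (rule S(1))
  show "slovak_entropy (image_metric e Z) \<le> ereal h"
    if "\<And>\<delta> h'. \<delta> > 0 \<Longrightarrow> h' > h \<Longrightarrow> eventually (\<lambda>n. covered Y time_map n \<delta> (exp (h' * real n))) sequentially"
    by (rule ord_eq_le_trans[OF S(2) entropy_le[OF e covered_Z[OF that]]])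
  show "ereal h \<le> slovak_entropy (image_metric e Z)"
    if "\<epsilon> > 0" "frequently (\<lambda>n. \<exists>F. finite F \<and> separated Y time_map n \<epsilon> F \<and> exp (h * real n) \<le> real (card F)) sequentially"
  proof (rule ord_le_eq_trans[OF entropy_ge[OF e that(1)] S(2)[symmetric]])
    show "frequently (\<lambda>n. \<exists>F. finite F \<and> separated Z act n \<epsilon> F \<and> exp (h * real n) \<le> real (card F)) sequentially"
      using that(2) by (rule frequently_mono[rotated]) (metis separated_Z)
  qed
qed

end

section \<open>Suspensions\<close>

text \<open>A bump of height \<open>c i\<close> over each cell from \<open>i\<close> to
  \<open>i + 1\<close>. It vanishes at the integers, which keeps it continuous in \<open>t\<close>
  although the symbol jumps there.\<close>

definition sig :: "(int \<Rightarrow> real) \<Rightarrow> real \<Rightarrow> real" where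
  "sig c t = \<bar>sin (pi * t)\<bar> * c \<lfloor>t\<rfloor>"

text \<open>As \<open>sig c\<close> vanishes at the integers, the samples are taken at distance \<open>1/2\<close>; one of any two
  consecutive samples then sees the symbol of \<open>c\<close>.\<close>

definition susp :: "(int \<Rightarrow> real) \<Rightarrow> real \<Rightarrow> complex \<times> (int \<Rightarrow> real)" where
  "susp c t = (cis (2 * pi * t), \<lambda>n. sig c (t + of_int n / 2))"

lemma abs_sin_pi_add_int: "\<bar>sin (pi * (x + of_int k))\<bar> = \<bar>sin (pi * x)\<bar>"
proof -
  have "sin (of_int k * pi) = 0"
    using sin_zero_iff_int2 by blast
  then have s: "sin (pi * of_int k) = 0"
    by (simp add: mult.commute)
  then have "(cos (pi * of_int k))\<^sup>2 = 1"
    using sin_cos_squared_add[of "pi * of_int k"] by simp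
  then have "\<bar>cos (pi * of_int k)\<bar> = 1"
    by (simp add: power2_eq_1_iff)
  then show ?thesis
    using s by (simp add: distrib_left sin_add abs_mult)
qed

lemma sig_add_int: "sig c (t + of_int j) = sig (shift j c) t"
  by (simp add: sig_def abs_sin_pi_add_int)

lemma cis_add_int: "cis (2 * pi * (t + of_int j)) = cis (2 * pi * t)"
  by (simp add: distrib_left flip: cis_mult)

text \<open>This is the identification that defines a suspension, time against shift. Here it is a
  consequence of the embedding into a function space, so no quotient has to be formed.\<close>

lemma susp_add_int: "susp c (t + of_int j) = susp (shift j c) t"
proof -
  have "sig c (t + of_int j + of_int n / 2) = sig (shift j c) (t + of_int n / 2)" for n
    using sig_add_int[of c "t + of_int n / 2" j] by (simp add: algebra_simps)
  then show ?thesis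
    unfolding susp_def cis_add_int by simp
qed

lemma susp_frac: "susp c t = susp (shift \<lfloor>t\<rfloor> c) (frac t)"
  using susp_add_int[of c "frac t" "\<lfloor>t\<rfloor>"] by (simp add: frac_def)

lemma susp_inj:
  assumes "susp c t = susp c' t"
  shows "c = c'"
proof
  fix i
  define x where "x = of_int i + frac t"
  \<comment> \<open>For an integer \<open>t\<close> the signal vanishes at the even samples, so the
    sample in the middle of cell \<open>i\<close> is used.\<close>
  define m where "m = 2 * (i - \<lfloor>t\<rfloor>) + (if frac t = 0 then 1 else 0)"
  define y where "y = t + of_int m / 2"
  have y: "y = of_int i + (if frac t = 0 then 1/2 else frac t)"
    by (simp add: y_def m_def frac_def field_simps)
  have fl: "\<lfloor>y\<rfloor> = i"
    unfolding y using frac_ge_0[of t] frac_lt_1[of t] by (intro floor_unique) auto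
  have "sin (pi * y) \<noteq> 0"
  proof
    assume "sin (pi * y) = 0"
    then obtain j :: int where "pi * y = of_int j * pi"
      using sin_zero_iff_int2 by blast
    then have "y = of_int j"
      by simp
    then have "y = of_int i"
      using fl by simp
    then show False
      using y by (auto split: if_splits)
  qed
  moreover have "sig c y = sig c' y"
    using fun_cong[OF arg_cong[OF assms, of snd], of m] by (simp add: susp_def y_def)
  ultimately show "c i = c' i"
    by (simp add: sig_def fl)
qed

lemma cis_2pi_eq:
  assumes "cis (2 * pi * s) = cis (2 * pi * t)"
  obtains j :: int where "s = t + of_int j"
proof -
  have "exp (\<i> * of_real (2 * pi * s)) = exp (\<i> * of_real (2 * pi * t))"
    using assms by (simp add: cis_conv_exp)
  then obtain j :: int where j: "\<i> * of_real (2 * pi * s) = \<i> * of_real (2 * pi * t) + (of_int (2 * j) * pi) * \<i>"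
    unfolding exp_eq by blast
  have "Im (\<i> * of_real (2 * pi * s)) = Im (\<i> * of_real (2 * pi * t) + (of_int (2 * j) * pi) * \<i>)"
    unfolding j by (rule refl)
  then have "2 * pi * s = 2 * pi * t + 2 * of_int j * pi"
    by simp
  then have "2 * pi * s = 2 * pi * (t + of_int j)"
    by (simp add: algebra_simps)
  then have "s = t + of_int j"
    by (simp only: mult_cancel_left) simp
  then show ?thesis
    by (rule that)
qed

lemma susp_eqD:
  assumes "susp c t = susp c' t'"
  obtains j :: int where "t = t' + of_int j" "c' = shift j c"
proof -
  have "cis (2 * pi * t) = cis (2 * pi * t')"
    using arg_cong[OF assms, of fst] by (simp add: susp_def)
  then obtain j :: int where j: "t = t' + of_int j"
    by (rule cis_2pi_eq)
  have "susp (shift j c) t' = susp c' t'"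
    using assms unfolding j susp_add_int .
  then have "shift j c = c'"
    by (rule susp_inj)
  then show ?thesis
    using that[OF j] by simp
qed

text \<open>For bounded \<open>t\<close> the signal is a finite sum of coordinates times fixed
  continuous bumps, one for each cell, which removes the discontinuous floor. The open strips of
  bounded \<open>t\<close> cover the whole space.\<close>

lemma continuous_on_sig: "continuous_on UNIV (\<lambda>z. sig (fst z) (snd z))"
proof -
  define bump where "bump u = sin (pi * min 1 (max 0 u))" for u :: real
  have bump: "continuous_on UNIV bump"
    unfolding bump_def by (intro continuous_intros)
  have bump_eq: "bump (t - of_int i) = (if i = \<lfloor>t\<rfloor> then \<bar>sin (pi * t)\<bar> else 0)" for t i
  proof -
    consider "i < \<lfloor>t\<rfloor>" | "i = \<lfloor>t\<rfloor>" | "\<lfloor>t\<rfloor> < i"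
      by linarith
    then show ?thesis
    proof cases
      case 1
      then have "1 \<le> t - of_int i"
        by linarith
      then show ?thesis
        using 1 by (simp add: bump_def)
    next
      case 2
      have "\<bar>sin (pi * t)\<bar> = \<bar>sin (pi * frac t)\<bar>"
        using abs_sin_pi_add_int[of "frac t" "\<lfloor>t\<rfloor>"] by (simp add: frac_def)
      also have "\<dots> = sin (pi * frac t)"
        using frac_ge_0[of t] frac_lt_1[of t] by (intro abs_of_nonneg sin_ge_zero) auto
      finally show ?thesis
        using 2 frac_ge_0[of t] frac_lt_1[of t] by (simp add: bump_def frac_def)
    next
      case 3
      then have "t - of_int i \<le> 0"
        by linarith
      then show ?thesis
        using 3 by (simp add: bump_def)
    qed
  qed
  have "continuous_on (UNIV \<times> {- real R<..<real R}) (\<lambda>z. sig (fst z) (snd z))" for R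
  proof -
    let ?I = "{- int R - 1..int R}"
    have coord: "continuous_on (UNIV \<times> {- real R<..<real R}) (\<lambda>z :: (int \<Rightarrow> real) \<times> real. fst z i)" for i
      by (rule continuous_on_product_then_coordinatewise[OF continuous_on_fst[OF continuous_on_id]])
    have "continuous_on (UNIV \<times> {- real R<..<real R})
        (\<lambda>z :: (int \<Rightarrow> real) \<times> real. \<Sum>i\<in>?I. fst z i * bump (snd z - of_int i))"
      by (intro continuous_on_sum continuous_on_mult coord continuous_on_compose2[OF bump] continuous_on_diff
          continuous_on_snd continuous_on_id continuous_on_const) auto
    moreover have "(\<Sum>i\<in>?I. fst z i * bump (snd z - of_int i)) = sig (fst z) (snd z)"
      if "z \<in> UNIV \<times> {- real R<..<real R}" for z :: "(int \<Rightarrow> real) \<times> real"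
    proof -
      have "snd z > - real R" "snd z < real R"
        using that by auto
      then have "\<lfloor>snd z\<rfloor> \<in> ?I"
        by (auto simp: le_floor_iff floor_le_iff)
      moreover have "(\<Sum>i\<in>?I. fst z i * bump (snd z - of_int i)) =
          (\<Sum>i\<in>?I. if i = \<lfloor>snd z\<rfloor> then \<bar>sin (pi * snd z)\<bar> * fst z i else 0)"
        unfolding bump_eq by (intro sum.cong) auto
      ultimately show ?thesis
        by (simp add: sig_def)
    qed
    ultimately show ?thesis
      by (rule continuous_on_eq)
  qed
  then have "continuous_on (\<Union>R\<in>(UNIV::nat set). UNIV \<times> {- real R<..<real R}) (\<lambda>z. sig (fst z) (snd z))"
    by (intro continuous_on_open_UN open_Times) auto
  moreover have "(\<Union>R\<in>(UNIV::nat set). UNIV \<times> {- real R<..<real R}) = (UNIV :: ((int \<Rightarrow> real) \<times> real) set)"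
  proof -
    have "z \<in> (\<Union>R\<in>(UNIV::nat set). UNIV \<times> {- real R<..<real R})" for z :: "(int \<Rightarrow> real) \<times> real"
    proof -
      obtain R :: nat where "\<bar>snd z\<bar> < real R"
        using reals_Archimedean2 by blast
      then have "z \<in> UNIV \<times> {- real R<..<real R}"
        by (cases z) auto
      then show ?thesis by blast
    qed
    then show ?thesis by blast
  qed
  ultimately show ?thesis by simp
qed

lemma continuous_on_susp:
  assumes "continuous_on S c" "continuous_on S t"
  shows "continuous_on S (\<lambda>x. susp (c x) (t x))"
proof -
  have "continuous_on S (\<lambda>x. sig (c x) (t x + of_int n / 2))" for n
    using continuous_on_compose2[OF continuous_on_sig, of S "\<lambda>x. (c x, t x + of_int n / 2)"] assms
    by (simp add: continuous_on_Pair continuous_on_add continuous_on_const)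
  moreover have "continuous_on S (\<lambda>x. cis (2 * pi * t x))"
    by (intro continuous_intros assms)
  ultimately show ?thesis
    unfolding susp_def by (intro continuous_on_Pair continuous_on_coordinatewise_then_product)
qed

text \<open>A continuous image of a compact set carries the quotient topology, because preimages of
  closed sets are images of compact sets. It allows continuity of the flow to be checked on
  representatives.\<close>

lemma continuous_on_quotient:
  fixes Q :: "'a::metric_space \<Rightarrow> 'b::metric_space" and F :: "'b \<Rightarrow> 'c::topological_space"
  assumes K: "compact K" and Q: "continuous_on K Q" and FQ: "continuous_on K (\<lambda>x. F (Q x))"
  shows "continuous_on (Q ` K) F"
proof -
  have cl: "closed (Q ` K)"
    using compact_imp_closed compact_continuous_image[OF Q K] by blast
  have "closed (F -` B \<inter> Q ` K)" if "closed B" for B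
  proof -
    have "closed ((\<lambda>x. F (Q x)) -` B \<inter> K)"
      using FQ that continuous_on_closed_vimage[OF compact_imp_closed[OF K]] by blast
    then have "compact (K \<inter> ((\<lambda>x. F (Q x)) -` B \<inter> K))"
      by (rule compact_Int_closed[OF K])
    then have "compact (Q ` (K \<inter> ((\<lambda>x. F (Q x)) -` B \<inter> K)))"
      by (intro compact_continuous_image continuous_on_subset[OF Q]) auto
    moreover have "Q ` (K \<inter> ((\<lambda>x. F (Q x)) -` B \<inter> K)) = F -` B \<inter> Q ` K"
      by auto
    ultimately show ?thesis
      using compact_imp_closed by simp
  qed
  then show ?thesis
    unfolding continuous_on_closed_vimage[OF cl] by blast
qed

section \<open>Lipschitz estimates for phase and signal\<close>

lemma abs_sin_pi_lipschitz: "\<bar>sin (pi * s) - sin (pi * t)\<bar> \<le> pi * \<bar>s - t\<bar>"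
proof -
  have "sin (pi * s) - sin (pi * t) = 2 * sin ((pi * s - pi * t) / 2) * cos ((pi * s + pi * t) / 2)"
    by (rule sin_diff_sin)
  then have "\<bar>sin (pi * s) - sin (pi * t)\<bar> = 2 * \<bar>sin ((pi * s - pi * t) / 2)\<bar> * \<bar>cos ((pi * s + pi * t) / 2)\<bar>"
    by (simp add: abs_mult)
  also have "\<dots> \<le> 2 * \<bar>sin ((pi * s - pi * t) / 2)\<bar> * 1"
    by (intro mult_left_mono) auto
  also have "\<dots> \<le> 2 * \<bar>(pi * s - pi * t) / 2\<bar>"
    using abs_sin_x_le_abs_x[of "(pi * s - pi * t) / 2"] by simp
  also have "\<dots> = pi * \<bar>s - t\<bar>"
    by (simp add: abs_mult flip: right_diff_distrib)
  finally show ?thesis .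
qed

lemma cis_lipschitz: "dist (cis (2 * pi * s)) (cis (2 * pi * t)) \<le> 4 * pi * \<bar>s - t\<bar>"
proof -
  have "\<bar>sin (2 * pi * s) - sin (2 * pi * t)\<bar> \<le> 2 * pi * \<bar>s - t\<bar>"
    using abs_sin_pi_lipschitz[of "2 * s" "2 * t"] by (simp add: algebra_simps abs_if split: if_splits)
  moreover have "\<bar>cos (2 * pi * s) - cos (2 * pi * t)\<bar> \<le> 2 * pi * \<bar>s - t\<bar>"
  proof -
    have c: "cos (2 * pi * x) = sin (pi * (1 / 2 - 2 * x))" for x
      by (simp add: cos_sin_eq algebra_simps)
    show ?thesis
      using abs_sin_pi_lipschitz[of "1/2 - 2 * s" "1/2 - 2 * t"] unfolding c
      by (simp add: algebra_simps abs_if split: if_splits)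
  qed
  moreover have "dist (cis (2 * pi * s)) (cis (2 * pi * t)) \<le>
      \<bar>cos (2 * pi * s) - cos (2 * pi * t)\<bar> + \<bar>sin (2 * pi * s) - sin (2 * pi * t)\<bar>"
    using cmod_le[of "cis (2 * pi * s) - cis (2 * pi * t)"] by (simp add: dist_norm)
  ultimately show ?thesis by linarith
qed

lemma sig_lipschitz:
  assumes "\<And>i. c i \<in> {0..1}"
  shows "\<bar>sig c s - sig c t\<bar> \<le> pi * \<bar>s - t\<bar>"
proof -
  have *: "\<bar>sig c s - sig c t\<bar> \<le> pi * (t - s)" if "s \<le> t" for s t
  proof (cases "\<lfloor>s\<rfloor> = \<lfloor>t\<rfloor>")
    case True
    have "\<bar>sig c s - sig c t\<bar> = \<bar>\<bar>sin (pi * s)\<bar> - \<bar>sin (pi * t)\<bar>\<bar> * \<bar>c \<lfloor>t\<rfloor>\<bar>"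
      unfolding sig_def True by (simp add: abs_mult flip: left_diff_distrib)
    also have "\<dots> \<le> \<bar>\<bar>sin (pi * s)\<bar> - \<bar>sin (pi * t)\<bar>\<bar> * 1"
      using assms[of "\<lfloor>t\<rfloor>"] by (intro mult_left_mono) auto
    also have "\<dots> \<le> \<bar>sin (pi * s) - sin (pi * t)\<bar>"
      using abs_triangle_ineq3[of "sin (pi * s)" "sin (pi * t)"] by (simp only: mult_1_right)
    also have "\<dots> \<le> pi * (t - s)"
      using abs_sin_pi_lipschitz[of s t] that by simp
    finally show ?thesis .
  next
    case False
    \<comment> \<open>The integer \<open>k\<close> lies between \<open>s\<close> and
      \<open>t\<close>; the signal vanishes there, so each of its two values is bounded by the
      distance to \<open>k\<close>.\<close>
    define k where "k = \<lfloor>t\<rfloor>"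
    have k: "s \<le> of_int k" "of_int k \<le> t"
      using False that by (auto simp: k_def) linarith
    have le: "0 \<le> sig c x \<and> sig c x \<le> pi * \<bar>x - of_int k\<bar>" for x
    proof -
      have "\<bar>sin (pi * x)\<bar> = \<bar>sin (pi * (x - of_int k))\<bar>"
        using abs_sin_pi_add_int[of "x - of_int k" k] by simp
      also have "\<dots> \<le> pi * \<bar>x - of_int k\<bar>"
        using abs_sin_x_le_abs_x[of "pi * (x - of_int k)"] by (simp add: abs_mult)
      finally have "\<bar>sin (pi * x)\<bar> * c \<lfloor>x\<rfloor> \<le> pi * \<bar>x - of_int k\<bar> * 1"
        using assms[of "\<lfloor>x\<rfloor>"] by (intro mult_mono) auto
      then show ?thesis
        using assms[of "\<lfloor>x\<rfloor>"] by (simp add: sig_def)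
    qed
    have "sig c s \<le> pi * (of_int k - s)" "sig c t \<le> pi * (t - of_int k)"
      using le[of s] le[of t] k by simp_all
    moreover have "0 \<le> sig c s" "0 \<le> sig c t" "pi * (of_int k - s) \<ge> 0" "pi * (t - of_int k) \<ge> 0"
      using le k by simp_all
    ultimately show ?thesis
      by (simp add: algebra_simps abs_if)
  qed
  show ?thesis
    using *[of s t] *[of t s] by (cases "s \<le> t") (simp_all add: abs_minus_commute)
qed

lemma dist_susp_coord:
  assumes c: "\<And>i. c i \<in> {0..1}" and st: "pi * \<bar>s - t\<bar> \<le> d / 2" and cc: "\<bar>c \<lfloor>t\<rfloor> - c' \<lfloor>t\<rfloor>\<bar> \<le> d / 2"
  shows "dist (sig c s) (sig c' t) \<le> d"
proof -
  have "\<bar>sig c t - sig c' t\<bar> = \<bar>sin (pi * t)\<bar> * \<bar>c \<lfloor>t\<rfloor> - c' \<lfloor>t\<rfloor>\<bar>"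
    by (simp add: sig_def abs_mult flip: right_diff_distrib)
  also have "\<dots> \<le> 1 * \<bar>c \<lfloor>t\<rfloor> - c' \<lfloor>t\<rfloor>\<bar>"
    by (intro mult_right_mono) auto
  also have "\<dots> \<le> d / 2"
    using cc by (simp only: mult_1_left)
  finally have "\<bar>sig c t - sig c' t\<bar> \<le> d / 2" .
  moreover have "\<bar>sig c s - sig c t\<bar> \<le> d / 2"
    using sig_lipschitz[of c s t, OF c] st by (rule order_trans)
  ultimately show ?thesis
    unfolding dist_real_def by linarith
qed

text \<open>Irrationality gives minimality of the time-one map. A speed below \<open>1/2\<close>
  makes the integer times hit the middle half of every cell that an orbit passes, where the bump is
  high enough to read the symbol.\<close>

definition speed :: real where "speed = sqrt 2 / 4"

lemma speed_bounds: "0 < speed" "speed < 1/2"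
proof -
  have "sqrt 2 < sqrt 4"
    by (rule real_sqrt_less_mono) simp
  then show "0 < speed" "speed < 1/2"
    by (auto simp: speed_def)
qed

lemma speed_irrational: "speed \<notin> \<rat>"
proof
  assume "speed \<in> \<rat>"
  then have "speed * 4 \<in> \<rat>"
    by (intro Rats_mult) auto
  then have "sqrt 2 \<in> \<rat>"
    by (simp add: speed_def)
  then obtain a b :: nat where b: "b \<noteq> 0" and ab: "sqrt 2 = real a / real b" and cop: "coprime a b"
    by (rule Rats_abs_nat_div_natE) auto
  then have "real a = sqrt 2 * real b"
    by simp
  then have "(real a)\<^sup>2 = 2 * (real b)\<^sup>2"
    by (simp add: power_mult_distrib)
  then have eq: "a\<^sup>2 = 2 * b\<^sup>2"
    by (metis of_nat_eq_iff of_nat_mult of_nat_numeral of_nat_power)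
  then have "even (a\<^sup>2)"
    by simp
  then have "even a"
    by simp
  then obtain m where "a = 2 * m" by (rule evenE)
  then have "b\<^sup>2 = 2 * m\<^sup>2"
    using eq by (simp add: power2_eq_square)
  then have "even (b\<^sup>2)"
    by simp
  then have "even b"
    by simp
  then show False
    using cop \<open>even a\<close> coprime_common_divisor_nat by fastforce
qed

context block_words
begin

section \<open>The suspension flow of the subshift\<close>

definition Y :: "(complex \<times> (int \<Rightarrow> real)) set" where
  "Y = (\<lambda>z. susp (fst z) (snd z)) ` (C \<times> UNIV)"

text \<open>The representative is chosen arbitrarily; \<open>flow_susp\<close> shows that the choice
  does not matter.\<close>

definition flow :: "real \<Rightarrow> complex \<times> (int \<Rightarrow> real) \<Rightarrow> complex \<times> (int \<Rightarrow> real)" where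
  "flow s y = (let z = SOME z. fst z \<in> C \<and> y = susp (fst z) (snd z) in susp (fst z) (snd z + speed * s))"

lemma susp_in_Y: "c \<in> C \<Longrightarrow> susp c t \<in> Y"
  unfolding Y_def by force

lemma C_unit: "c \<in> C \<Longrightarrow> c i \<in> {0..1}"
  using C_values A_sub by blast

lemma Y_rep:
  assumes "y \<in> Y"
  obtains c t where "c \<in> C" "0 \<le> t" "t < 1" "y = susp c t"
proof -
  obtain c t where ct: "c \<in> C" "y = susp c t"
    using assms unfolding Y_def by force
  then have "y = susp (shift \<lfloor>t\<rfloor> c) (frac t)"
    using susp_frac by metis
  then show ?thesis
    using that[of "shift \<lfloor>t\<rfloor> c" "frac t"] shift_C[OF ct(1)] frac_ge_0 frac_lt_1 by blast
qed

lemma flow_susp: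
  assumes "c \<in> C"
  shows "flow s (susp c t) = susp c (t + speed * s)"
proof -
  define z where "z = (SOME z. fst z \<in> C \<and> susp c t = susp (fst z) (snd z))"
  have "\<exists>z. fst z \<in> C \<and> susp c t = susp (fst z) (snd z)"
    using assms by (intro exI[of _ "(c, t)"]) simp
  then have z: "fst z \<in> C \<and> susp c t = susp (fst z) (snd z)"
    unfolding z_def by (rule someI_ex)
  then obtain j :: int where j: "t = snd z + of_int j" "fst z = shift j c"
    using susp_eqD by blast
  have "flow s (susp c t) = susp (fst z) (snd z + speed * s)"
    by (simp add: flow_def z_def Let_def)
  also have "\<dots> = susp c (snd z + speed * s + of_int j)"
    unfolding susp_add_int j(2) ..
  also have "\<dots> = susp c (t + speed * s)"
    by (simp add: j(1) algebra_simps)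
  finally show ?thesis .
qed

lemma Y_eq_image: "Y = (\<lambda>z. susp (fst z) (snd z)) ` (C \<times> {0..1})"
proof
  show "Y \<subseteq> (\<lambda>z. susp (fst z) (snd z)) ` (C \<times> {0..1})"
  proof
    fix y assume "y \<in> Y"
    then obtain c t where "c \<in> C" "0 \<le> t" "t < 1" "y = susp c t"
      by (rule Y_rep)
    then show "y \<in> (\<lambda>z. susp (fst z) (snd z)) ` (C \<times> {0..1})"
      by (intro image_eqI[of _ _ "(c, t)"]) auto
  qed
qed (auto simp: Y_def)

lemma compact_Y: "compact Y"
  unfolding Y_eq_image
  by (intro compact_continuous_image continuous_on_susp continuous_intros compact_Times compact_C) auto

text \<open>The quotient argument needs compactness, so time is first confined to a bounded
  interval; the times of a convergent sequence are bounded.\<close>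

lemma continuous_on_flow: "continuous_on (UNIV \<times> Y) (\<lambda>(s, y). flow s y)"
proof -
  have bdd: "continuous_on ({-R..R} \<times> Y) (\<lambda>(s, y). flow s y)" for R :: real
  proof -
    define Q where "Q z = (fst z, susp (fst (snd z)) (snd (snd z)))" for z :: "real \<times> (int \<Rightarrow> real) \<times> real"
    let ?K = "{-R..R} \<times> C \<times> {0..1::real}"
    have "compact ?K"
      by (intro compact_Times compact_C compact_Icc)
    moreover have "continuous_on ?K Q"
      unfolding Q_def by (intro continuous_on_Pair continuous_on_susp continuous_intros)
    moreover have "continuous_on ?K (\<lambda>z. (\<lambda>(s, y). flow s y) (Q z))"
    proof (rule continuous_on_eq)
      show "continuous_on ?K (\<lambda>z. susp (fst (snd z)) (snd (snd z) + speed * fst z))"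
        by (intro continuous_on_susp continuous_intros)
      show "susp (fst (snd z)) (snd (snd z) + speed * fst z) = (\<lambda>(s, y). flow s y) (Q z)" if "z \<in> ?K" for z
        using that by (auto simp: Q_def flow_susp)
    qed
    ultimately have "continuous_on (Q ` ?K) (\<lambda>(s, y). flow s y)"
      by (rule continuous_on_quotient)
    moreover have "Q ` ?K = {-R..R} \<times> Y"
    proof
      show "Q ` ?K \<subseteq> {-R..R} \<times> Y"
        using susp_in_Y by (auto simp: Q_def)
      show "{-R..R} \<times> Y \<subseteq> Q ` ?K"
      proof
        fix x assume "x \<in> {-R..R} \<times> Y"
        then obtain s z where "x = (s, susp (fst z) (snd z))" "s \<in> {-R..R}" "z \<in> C \<times> {0..1}"
          unfolding Y_eq_image by blast
        then show "x \<in> Q ` ?K"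
          by (intro image_eqI[of _ _ "(s, z)"]) (auto simp: Q_def)
      qed
    qed
    ultimately show ?thesis by simp
  qed
  show ?thesis
    unfolding continuous_on_sequentially
  proof (intro allI ballI impI)
    fix x :: "nat \<Rightarrow> real \<times> complex \<times> (int \<Rightarrow> real)" and a
    assume a: "a \<in> UNIV \<times> Y" and x: "(\<forall>n. x n \<in> UNIV \<times> Y) \<and> x \<longlonglongrightarrow> a"
    have "Bseq (\<lambda>n. fst (x n))"
      using x tendsto_fst[of x a sequentially] convergentI convergent_imp_Bseq by blast
    then obtain R0 where R0: "\<forall>n. norm (fst (x n)) \<le> R0"
      unfolding Bseq_def by blast
    define R where "R = max R0 \<bar>fst a\<bar>"
    have mem: "p \<in> {-R..R} \<times> Y" if "\<bar>fst p\<bar> \<le> R" "p \<in> UNIV \<times> Y" for p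
      using that by (cases p) auto
    have xR: "x n \<in> {-R..R} \<times> Y" for n
    proof (rule mem)
      have "\<bar>fst (x n)\<bar> \<le> R0"
        using R0 by simp
      then show "\<bar>fst (x n)\<bar> \<le> R"
        by (simp add: R_def)
    qed (use x in blast)
    have aR: "a \<in> {-R..R} \<times> Y"
      by (rule mem[OF _ a]) (simp add: R_def)
    show "((\<lambda>(s, y). flow s y) \<circ> x) \<longlonglongrightarrow> (\<lambda>(s, y). flow s y) a"
      using bdd[of R, unfolded continuous_on_sequentially] aR xR x by blast
  qed
qed

text \<open>The window of \<open>c'\<close> is seen in \<open>c\<close> at all places
  \<open>a + j * P\<close>. It remains to bring \<open>t + speed * n\<close> close to
  \<open>t' + a\<close> modulo \<open>P\<close>, which is Kronecker's theorem for the irrational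
  number \<open>speed / P\<close>.\<close>

lemma flow_dense:
  assumes y: "y \<in> Y" "y' \<in> Y" and d: "d > 0"
  shows "\<exists>n::nat. dist (flow (real n) y) y' < d"
proof -
  obtain c t where c: "c \<in> C" "y = susp c t"
    using y(1) by (rule Y_rep)
  obtain c' t' where c': "c' \<in> C" "y' = susp c' t'"
    using y(2) by (rule Y_rep)
  have "d / 2 > 0"
    using d by simp
  then obtain N :: nat and e where e: "e > 0"
    and close: "\<forall>z z' :: complex \<times> (int \<Rightarrow> real).
      dist (fst z) (fst z') \<le> e \<longrightarrow> (\<forall>i. \<bar>i\<bar> \<le> int N \<longrightarrow> dist (snd z i) (snd z' i) \<le> e) \<longrightarrow> dist z z' \<le> d / 2"
    by (rule dist_pair_fun_close)
  \<comment> \<open>The samples of \<open>y'\<close> with index up to \<open>N\<close> read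
    \<open>c'\<close> in cells within this distance of \<open>0\<close>.\<close>
  define N1 where "N1 = nat \<lceil>\<bar>t'\<bar>\<rceil> + N + 1"
  have "e / 2 > 0"
    using e by simp
  then obtain P :: nat where P: "P > 0" and
    rec: "\<exists>a. \<forall>j i. \<bar>i\<bar> \<le> int N1 \<longrightarrow> \<bar>c (a + j * int P + i) - c' i\<bar> < e / 2"
    using window_recurs[OF c'(1), of "e / 2" N1] c(1) by metis
  obtain a where a: "\<forall>j i. \<bar>i\<bar> \<le> int N1 \<longrightarrow> \<bar>c (a + j * int P + i) - c' i\<bar> < e / 2"
    using rec by (rule exE)
  define \<eta> where "\<eta> = e / (4 * pi)"
  have \<eta>: "\<eta> > 0"
    using e by (simp add: \<eta>_def)
  have "speed / real P \<notin> \<rat>"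
  proof
    assume "speed / real P \<in> \<rat>"
    then have "speed / real P * real P \<in> \<rat>"
      by (intro Rats_mult) auto
    then show False
      using speed_irrational P by simp
  qed
  moreover have "\<eta> / real P > 0"
    using \<eta> P by simp
  ultimately obtain h k :: int where k: "k > 0"
    "\<bar>of_int k * (speed / real P) - of_int h - (t' + of_int a - t) / real P\<bar> < \<eta> / real P"
    by (rule sequence_of_fractional_parts_is_dense)
  define n where "n = nat k"
  \<comment> \<open>\<open>\<theta>\<close> is the error in time that remains after \<open>h\<close>
    full periods.\<close>
  define \<theta> where "\<theta> = t + speed * real n - (of_int (a + h * int P) + t')"
  have "\<theta> = real P * (of_int k * (speed / real P) - of_int h - (t' + of_int a - t) / real P)"
    using P k(1) by (simp add: \<theta>_def n_def field_simps)
  then have "\<bar>\<theta>\<bar> = real P * \<bar>of_int k * (speed / real P) - of_int h - (t' + of_int a - t) / real P\<bar>"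
    by (simp add: abs_mult)
  also have "\<dots> < real P * (\<eta> / real P)"
    using k(2) P by (intro mult_strict_left_mono) auto
  finally have \<theta>: "\<bar>\<theta>\<bar> < \<eta>"
    using P by simp
  define b where "b = shift (a + h * int P) c"
  have b: "b \<in> C"
    unfolding b_def by (rule shift_C[OF c(1)])
  have "flow (real n) y = susp c (t + speed * real n)"
    unfolding c(2) by (rule flow_susp[OF c(1)])
  also have "t + speed * real n = (t' + \<theta>) + of_int (a + h * int P)"
    by (simp add: \<theta>_def)
  also have "susp c \<dots> = susp b (t' + \<theta>)"
    unfolding b_def by (rule susp_add_int)
  finally have fl: "flow (real n) y = susp b (t' + \<theta>)" .
  have "4 * pi * \<bar>\<theta>\<bar> \<le> e" "pi * \<bar>\<theta>\<bar> \<le> e / 2"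
  proof -
    have "4 * pi * \<bar>\<theta>\<bar> \<le> 4 * pi * \<eta>"
      using \<theta> by (intro mult_left_mono) auto
    then show "4 * pi * \<bar>\<theta>\<bar> \<le> e"
      by (simp add: \<eta>_def)
    then show "pi * \<bar>\<theta>\<bar> \<le> e / 2"
      using e by simp
  qed
  then have "dist (fst (flow (real n) y)) (fst y') \<le> e"
    using cis_lipschitz[of "t' + \<theta>" t'] by (simp add: fl c'(2) susp_def)
  moreover have "dist (snd (flow (real n) y) m) (snd y' m) \<le> e" if m: "\<bar>m\<bar> \<le> int N" for m
  proof -
    define s where "s = t' + of_int m / 2"
    have "\<bar>s\<bar> \<le> \<bar>t'\<bar> + of_int \<bar>m\<bar>"
      by (simp add: s_def abs_if)
    also have "\<dots> \<le> of_int (\<lceil>\<bar>t'\<bar>\<rceil> + int N)"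
      using m le_of_int_ceiling[of "\<bar>t'\<bar>"] by (simp del: le_of_int_ceiling of_int_abs)
    finally have "\<bar>\<lfloor>s\<rfloor>\<bar> \<le> int N1"
      unfolding N1_def by linarith
    then have "\<bar>b \<lfloor>s\<rfloor> - c' \<lfloor>s\<rfloor>\<bar> < e / 2"
      using a by (simp add: b_def add.commute)
    then have "dist (sig b (s + \<theta>)) (sig c' s) \<le> e"
      using \<open>pi * \<bar>\<theta>\<bar> \<le> e / 2\<close> C_unit[OF b] by (intro dist_susp_coord) auto
    then show ?thesis
      by (simp add: fl c'(2) susp_def s_def algebra_simps)
  qed
  ultimately have "dist (flow (real n) y) y' \<le> d / 2"
    using close by blast
  then show ?thesis
    using d by (intro exI[of _ n]) simp
qed

lemma flow_free:
  assumes "y \<in> Y" "flow s y = y"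
  shows "s = 0"
proof -
  obtain c t where c: "c \<in> C" "y = susp c t"
    using assms(1) by (rule Y_rep)
  have "susp c (t + speed * s) = susp c t"
    using assms(2) flow_susp[OF c(1)] by (simp add: c(2))
  then obtain j :: int where j: "t + speed * s = t + of_int j" "c = shift j c"
    by (rule susp_eqD)
  have per: "c (i + j) = c i" for i
    using fun_cong[OF j(2), of i] by simp
  have "j = 0"
  proof (rule ccontr)
    assume "j \<noteq> 0"
    then consider "j > 0" | "- j > 0"
      by linarith
    then show False
    proof cases
      case 1
      then show False
        using not_periodic[OF c(1) per] by blast
    next
      case 2
      have "c (i + - j) = c i" for i
        using per[of "i - j"] by simp
      then show False
        using not_periodic[OF c(1) _ 2] by blast
    qed
  qed
  then show ?thesis
    using j(1) speed_bounds by simp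
qed

lemma flow_add: "y \<in> Y \<Longrightarrow> flow (s + s') y = flow s (flow s' y)"
proof -
  assume "y \<in> Y"
  then obtain c t where "c \<in> C" "y = susp c t"
    by (rule Y_rep)
  then show ?thesis
    by (simp add: flow_susp algebra_simps)
qed

lemma flow_in: "y \<in> Y \<Longrightarrow> flow s y \<in> Y"
proof -
  assume "y \<in> Y"
  then obtain c t where "c \<in> C" "y = susp c t"
    by (rule Y_rep)
  then show ?thesis
    by (simp add: flow_susp susp_in_Y)
qed

lemma flow_0: "y \<in> Y \<Longrightarrow> flow 0 y = y"
proof -
  assume "y \<in> Y"
  then obtain c t where "c \<in> C" "y = susp c t"
    by (rule Y_rep)
  then show ?thesis
    by (simp add: flow_susp)
qed

lemma fst_flow: "y \<in> Y \<Longrightarrow> fst (flow s y) = fst y * cis (2 * pi * (speed * s))"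
proof -
  assume "y \<in> Y"
  then obtain c t where "c \<in> C" "y = susp c t"
    by (rule Y_rep)
  then show ?thesis
    by (simp add: flow_susp) (simp add: susp_def cis_mult algebra_simps)
qed

text \<open>A logarithm on the contractible interval lifts the phase to a continuous angle
  \<open>\<theta>\<close>. Flowing back accordingly leaves a path \<open>d\<close> with constant
  phase; each of its coordinates takes values in a countable set, because \<open>A\<close> is
  countable, and is constant by connectedness.\<close>

lemma flow_paths:
  assumes g: "continuous_on {0..1::real} g" "g ` {0..1} \<subseteq> Y"
  shows "\<exists>\<tau>. continuous_on {0..1} \<tau> \<and> (\<forall>u\<in>{0..1}. g u = flow (\<tau> u) (g 0))"
proof -
  have gY: "g u \<in> Y" if "u \<in> {0..1}" for u
    using g(2) that by blast
  have norm1: "norm (fst (g u)) = 1" if "u \<in> {0..1}" for u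
    using gY[OF that] by (rule Y_rep) (simp add: susp_def)
  have "contractible {0..1::real}"
    by (intro convex_imp_contractible) simp
  moreover have "fst (g u) \<noteq> 0" if "u \<in> {0..1}" for u
    using norm1[OF that] by auto
  ultimately obtain l where l: "continuous_on {0..1} l" and le: "\<And>u. u \<in> {0..1} \<Longrightarrow> fst (g u) = exp (l u)"
    using continuous_logarithm_on_contractible[OF continuous_on_fst[OF g(1)]] by blast
  define \<theta> where "\<theta> u = Im (l u) / (2 * pi)" for u
  have \<theta>: "continuous_on {0..1} \<theta>"
    unfolding \<theta>_def by (intro continuous_intros l) simp
  have fst_g: "fst (g u) = cis (2 * pi * \<theta> u)" if u: "u \<in> {0..1}" for u
  proof -
    have "exp (Re (l u)) = 1"
      using norm1[OF u] le[OF u] by (simp add: norm_exp_eq_Re)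
    then have "fst (g u) = cis (Im (l u))"
      unfolding le[OF u] by (simp add: exp_eq_polar)
    then show ?thesis
      by (simp add: \<theta>_def)
  qed
  define \<tau> where "\<tau> u = (\<theta> u - \<theta> 0) / speed" for u
  have \<tau>: "continuous_on {0..1} \<tau>"
    unfolding \<tau>_def using speed_bounds by (intro continuous_intros \<theta>) auto
  define d where "d u = flow (- \<tau> u) (g u)" for u
  have d_cont: "continuous_on {0..1} d"
  proof -
    have "continuous_on {0..1} (\<lambda>u. (\<lambda>(s, y). flow s y) (- \<tau> u, g u))"
      by (rule continuous_on_compose2[OF continuous_on_flow])
        (use \<tau> g in \<open>auto intro!: continuous_intros\<close>)
    then show ?thesis
      by (simp add: d_def)
  qed
  have dY: "d u \<in> Y" if "u \<in> {0..1}" for u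
    unfolding d_def by (rule flow_in[OF gY[OF that]])
  have fst_d: "fst (d u) = cis (2 * pi * \<theta> 0)" if u: "u \<in> {0..1}" for u
  proof -
    have "speed * - \<tau> u = \<theta> 0 - \<theta> u"
      using speed_bounds by (simp add: \<tau>_def)
    then show ?thesis
      unfolding d_def fst_flow[OF gY[OF u]] fst_g[OF u]
      by (simp add: cis_mult algebra_simps)
  qed
  have countable: "snd (d u) n \<in> (\<lambda>a. \<bar>sin (pi * (\<theta> 0 + of_int n / 2))\<bar> * a) ` A" if u: "u \<in> {0..1}" for u n
  proof -
    obtain c t where c: "c \<in> C" "d u = susp c t"
      using dY[OF u] by (rule Y_rep)
    have "cis (2 * pi * t) = cis (2 * pi * \<theta> 0)"
      using fst_d[OF u] by (simp add: c(2) susp_def)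
    then obtain j :: int where "t = \<theta> 0 + of_int j"
      by (rule cis_2pi_eq)
    then have "d u = susp (shift j c) (\<theta> 0)"
      using c(2) susp_add_int by simp
    then have "snd (d u) n = \<bar>sin (pi * (\<theta> 0 + of_int n / 2))\<bar> * shift j c \<lfloor>\<theta> 0 + of_int n / 2\<rfloor>"
      by (simp add: susp_def sig_def)
    moreover have "shift j c \<lfloor>\<theta> 0 + of_int n / 2\<rfloor> \<in> A"
      by (rule C_values[OF shift_C[OF c(1)]])
    ultimately show ?thesis
      by blast
  qed
  have const: "d u = d 0" if u: "u \<in> {0..1}" for u
  proof (rule prod_eqI)
    show "fst (d u) = fst (d 0)"
      using fst_d u by simp
    show "snd (d u) = snd (d 0)"
    proof
      fix n
      have "continuous_on {0..1} (\<lambda>u. snd (d u) n)"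
        by (rule continuous_on_product_then_coordinatewise[OF continuous_on_snd[OF d_cont]])
      then have conn: "connected ((\<lambda>u. snd (d u) n) ` {0..1})"
        by (rule connected_continuous_image) simp
      have "countable ((\<lambda>u. snd (d u) n) ` {0..1})"
        using countable by (intro countable_subset[OF _ countable_image[OF A_countable]] image_subsetI)
      then have "\<not> (snd (d u) n \<noteq> snd (d 0) n)"
        using connected_uncountable[OF conn, of "snd (d u) n" "snd (d 0) n"] u by auto
      then show "snd (d u) n = snd (d 0) n"
        by simp
    qed
  qed
  have "\<tau> 0 = 0"
    by (simp add: \<tau>_def)
  then have d0: "d 0 = g 0"
    using flow_0[OF gY[of 0]] by (simp add: d_def)
  have "g u = flow (\<tau> u) (g 0)" if u: "u \<in> {0..1}" for u
  proof -
    have "flow (\<tau> u) (d u) = flow (\<tau> u + - \<tau> u) (g u)"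
      unfolding d_def by (rule flow_add[OF gY[OF u], symmetric])
    then show ?thesis
      using const[OF u] d0 flow_0[OF gY[OF u]] by simp
  qed
  then show ?thesis
    using \<tau> by blast
qed

lemma minimal_flow_Y:
  assumes "y0 \<in> Y"
  shows "minimal_flow Y flow y0"
proof
  show "\<And>t y. y \<in> Y \<Longrightarrow> flow t y = y \<Longrightarrow> t = 0"
    by (rule flow_free)
qed (fact compact_Y assms flow_in flow_0 flow_add continuous_on_flow flow_dense flow_paths)+

end

section \<open>Entropy of the suspension\<close>

lemma dist_fun_ge: "(1/2) ^ n * min (dist (x (from_nat n)) (y (from_nat n))) 1 \<le> dist x y"
  for x y :: "'i::countable \<Rightarrow> 'a::metric_space"
proof -
  let ?f = "\<lambda>n. (1/2) ^ n * min (dist (x (from_nat n)) (y (from_nat n))) 1 :: real"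
  have "summable ?f"
    by (rule summable_comparison_test'[of "\<lambda>n. (1/2)^n"]) (auto simp: summable_geometric_iff)
  then have "(\<Sum>i\<in>{n}. ?f i) \<le> suminf ?f"
    by (rule sum_le_suminf) auto
  then show ?thesis
    by (simp add: dist_fun_def)
qed

context block_words
begin

text \<open>The code of \<open>y = susp c t\<close> consists of the phase \<open>t\<close>, rounded,
  and of a window of \<open>c\<close>. In \<open>n\<close> steps the orbit passes only about
  \<open>speed * n\<close> cells, which brings the factor \<open>speed\<close> into the
  entropy.\<close>

lemma covered_Y_step:
  fixes n N k :: nat
  assumes A: "finite A" and d: "d > 0"
    and close: "\<forall>z z' :: complex \<times> (int \<Rightarrow> real).
      dist (fst z) (fst z') \<le> d \<longrightarrow> (\<forall>i. \<bar>i\<bar> \<le> int N \<longrightarrow> dist (snd z i) (snd z' i) \<le> d) \<longrightarrow> dist z z' \<le> \<delta>"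
  shows "covered Y (\<lambda>i. flow (of_int i)) n \<delta> (real (nat \<lfloor>4 * pi / d\<rfloor> + 1) *
    real (p k * (card A ^ r k) ^ ((nat \<lceil>speed * real n\<rceil> + (2 * N + 4)) div p k + 2)))"
proof -
  define e where "e = d / (4 * pi)"
  have e: "e > 0" "1 / e = 4 * pi / d"
    using d by (auto simp: e_def)
  \<comment> \<open>The samples are \<open>t + speed * i + m / 2\<close> with \<open>i < n\<close>
    and \<open>\<bar>m\<bar> \<le> N\<close>: they lie between \<open>- N\<close> and
    \<open>speed * n + N + 1\<close>, inside the window of length \<open>L\<close> that starts at
    \<open>s\<close>.\<close>
  define L where "L = nat \<lceil>speed * real n\<rceil> + (2 * N + 4)"
  define s where "s = - int N - 1"
  let ?W = "{s..<s + int L}"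
  define rep where "rep y = (SOME z. fst z \<in> C \<and> 0 \<le> snd z \<and> snd z < 1 \<and> y = susp (fst z) (snd z))" for y
  have rep: "fst (rep y) \<in> C" "0 \<le> snd (rep y)" "snd (rep y) < 1" "y = susp (fst (rep y)) (snd (rep y))"
    if y: "y \<in> Y" for y
  proof -
    obtain c t where "c \<in> C" "0 \<le> t" "t < 1" "y = susp c t"
      using y by (rule Y_rep)
    then have "\<exists>z. fst z \<in> C \<and> 0 \<le> snd z \<and> snd z < 1 \<and> y = susp (fst z) (snd z)"
      by (intro exI[of _ "(c, t)"]) simp
    then have "fst (rep y) \<in> C \<and> 0 \<le> snd (rep y) \<and> snd (rep y) < 1 \<and> y = susp (fst (rep y)) (snd (rep y))"
      unfolding rep_def by (rule someI_ex)
    then show "fst (rep y) \<in> C" "0 \<le> snd (rep y)" "snd (rep y) < 1" "y = susp (fst (rep y)) (snd (rep y))"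
      by blast+
  qed
  define code where "code y = (\<lfloor>snd (rep y) / e\<rfloor>, restrict (fst (rep y)) ?W)" for y
  let ?T = "{0..\<lfloor>1 / e\<rfloor>} \<times> (\<lambda>c. restrict c ?W) ` C"
  have finT: "finite ?T"
    using card_windows(1)[OF A] by (intro finite_cartesian_product) auto
  have sub: "code ` Y \<subseteq> ?T"
  proof (rule image_subsetI)
    fix y assume y: "y \<in> Y"
    have "0 \<le> snd (rep y) / e"
      using rep(2)[OF y] e(1) by simp
    moreover have "snd (rep y) / e \<le> 1 / e"
      using rep(3)[OF y] e(1) by (intro divide_right_mono) auto
    ultimately have "\<lfloor>snd (rep y) / e\<rfloor> \<in> {0..\<lfloor>1 / e\<rfloor>}"
      by (auto intro: floor_mono)
    then show "code y \<in> ?T"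
      using rep(1)[OF y] by (simp add: code_def)
  qed
  have "card (code ` Y) \<le> card ?T"
    using finT sub by (rule card_mono)
  also have "card ?T = card {0..\<lfloor>1 / e\<rfloor>} * card ((\<lambda>c. restrict c ?W) ` C)"
    by (rule card_cartesian_product)
  also have "\<dots> \<le> (nat \<lfloor>4 * pi / d\<rfloor> + 1) * (p k * (card A ^ r k) ^ (L div p k + 2))"
  proof (rule mult_le_mono)
    show "card {0..\<lfloor>1 / e\<rfloor>} \<le> nat \<lfloor>4 * pi / d\<rfloor> + 1"
      using d by (simp add: e(2) nat_add_distrib)
    show "card ((\<lambda>c. restrict c ?W) ` C) \<le> p k * (card A ^ r k) ^ (L div p k + 2)"
      by (rule card_windows(2)[OF A])
  qed
  finally have "real (card (code ` Y)) \<le> real ((nat \<lfloor>4 * pi / d\<rfloor> + 1) * (p k * (card A ^ r k) ^ (L div p k + 2)))"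
    by (simp only: of_nat_le_iff)
  then have card: "real (card (code ` Y)) \<le> real (nat \<lfloor>4 * pi / d\<rfloor> + 1) * real (p k * (card A ^ r k) ^ (L div p k + 2))"
    by (simp only: of_nat_mult)
  have "covered Y (\<lambda>i. flow (of_int i)) n \<delta> (real (nat \<lfloor>4 * pi / d\<rfloor> + 1) * real (p k * (card A ^ r k) ^ (L div p k + 2)))"
  proof (rule covered_code[of code])
    show "finite (code ` Y)"
      using sub finT by (rule finite_subset)
    fix y y' i assume y: "y \<in> Y" "y' \<in> Y" "code y = code y'" and i: "i < n"
    define c t c' t' where "c = fst (rep y)" and "t = snd (rep y)" and "c' = fst (rep y')" and "t' = snd (rep y')"
    have ct: "c \<in> C" "0 \<le> t" "t < 1" "y = susp c t" "c' \<in> C" "0 \<le> t'" "t' < 1" "y' = susp c' t'"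
      using rep[OF y(1)] rep[OF y(2)] by (simp_all add: c_def t_def c'_def t'_def)
    have fl: "flow (of_int (int i)) y = susp c (t + speed * real i)" "flow (of_int (int i)) y' = susp c' (t' + speed * real i)"
      unfolding ct(4,8) using flow_susp ct(1,5) by auto
    have "\<lfloor>t / e\<rfloor> = \<lfloor>t' / e\<rfloor>"
      using y(3) by (simp add: code_def t_def t'_def)
    then have "\<bar>t / e - t' / e\<bar> < 1"
      by linarith
    then have tt: "\<bar>t - t'\<bar> < e"
      using e(1) by (simp add: field_simps flip: diff_divide_distrib)
    have win: "c j = c' j" if "j \<in> ?W" for j
    proof -
      have "restrict c ?W = restrict c' ?W"
        using y(3) by (simp add: code_def c_def c'_def)
      then show ?thesis
        using that by (metis restrict_apply')
    qed
    have pe: "4 * pi * \<bar>t - t'\<bar> \<le> d" "pi * \<bar>t - t'\<bar> \<le> d / 2"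
    proof -
      have "4 * pi * \<bar>t - t'\<bar> \<le> 4 * pi * e"
        using tt by (intro mult_left_mono) auto
      then show "4 * pi * \<bar>t - t'\<bar> \<le> d"
        by (simp add: e_def)
      then show "pi * \<bar>t - t'\<bar> \<le> d / 2"
        using d by simp
    qed
    have "dist (fst (flow (of_int (int i)) y)) (fst (flow (of_int (int i)) y')) \<le> d"
      using cis_lipschitz[of "t + speed * real i" "t' + speed * real i"] pe(1) unfolding fl by (simp add: susp_def)
    moreover have "dist (snd (flow (of_int (int i)) y) m) (snd (flow (of_int (int i)) y') m) \<le> d"
      if m: "\<bar>m\<bar> \<le> int N" for m
    proof -
      define x where "x = t + speed * real i + of_int m / 2"
      define x' where "x' = t' + speed * real i + of_int m / 2"
      have "speed * real i \<le> speed * real n"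
        using i speed_bounds by (intro mult_left_mono) auto
      then have "speed * real i \<le> real (nat \<lceil>speed * real n\<rceil>)"
        by (meson order_trans real_nat_ceiling_ge)
      moreover have "0 \<le> speed * real i"
        using speed_bounds by simp
      moreover have "- real N \<le> of_int m" "of_int m \<le> real N"
        using m by (metis abs_le_iff minus_le_iff of_int_le_iff of_int_minus of_int_of_nat_eq)+
      ultimately have "- real N \<le> x'" "x' < real (nat \<lceil>speed * real n\<rceil>) + real N + 1"
        using ct(6,7) unfolding x'_def by linarith+
      then have "\<lfloor>x'\<rfloor> \<in> ?W"
        unfolding s_def L_def by (auto simp: le_floor_iff floor_less_iff)
      then have "\<bar>c \<lfloor>x'\<rfloor> - c' \<lfloor>x'\<rfloor>\<bar> \<le> d / 2"
        using win d by simp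
      moreover have "pi * \<bar>x - x'\<bar> \<le> d / 2"
        using pe(2) by (simp add: x_def x'_def)
      ultimately have "dist (sig c x) (sig c' x') \<le> d"
        using C_unit[OF ct(1)] by (intro dist_susp_coord)
      then show ?thesis
        unfolding fl by (simp add: susp_def x_def x'_def)
    qed
    ultimately show "dist (flow (of_int (int i)) y) (flow (of_int (int i)) y') \<le> \<delta>"
      using close by blast
  qed (fact card)
  then show ?thesis
    by (simp only: L_def)
qed

lemma covered_Y:
  assumes A: "finite A" and P: "(\<lambda>k. real (r k) / real (p k)) \<longlonglongrightarrow> P"
    and "\<delta> > 0" and h': "speed * P * ln (real (card A)) < h'"
  shows "eventually (\<lambda>n. covered Y (\<lambda>i. flow (of_int i)) n \<delta> (exp (h' * real n))) sequentially"
proof -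
  obtain N :: nat and d where d: "d > 0"
    and close: "\<forall>z z' :: complex \<times> (int \<Rightarrow> real).
      dist (fst z) (fst z') \<le> d \<longrightarrow> (\<forall>i. \<bar>i\<bar> \<le> int N \<longrightarrow> dist (snd z i) (snd z' i) \<le> d) \<longrightarrow> dist z z' \<le> \<delta>"
    by (rule dist_pair_fun_close[OF assms(3)])
  have "(\<lambda>k. speed * (real (r k) / real (p k)) * ln (real (card A))) \<longlonglongrightarrow> speed * P * ln (real (card A))"
    by (intro tendsto_intros P)
  then have "eventually (\<lambda>k. speed * (real (r k) / real (p k)) * ln (real (card A)) < h') sequentially"
    using h' by (rule order_tendstoD)
  then obtain k where k: "speed * (real (r k) / real (p k)) * ln (real (card A)) < h'"
    using eventually_happens'[OF sequentially_bot] by blast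
  \<comment> \<open>At the fixed order \<open>k\<close> the logarithm of the number of cells is at
    most \<open>a * n + b\<close>; as \<open>a < h'\<close>, the constant \<open>b\<close> is
    absorbed for large \<open>n\<close>.\<close>
  define a where "a = speed * (real (r k) / real (p k)) * ln (real (card A))"
  have ka: "a < h'"
    using k by (simp only: a_def)
  define K0 where "K0 = real (nat \<lfloor>4 * pi / d\<rfloor> + 1)"
  define b where "b = ln K0 + ln (real (p k)) + real (r k) * ln (real (card A)) * (real (2 * N + 5) / real (p k) + 2)"
  have A1: "card A \<ge> 1"
    using A A_two by (metis One_nat_def Suc_le_eq card_gt_0_iff empty_iff)
  have K0: "K0 > 0"
    by (simp add: K0_def)
  have "eventually (\<lambda>n. b / (h' - a) \<le> real n) sequentially"
    by (metis eventually_sequentiallyI linorder_le_cases nat_ceiling_le_eq)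
  then show ?thesis
  proof eventually_elim
    case (elim n)
    define M where "M = (nat \<lceil>speed * real n\<rceil> + (2 * N + 4)) div p k + 2"
    have "real M \<le> real (nat \<lceil>speed * real n\<rceil> + (2 * N + 4)) / real (p k) + 2"
      unfolding M_def using of_nat_div_le_of_nat[of "nat \<lceil>speed * real n\<rceil> + (2 * N + 4)" "p k", where ?'a = real] by simp
    also have "\<dots> \<le> (speed * real n + real (2 * N + 5)) / real (p k) + 2"
    proof -
      have "real (nat \<lceil>speed * real n\<rceil>) \<le> speed * real n + 1"
      proof -
        have "0 \<le> speed * real n"
          using speed_bounds by simp
        then show ?thesis
          by linarith
      qed
      then show ?thesis
        by (intro add_right_mono divide_right_mono) auto
    qed
    finally have M: "real M \<le> (speed * real n + real (2 * N + 5)) / real (p k) + 2" .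
    have "ln (K0 * real (p k * (card A ^ r k) ^ M)) = ln K0 + ln (real (p k)) + real (r k) * ln (real (card A)) * real M"
      using K0 A1 by (simp add: ln_mult ln_realpow power_mult[symmetric])
    also have "\<dots> \<le> ln K0 + ln (real (p k)) + real (r k) * ln (real (card A)) *
        ((speed * real n + real (2 * N + 5)) / real (p k) + 2)"
      using A1 by (intro add_left_mono mult_left_mono[OF M]) auto
    also have "\<dots> = a * real n + b"
      by (simp add: a_def b_def field_simps)
    also have "\<dots> \<le> h' * real n"
    proof -
      have "b \<le> real n * (h' - a)"
        using elim ka by (simp add: pos_divide_le_eq)
      then show ?thesis
        by (simp add: algebra_simps)
    qed
    finally have "ln (K0 * real (p k * (card A ^ r k) ^ M)) \<le> h' * real n" .
    moreover have "K0 * real (p k * (card A ^ r k) ^ M) > 0"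
      using K0 A1 by simp
    ultimately have "K0 * real (p k * (card A ^ r k) ^ M) \<le> exp (h' * real n)"
      by (metis exp_le_cancel_iff exp_ln)
    then show ?case
      using covered_Y_step[OF A d close, of n k] unfolding covered_def K0_def M_def by (meson order_trans)
  qed
qed

text \<open>Words that differ by \<open>\<eta>\<close> in position \<open>x\<close> are told apart
  when the orbit passes cell \<open>x\<close>: at some integer time it is in the middle half of the
  cell, where the bump is at least \<open>1/2\<close> and coordinate \<open>0\<close> shows half of
  the difference.\<close>

lemma separated_Y_step:
  assumes F: "finite F" "F \<subseteq> A" "\<eta> > 0" "\<And>a b. a \<in> F \<Longrightarrow> b \<in> F \<Longrightarrow> a \<noteq> b \<Longrightarrow> \<eta> \<le> \<bar>a - b\<bar>"
    and \<epsilon>: "\<epsilon> > 0" "\<And>z z' :: complex \<times> (int \<Rightarrow> real). dist z z' \<le> \<epsilon> \<Longrightarrow> \<bar>snd z 0 - snd z' 0\<bar> < \<eta> / 2"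
    and n: "real (p k) / speed \<le> real n"
  shows "\<exists>E. finite E \<and> separated Y (\<lambda>i. flow (of_int i)) n \<epsilon> E \<and> card E = card F ^ r k"
proof -
  obtain G where G: "finite G" "G \<subseteq> B k" "card G = card F ^ r k"
    and sepG: "\<forall>w\<in>G. \<forall>w'\<in>G. w \<noteq> w' \<longrightarrow> (\<exists>x. 0 \<le> x \<and> x < int (p k) \<and> \<eta> \<le> \<bar>w x - w' x\<bar>)"
    by (rule many_words[OF F])
  have "\<exists>c. c \<in> C \<and> agree (p k) c w" if "w \<in> G" for w
    using word_in_C that G(2) by (metis subsetD)
  then have "\<forall>w\<in>G. \<exists>c. c \<in> C \<and> agree (p k) c w"
    by blast
  then obtain c where c: "\<forall>w\<in>G. c w \<in> C \<and> agree (p k) (c w) w"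
    by (rule bchoice[THEN exE])
  define y where "y w = susp (c w) 0" for w
  have sep: "\<exists>i<n. dist (flow (of_int (int i)) (y w)) (flow (of_int (int i)) (y w')) > \<epsilon>"
    if w: "w \<in> G" "w' \<in> G" "w \<noteq> w'" for w w'
  proof -
    obtain x where x: "0 \<le> x" "x < int (p k)" "\<eta> \<le> \<bar>w x - w' x\<bar>"
      using sepG w by blast
    \<comment> \<open>The first integer time at which the position is at least
      \<open>x + 1/4\<close>; the overshoot is less than \<open>speed < 1/2\<close>, so the position
      is still below \<open>x + 3/4\<close>.\<close>
    define i where "i = nat \<lceil>(of_int x + 1/4) / speed\<rceil>"
    have i1: "(of_int x + 1/4) / speed \<le> real i"
      unfolding i_def by (rule real_nat_ceiling_ge)
    have "real i < (of_int x + 1/4) / speed + 1"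
    proof -
      have "0 \<le> (of_int x + 1/4) / speed"
        using x(1) speed_bounds by simp
      then show ?thesis
        unfolding i_def by linarith
    qed
    then have "speed * real i < speed * ((of_int x + 1/4) / speed + 1)"
      using speed_bounds by (intro mult_strict_left_mono) auto
    also have "speed * ((of_int x + 1/4) / speed + 1) = of_int x + 1/4 + speed"
    proof -
      have "speed * ((of_int x + 1/4) / speed) = of_int x + 1/4"
        using speed_bounds by (metis less_irrefl nonzero_mult_div_cancel_left times_divide_eq_right)
      then show ?thesis
        by (simp only: distrib_left[of speed _ 1] mult_1_right)
    qed
    finally have i2: "speed * real i < of_int x + 3/4"
      using speed_bounds by linarith
    have i3: "of_int x + 1/4 \<le> speed * real i"
      using i1 speed_bounds by (simp add: field_simps)
    have "i < n"
    proof -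
      have "of_int x + 1 \<le> real (p k)"
        using x(2) by linarith
      then have "speed * real i < real (p k)"
        using i2 by linarith
      also have "real (p k) \<le> speed * real n"
        using n speed_bounds by (simp add: field_simps)
      finally show ?thesis
        using speed_bounds by simp
    qed
    have fl: "\<lfloor>speed * real i\<rfloor> = x"
      using i2 i3 by (intro floor_unique) auto
    have half: "1/2 \<le> \<bar>sin (pi * (speed * real i))\<bar>"
    proof -
      define f where "f = speed * real i - of_int x"
      \<comment> \<open>The interval from \<open>1/6\<close> to \<open>5/6\<close> contains the
        middle half of the cell, and \<open>sin (pi * f) \<ge> 1/2\<close> holds on it.\<close>
      have f: "1/6 \<le> f" "f \<le> 5/6"
        using i2 i3 by (auto simp: f_def)
      have mono: "1/2 \<le> sin (pi * g)" if "1/6 \<le> g" "g \<le> 1/2" for g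
      proof -
        have "sin (pi / 6) \<le> sin (pi * g)"
          using that by (intro sin_monotone_2pi_le) auto
        then show ?thesis
          by (simp add: sin_30)
      qed
      have "1/2 \<le> sin (pi * f)"
      proof (cases "f \<le> 1/2")
        case True
        then show ?thesis
          using mono f by simp
      next
        case False
        then have "1/2 \<le> sin (pi * (1 - f))"
          using mono f by simp
        also have "sin (pi * (1 - f)) = sin (pi * f)"
          by (simp add: right_diff_distrib)
        finally show ?thesis .
      qed
      moreover have "\<bar>sin (pi * (speed * real i))\<bar> = \<bar>sin (pi * f)\<bar>"
        using abs_sin_pi_add_int[of f x] by (simp add: f_def)
      ultimately show ?thesis by simp
    qed
    have coord: "snd (flow (of_int (int i)) (y v)) 0 = \<bar>sin (pi * (speed * real i))\<bar> * v x" if "v \<in> G" for v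
    proof -
      have cv: "c v \<in> C" "agree (p k) (c v) v"
        using c that by auto
      have "flow (of_int (int i)) (y v) = susp (c v) (0 + speed * of_int (int i))"
        unfolding y_def by (rule flow_susp[OF cv(1)])
      moreover have "c v x = v x"
        using agreeD[OF cv(2) x(1,2)] .
      ultimately show ?thesis
        by (simp add: susp_def sig_def fl)
    qed
    have "\<eta> / 2 \<le> \<bar>sin (pi * (speed * real i))\<bar> * \<bar>w x - w' x\<bar>"
      using mult_mono[OF half x(3)] F(3) by simp
    then have "\<eta> / 2 \<le> \<bar>snd (flow (of_int (int i)) (y w)) 0 - snd (flow (of_int (int i)) (y w')) 0\<bar>"
      unfolding coord[OF w(1)] coord[OF w(2)] by (simp add: abs_mult flip: right_diff_distrib)
    then have "\<not> dist (flow (of_int (int i)) (y w)) (flow (of_int (int i)) (y w')) \<le> \<epsilon>"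
      using \<epsilon>(2)[of "flow (of_int (int i)) (y w)" "flow (of_int (int i)) (y w')"] by linarith
    then show ?thesis
      using \<open>i < n\<close> by (intro exI[of _ i]) simp
  qed
  have inj: "inj_on y G"
  proof (rule inj_onI, rule ccontr)
    fix w w' assume "w \<in> G" "w' \<in> G" "y w = y w'" "w \<noteq> w'"
    then show False
      using sep[of w w'] \<epsilon>(1) by auto
  qed
  have "separated Y (\<lambda>i. flow (of_int i)) n \<epsilon> (y ` G)"
    unfolding separated_def
  proof (intro conjI ballI impI)
    show "y ` G \<subseteq> Y"
      using c susp_in_Y by (auto simp: y_def)
    fix a b assume "a \<in> y ` G" "b \<in> y ` G" "a \<noteq> b"
    then obtain w w' where "w \<in> G" "w' \<in> G" "w \<noteq> w'" "a = y w" "b = y w'"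
      by blast
    then show "\<exists>i<n. dist (flow (of_int (int i)) a) (flow (of_int (int i)) b) > \<epsilon>"
      using sep by simp
  qed
  then show ?thesis
    using G(1,3) card_image[OF inj] by (intro exI[of _ "y ` G"]) simp
qed

lemma coord_close:
  assumes "\<eta> > 0"
  obtains \<epsilon> where "\<epsilon> > 0"
    "\<forall>z z' :: complex \<times> (int \<Rightarrow> real). dist z z' \<le> \<epsilon> \<longrightarrow> \<bar>snd z 0 - snd z' 0\<bar> < \<eta>"
proof -
  define m where "m = (1/2 :: real) ^ to_nat (0::int)"
  have m: "m > 0"
    by (simp add: m_def)
  define \<epsilon> where "\<epsilon> = m * min \<eta> 1 / 2"
  have "\<epsilon> > 0"
    using m assms by (simp add: \<epsilon>_def)
  moreover have "\<bar>snd z 0 - snd z' 0\<bar> < \<eta>" if z: "dist z z' \<le> \<epsilon>" for z z' :: "complex \<times> (int \<Rightarrow> real)"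
  proof -
    have "m * min (dist (snd z 0) (snd z' 0)) 1 \<le> dist (snd z) (snd z')"
      using dist_fun_ge[of "to_nat (0::int)" "snd z" "snd z'"] by (simp add: m_def)
    also have "\<dots> \<le> dist z z'"
      by (rule dist_snd_le)
    also have "\<dots> < m * min \<eta> 1"
      using z \<open>\<epsilon> > 0\<close> by (simp add: \<epsilon>_def)
    finally have "min (dist (snd z 0) (snd z' 0)) 1 < min \<eta> 1"
      using m by (simp only: mult_less_cancel_left_pos)
    then show ?thesis
      by (auto simp: dist_real_def min_def split: if_splits)
  qed
  ultimately show ?thesis
    using that by blast
qed

text \<open>The separated sets are found at the times \<open>n\<close> about
  \<open>p k / speed\<close>, which suffice to run through a block of order \<open>k\<close>; a
  density above \<open>P\<close> gives at least \<open>P * p k\<close> free positions.\<close>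

lemma separated_Y:
  assumes P: "\<And>k. P < real (r k) / real (p k)"
    and F: "finite F" "F \<subseteq> A" "F \<noteq> {}" "\<eta> > 0" "\<And>a b. a \<in> F \<Longrightarrow> b \<in> F \<Longrightarrow> a \<noteq> b \<Longrightarrow> \<eta> \<le> \<bar>a - b\<bar>"
    and h: "h < speed * P * ln (real (card F))"
  obtains \<epsilon> where "\<epsilon> > 0" "frequently (\<lambda>n. \<exists>E. finite E \<and> separated Y (\<lambda>i. flow (of_int i)) n \<epsilon> E \<and>
    exp (h * real n) \<le> real (card E)) sequentially"
proof -
  obtain \<epsilon> where \<epsilon>: "\<epsilon> > 0"
    "\<forall>z z' :: complex \<times> (int \<Rightarrow> real). dist z z' \<le> \<epsilon> \<longrightarrow> \<bar>snd z 0 - snd z' 0\<bar> < \<eta> / 2"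
    by (rule coord_close[of "\<eta> / 2"]) (use F(4) in simp)
  define b where "b = ln (real (card F))"
  have F1: "card F \<ge> 1"
    using F(1,3) by (simp add: Suc_le_eq card_gt_0_iff)
  have b: "b \<ge> 0"
    using F1 by (simp add: b_def)
  have "\<exists>n\<ge>m. \<exists>E. finite E \<and> separated Y (\<lambda>i. flow (of_int i)) n \<epsilon> E \<and> exp (h * real n) \<le> real (card E)" for m
  proof -
    \<comment> \<open>Rounding \<open>p k / speed\<close> up to an integer costs at most
      \<open>h1\<close> in the exponent, and nothing if \<open>h\<close> is negative.\<close>
    define h1 where "h1 = max h 0"
    have "h / speed < P * b"
      using h speed_bounds by (simp add: b_def field_simps)
    obtain k0 :: nat where k0: "h1 / (P * b - h / speed) < real k0"
      using reals_Archimedean2 by blast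
    define k where "k = k0 + m"
    have pk: "real k0 \<le> real (p k)" "real m \<le> real (p k)"
      using less_p[of k] by (auto simp: k_def)
    define n where "n = nat \<lceil>real (p k) / speed\<rceil>"
    have n1: "real (p k) / speed \<le> real n"
      unfolding n_def by (rule real_nat_ceiling_ge)
    have n2: "real n \<le> real (p k) / speed + 1"
    proof -
      have "0 \<le> real (p k) / speed"
        using speed_bounds by simp
      then show ?thesis
        unfolding n_def by linarith
    qed
    have "real (p k) \<le> real (p k) / speed"
      using speed_bounds by (simp add: field_simps)
    then have "m \<le> n"
      using pk(2) n1 by linarith
    obtain E where E: "finite E" "separated Y (\<lambda>i. flow (of_int i)) n \<epsilon> E" "card E = card F ^ r k"
      using separated_Y_step[OF F(1,2,4,5) \<epsilon>(1) \<epsilon>(2)[rule_format] n1] by blast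
    have "h * real n \<le> h * (real (p k) / speed) + h1"
    proof (cases "h \<ge> 0")
      case True
      then have "h * real n \<le> h * (real (p k) / speed + 1)"
        by (intro mult_left_mono n2)
      then show ?thesis
        using True by (simp add: h1_def distrib_left)
    next
      case False
      then have "h * real n \<le> h * (real (p k) / speed)"
        by (intro mult_left_mono_neg n1) simp
      then show ?thesis
        using False by (simp add: h1_def)
    qed
    also have "\<dots> \<le> P * b * real (p k)"
    proof -
      have "h1 < real k0 * (P * b - h / speed)"
        using k0 \<open>h / speed < P * b\<close> by (simp add: divide_less_eq)
      also have "\<dots> \<le> real (p k) * (P * b - h / speed)"
        using pk(1) \<open>h / speed < P * b\<close> by (intro mult_right_mono) auto
      finally show ?thesis
        by (simp add: algebra_simps)
    qed
    also have "\<dots> \<le> real (r k) * b"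
    proof -
      have "P * real (p k) \<le> real (r k)"
        using P[of k] by (simp add: field_simps less_imp_le)
      then have "P * real (p k) * b \<le> real (r k) * b"
        using b by (rule mult_right_mono)
      then show ?thesis
        by (simp add: algebra_simps)
    qed
    finally have "exp (h * real n) \<le> exp (real (r k) * b)"
      by simp
    also have "\<dots> = real (card E)"
      using F1 by (simp add: E(3) b_def exp_of_nat_mult)
    finally show ?thesis
      using E \<open>m \<le> n\<close> by blast
  qed
  then have "frequently (\<lambda>n. \<exists>E. finite E \<and> separated Y (\<lambda>i. flow (of_int i)) n \<epsilon> E \<and>
      exp (h * real n) \<le> real (card E)) sequentially"
    by (simp add: frequently_sequentially)
  then show ?thesis
    by (rule that[OF \<epsilon>(1)])
qed

end

section \<open>Realisation over one carrier type, and choice of the alphabet\<close>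

definition encode :: "(complex \<times> (int \<Rightarrow> real)) \<times> (int \<Rightarrow> real) \<Rightarrow> nat \<Rightarrow> real" where
  "encode z n = (case prod_decode n of (i, j) \<Rightarrow>
     if i = 0 then Re (fst (fst z)) else if i = 1 then Im (fst (fst z))
     else if i = 2 then snd (fst z) (from_nat j) else snd z (from_nat j))"

lemma inj_encode: "inj encode"
proof (rule injI)
  fix z z' assume eq: "encode z = encode z'"
  have "encode z (prod_encode (i, j)) = encode z' (prod_encode (i, j))" for i j
    using eq by simp
  note * = this[unfolded encode_def prod_encode_inverse prod.case]
  have "Re (fst (fst z)) = Re (fst (fst z'))" "Im (fst (fst z)) = Im (fst (fst z'))"
    using *[of 0 0] *[of 1 0] by simp_all
  moreover have "snd (fst z) m = snd (fst z') m" "snd z m = snd z' m" for m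
    using *[of 2 "to_nat m"] *[of 3 "to_nat m"] by simp_all
  ultimately show "z = z'"
    by (simp add: prod_eq_iff complex_eq_iff fun_eq_iff)
qed

lemma slovak_of_block_words:
  fixes A :: "real set"
  assumes "block_words A B p q l r u" and P: "(\<lambda>k. real (r k) / real (p k)) \<longlonglongrightarrow> P"
    and P_less: "\<And>k. P < real (r k) / real (p k)"
  obtains X :: "(nat \<Rightarrow> real) metric" where "slovak_space X"
    "finite A \<Longrightarrow> slovak_entropy X \<le> ereal (speed * P * ln (real (card A)))"
    "\<And>F \<eta> h. finite F \<Longrightarrow> F \<subseteq> A \<Longrightarrow> F \<noteq> {} \<Longrightarrow> \<eta> > 0 \<Longrightarrow>
      (\<forall>a\<in>F. \<forall>b\<in>F. a \<noteq> b \<longrightarrow> \<eta> \<le> \<bar>a - b\<bar>) \<Longrightarrow> h < speed * P * ln (real (card F)) \<Longrightarrow>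
      ereal h \<le> slovak_entropy X"
proof -
  interpret block_words A B p q l r u
    by fact
  obtain c where "c \<in> C"
    using C_nonempty by blast
  then have "susp c 0 \<in> Y"
    by (rule susp_in_Y)
  then interpret F: minimal_flow Y flow "susp c 0"
    by (rule minimal_flow_Y)
  have tm: "F.time_map = (\<lambda>i. flow (of_int i))"
    by (simp add: fun_eq_iff F.time_map_def)
  have e: "inj_on encode F.Z"
    using inj_encode by (rule inj_on_subset) simp
  show ?thesis
  proof (rule that)
    show "slovak_space (image_metric encode F.Z)"
      by (rule F.slovak_of_flow(1)[OF e])
    show "slovak_entropy (image_metric encode F.Z) \<le> ereal (speed * P * ln (real (card A)))" if "finite A"
      by (rule F.slovak_of_flow(2)[OF e]) (unfold tm, rule covered_Y[OF that P])
    show "ereal h \<le> slovak_entropy (image_metric encode F.Z)"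
      if a: "finite E" "E \<subseteq> A" "E \<noteq> {}" "\<eta> > 0" "\<forall>a\<in>E. \<forall>b\<in>E. a \<noteq> b \<longrightarrow> \<eta> \<le> \<bar>a - b\<bar>"
        "h < speed * P * ln (real (card E))" for E \<eta> h
    proof -
      obtain \<epsilon> where \<epsilon>: "\<epsilon> > 0" "frequently (\<lambda>n. \<exists>E. finite E \<and> separated Y (\<lambda>i. flow (of_int i)) n \<epsilon> E \<and>
          exp (h * real n) \<le> real (card E)) sequentially"
        by (rule separated_Y[OF P_less a(1-4) _ a(6)]) (use a(5) in blast)
      show ?thesis
        by (rule F.slovak_of_flow(3)[OF e \<epsilon>(1)]) (unfold tm, rule \<epsilon>(2))
    qed
  qed
qed

text \<open>An alphabet of \<open>a\<close> symbols allows all entropies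
  \<open>speed * P * ln a\<close> with \<open>0 \<le> P < 1\<close>; \<open>a\<close> is taken so
  large that the required \<open>P\<close> is below \<open>1\<close>. For \<open>s = 0\<close> the
  limit density is \<open>0\<close>, although every order has free positions.\<close>

lemma slovak_finite_entropy:
  assumes "0 \<le> s"
  shows "\<exists>X :: (nat \<Rightarrow> real) metric. slovak_space X \<and> slovak_entropy X = ereal s"
proof -
  obtain a0 :: nat where a0: "exp (s / speed) < real a0"
    using reals_Archimedean2 by blast
  define a where "a = a0 + 2"
  have a: "exp (s / speed) < real a" "a \<ge> 2"
    using a0 by (auto simp: a_def)
  then have ln_a: "s / speed < ln (real a)" "ln (real a) > 0"
    using exp_less_cancel_iff[of "s / speed" "ln (real a)"] by auto
  define P where "P = s / (speed * ln (real a))"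
  have P: "0 \<le> P" "P < 1"
    using ln_a speed_bounds assms by (auto simp: P_def field_simps)
  have Ps: "speed * P * ln (real a) = s"
    using ln_a speed_bounds by (simp add: P_def)
  define A where "A = (\<lambda>i. real i / real a) ` {..<a}"
  have "inj_on (\<lambda>i. real i / real a) {..<a}"
    using a(2) by (auto simp: inj_on_def)
  then have cardA: "card A = a"
    by (simp add: A_def card_image)
  have finA: "finite A"
    by (simp add: A_def)
  have gap: "\<forall>x\<in>A. \<forall>y\<in>A. x \<noteq> y \<longrightarrow> 1 / real a \<le> \<bar>x - y\<bar>"
  proof (intro ballI impI)
    fix x y assume "x \<in> A" "y \<in> A" "x \<noteq> y"
    then obtain i j where ij: "x = real i / real a" "y = real j / real a" "i \<noteq> j"
      by (auto simp: A_def)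
    have "1 \<le> \<bar>real i - real j\<bar>"
      using ij(3) by linarith
    then have "1 / real a \<le> \<bar>real i - real j\<bar> / real a"
      by (intro divide_right_mono) auto
    then show "1 / real a \<le> \<bar>x - y\<bar>"
      by (simp add: ij(1,2) flip: diff_divide_distrib)
  qed
  have two: "\<exists>x\<in>A. \<exists>y\<in>A. x \<noteq> y"
  proof -
    have "real 0 / real a \<in> A" "real 1 / real a \<in> A"
      unfolding A_def using a(2) by (intro imageI; simp)+
    then show ?thesis
      using a(2) by (intro bexI[of _ "real 0 / real a"] bexI[of _ "real 1 / real a"]) auto
  qed
  have "A \<subseteq> {0..1}"
    using a(2) by (auto simp: A_def)
  then obtain B p q l r u where bw: "block_words A B p q l r u"
    "(\<lambda>k. real (r k) / real (p k)) \<longlonglongrightarrow> P" "\<And>k. P < real (r k) / real (p k)"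
    using block_words_exist[of A P] finite_imp_closed[OF finA] countable_finite[OF finA] two P by blast
  obtain X :: "(nat \<Rightarrow> real) metric" where X: "slovak_space X"
    "finite A \<Longrightarrow> slovak_entropy X \<le> ereal (speed * P * ln (real (card A)))"
    "\<And>F \<eta> h. finite F \<Longrightarrow> F \<subseteq> A \<Longrightarrow> F \<noteq> {} \<Longrightarrow> \<eta> > 0 \<Longrightarrow>
      (\<forall>a\<in>F. \<forall>b\<in>F. a \<noteq> b \<longrightarrow> \<eta> \<le> \<bar>a - b\<bar>) \<Longrightarrow> h < speed * P * ln (real (card F)) \<Longrightarrow>
      ereal h \<le> slovak_entropy X"
    using slovak_of_block_words[OF bw] by blast
  have "slovak_entropy X \<le> ereal s"
    using X(2)[OF finA] by (simp add: cardA Ps)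
  moreover have lower: "ereal h \<le> slovak_entropy X" if "h < s" for h
    by (rule X(3)[OF finA subset_refl _ _ gap]) (use that two a in \<open>auto simp: cardA Ps\<close>)
  have "ereal s \<le> slovak_entropy X"
  proof (rule ccontr)
    assume "\<not> ereal s \<le> slovak_entropy X"
    then obtain h where "slovak_entropy X < ereal h" "ereal h < ereal s"
      using ereal_dense2[of "slovak_entropy X" "ereal s"] by (auto simp: not_le)
    then show False
      using lower[of h] by simp
  qed
  ultimately show ?thesis
    using X(1) by (intro exI[of _ X]) (simp add: antisym)
qed

text \<open>A convergent sequence with its limit is a compact countable alphabet with arbitrarily
  large finite subsets; at the fixed density \<open>1/2\<close> a subset of \<open>m\<close> symbols
  forces entropy at least \<open>speed * ln m / 2\<close>.\<close>

lemma slovak_infinite_entropy: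
  "\<exists>X :: (nat \<Rightarrow> real) metric. slovak_space X \<and> slovak_entropy X = \<infinity>"
proof -
  define A where "A = insert 0 (range (\<lambda>n. 1 / real (Suc n)))"
  have "compact A"
    unfolding A_def by (rule compact_sequence_with_limit[OF LIMSEQ_Suc[OF lim_inverse_n']])
  then have "closed A"
    by (rule compact_imp_closed)
  moreover have "A \<subseteq> {0..1}" "countable A"
    by (auto simp: A_def)
  moreover have "\<exists>x\<in>A. \<exists>y\<in>A. x \<noteq> y"
  proof -
    have "0 \<in> A" "1 / real (Suc 0) \<in> A"
      unfolding A_def by blast+
    moreover have "0 \<noteq> 1 / real (Suc 0)"
      by simp
    ultimately show ?thesis by blast
  qed
  moreover have "(0::real) \<le> 1/2" "(1/2::real) < 1"
    by simp_all
  ultimately obtain B p q l r u where bw: "block_words A B p q l r u"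
    "(\<lambda>k. real (r k) / real (p k)) \<longlonglongrightarrow> 1/2" "\<And>k. 1/2 < real (r k) / real (p k)"
    using block_words_exist[of A "1/2"] by blast
  obtain X :: "(nat \<Rightarrow> real) metric" where X: "slovak_space X"
    "finite A \<Longrightarrow> slovak_entropy X \<le> ereal (speed * (1/2) * ln (real (card A)))"
    "\<And>F \<eta> h. finite F \<Longrightarrow> F \<subseteq> A \<Longrightarrow> F \<noteq> {} \<Longrightarrow> \<eta> > 0 \<Longrightarrow>
      (\<forall>a\<in>F. \<forall>b\<in>F. a \<noteq> b \<longrightarrow> \<eta> \<le> \<bar>a - b\<bar>) \<Longrightarrow> h < speed * (1/2) * ln (real (card F)) \<Longrightarrow>
      ereal h \<le> slovak_entropy X"
    using slovak_of_block_words[OF bw] by blast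
  have "ereal h \<le> slovak_entropy X" for h
  proof -
    obtain m0 :: nat where m0: "exp (2 * h / speed) < real m0"
      using reals_Archimedean2 by blast
    define m where "m = Suc m0"
    have m: "exp (2 * h / speed) < real m" "m > 0"
      using m0 by (auto simp: m_def)
    then have "2 * h / speed < ln (real m)"
      using exp_less_cancel_iff[of "2 * h / speed" "ln (real m)"] by simp
    then have h: "h < speed * (1/2) * ln (real m)"
      using speed_bounds by (simp add: field_simps)
    define F where "F = (\<lambda>n. 1 / real (Suc n)) ` {..<m}"
    have cardF: "card F = m"
      unfolding F_def by (subst card_image) (auto simp: inj_on_def)
    \<comment> \<open>Different reciprocals of integers up to \<open>m\<close> differ by at least
      \<open>1 / (m * m)\<close>, since the numerator of the difference is at least
      \<open>1\<close>.\<close>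
    have gap: "\<forall>x\<in>F. \<forall>y\<in>F. x \<noteq> y \<longrightarrow> 1 / (real m * real m) \<le> \<bar>x - y\<bar>"
    proof (intro ballI impI)
      fix x y assume "x \<in> F" "y \<in> F" "x \<noteq> y"
      then obtain i j where ij: "x = 1 / real (Suc i)" "y = 1 / real (Suc j)" "i < m" "j < m" "i \<noteq> j"
        by (auto simp: F_def)
      have "x - y = (real (Suc j) - real (Suc i)) / (real (Suc i) * real (Suc j))"
        by (simp add: ij(1,2) field_simps)
      then have "\<bar>x - y\<bar> = \<bar>real (Suc j) - real (Suc i)\<bar> / (real (Suc i) * real (Suc j))"
        by (simp add: abs_mult)
      also have "\<dots> \<ge> 1 / (real m * real m)"
        using ij(3-5) by (intro frac_le mult_mono) auto
      finally show "1 / (real m * real m) \<le> \<bar>x - y\<bar>" .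
    qed
    show ?thesis
    proof (rule X(3)[OF _ _ _ _ gap])
      show "finite F" "F \<subseteq> A" "F \<noteq> {}"
        using m(2) by (auto simp: F_def A_def)
      show "0 < 1 / (real m * real m)"
        using m(2) by simp
      show "h < speed * (1/2) * ln (real (card F))"
        unfolding cardF by (rule h)
    qed
  qed
  then have "slovak_entropy X = \<infinity>"
    by (rule ereal_top)
  then show ?thesis
    using X(1) by blast
qed

theorem theorem5:
  shows "(\<exists>X :: (nat \<Rightarrow> real) metric. slovak_space X) \<and>
    (\<forall>s :: ereal. 0 \<le> s \<and> s \<le> \<infinity> \<longrightarrow>
      (\<exists>X :: (nat \<Rightarrow> real) metric. slovak_space X \<and> slovak_entropy X = s))"
proof (intro conjI allI impI)
  show "\<exists>X :: (nat \<Rightarrow> real) metric. slovak_space X"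
    using slovak_infinite_entropy by blast
  fix s :: ereal assume "0 \<le> s \<and> s \<le> \<infinity>"
  then show "\<exists>X :: (nat \<Rightarrow> real) metric. slovak_space X \<and> slovak_entropy X = s"
    using slovak_infinite_entropy slovak_finite_entropy by (cases s) auto
qed

end
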